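(* Let $p(\cdot)\in\mathcal{P}(\mathbb{R}^n)\cap LH(\mathbb{R}^n)$ with $p_->1$ and let $W:\mathbb{R}^n\to\mathcal{S}_d$ be a matrix weight. Suppose $W\in\mathcal{A}_{p(\cdot)}$. Then there exists $r>1$ such that for all $s\in[1,r]$, if $q(\cdot)$ is the exponent function defined by $q'(\cdot)=s\,p'(\cdot)$, then $W\in\mathcal{A}_{q(\cdot)}$.
   Context: Cubes in $\mathbb{R}^n$ have sides parallel to the coordinate axes. $\mathcal{P}(\mathbb{R}^n)$ is the set of exponent functions, i.e. Lebesgue measurable $p(\cdot):\mathbb{R}^n\to[1,\infty]$; $p_+=\operatorname{ess\,sup}_{\mathbb{R}^n}p$, $p_-=\operatorname{ess\,inf}_{\mathbb{R}^n}p$. The conjugate exponent $p'(\cdot)$ satisfies $\frac1{p(x)}+\frac1{p'(x)}=1$ (with $1/\infty=0$); likewise $q'(\cdot)$ is the conjugate exponent of $q(\cdot)$. With $\Omega_\infty=\{x:p(x)=\infty\}$, the modular is $\rho_{p(\cdot)}(f)=\int_{\mathbb{R}^n\setminus\Omega_\infty}|f(x)|^{p(x)}dx+\|f\|_{L^\infty(\Omega_\infty)}$ and the norm is $\|f\|_{L^{p(\cdot)}(\mathbb{R}^n)}=\inf\{\lambda>0:\rho_{p(\cdot)}(f/\lambda)\le1\}$. A subscript ($L^{p(\cdot)}_x$, $L^{p(\cdot)}_y$) indicates the variable in which the norm is taken. Log-Hölder continuity: $u(\cdot):\mathbb{R}^n\to\mathbb{R}$ is in $LH(\mathbb{R}^n)$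 if there is $C_0$ with $|u(x)-u(y)|\le\frac{C_0}{-\log|x-y|}$ whenever $|x-y|<1/2$, and there are constants $C_\infty,u_\infty$ with $|u(x)-u_\infty|\le\frac{C_\infty}{\log(e+|x|)}$ for all $x$. $\mathcal{S}_d$ is the set of $d\times d$ self-adjoint positive semi-definite matrices and $|A|_{\mathrm{op}}=\sup_{\mathbf{e}\in\mathbb{R}^d,|\mathbf{e}|=1}|A\mathbf{e}|$. A matrix weight is a measurable $W:\mathbb{R}^n\to\mathcal{S}_d$ with $|W(\cdot)|_{\mathrm{op}}\in L^1_{\mathrm{loc}}(\mathbb{R}^n)$; it is invertible if it is positive definite a.e. For an exponent function $p(\cdot)$, $W\in\mathcal{A}_{p(\cdot)}$ means that $W$ is an invertible matrix weight with $$[W]_{\mathcal{A}_{p(\cdot)}}=\sup_Q|Q|^{-1}\Big\|\,\big\||W(x)W^{-1}(y)|_{\mathrm{op}}\chi_Q(y)\big\|_{L^{p'(\cdot)}_y(\mathbb{R}^n)}\chi_Q(x)\Big\|_{L^{p(\cdot)}_x(\mathbb{R}^n)}<\infty,$$ the supremum being over all cubes $Q\subset\mathbb{R}^n$. *)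

theory Defs
  imports "HOL-Analysis.Analysis" "HOL-Probability.Essential_Supremum"
begin

section \<open>Variable exponents\<close>

text \<open>Exponents take values in the extended half-line, so that the value \<open>\<infinity>\<close> is available.\<close>

definition exponent_function :: "(real^'n \<Rightarrow> ennreal) \<Rightarrow> bool" where
  "exponent_function p \<longleftrightarrow> p \<in> borel_measurable lebesgue \<and> (\<forall>x. 1 \<le> p x)"

text \<open>The essential infimum, dual to the library's \<^const>\<open>esssup\<close>
  (an upper limit along the filter of almost-everywhere statements).\<close>

definition exponent_minus :: "(real^'n \<Rightarrow> ennreal) \<Rightarrow> ennreal" where
  "exponent_minus p = Liminf (ae_filter lebesgue) p"

text \<open>The solution \<open>p'\<close> of \<open>1/p + 1/p' = 1\<close>. In \<^typ>\<open>ennreal\<close> one has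
  \<open>inverse 0 = \<infinity>\<close> and \<open>inverse \<infinity> = 0\<close>, so the endpoints \<open>1\<close> and \<open>\<infinity>\<close> are covered;
  see \<open>conj_exponent_unique\<close> below.\<close>

definition conj_exponent :: "(real^'n \<Rightarrow> ennreal) \<Rightarrow> real^'n \<Rightarrow> ennreal" where
  "conj_exponent p x = inverse (1 - inverse (p x))"

definition log_Hoelder :: "(real^'n \<Rightarrow> real) \<Rightarrow> bool" where
  "log_Hoelder u \<longleftrightarrow>
     (\<exists>C0. \<forall>x y. norm (x - y) < 1/2 \<longrightarrow> \<bar>u x - u y\<bar> \<le> C0 / (- ln (norm (x - y)))) \<and>
     (\<exists>Cinf uinf. \<forall>x. \<bar>u x - uinf\<bar> \<le> Cinf / ln (exp 1 + norm x))"

section \<open>The variable exponent Lebesgue norm\<close>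

text \<open>Modular and norm only see \<open>\<bar>f\<bar>\<close>, so they are defined on functions with values in
  \<open>[0,\<infinity>]\<close>. The value \<open>\<infinity>\<close> is needed because the outer norm in the \<open>\<A>\<close>-condition is applied
  to a function that is itself a (possibly infinite) norm.\<close>

definition ennreal_powr :: "ennreal \<Rightarrow> real \<Rightarrow> ennreal" where
  "ennreal_powr a t = (if a = \<infinity> then \<infinity> else ennreal (enn2real a powr t))"

definition modular :: "(real^'n \<Rightarrow> ennreal) \<Rightarrow> (real^'n \<Rightarrow> ennreal) \<Rightarrow> ennreal" where
  "modular p f =
     (\<integral>\<^sup>+x\<in>- {x. p x = \<infinity>}. ennreal_powr (f x) (enn2real (p x)) \<partial>lebesgue)
     + esssup (restrict_space lebesgue {x. p x = \<infinity>}) f"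

definition Lp_norm :: "(real^'n \<Rightarrow> ennreal) \<Rightarrow> (real^'n \<Rightarrow> ennreal) \<Rightarrow> ennreal" where
  "Lp_norm p f = Inf {ennreal l | l::real. l > 0 \<and> modular p (\<lambda>x. f x / ennreal l) \<le> 1}"

section \<open>Matrix weights\<close>

definition psd_matrices :: "(real^'d^'d) set" where
  "psd_matrices = {A. transpose A = A \<and> (\<forall>v. 0 \<le> v \<bullet> (A *v v))}"

definition pd_matrices :: "(real^'d^'d) set" where
  "pd_matrices = {A. transpose A = A \<and> (\<forall>v. v \<noteq> 0 \<longrightarrow> 0 < v \<bullet> (A *v v))}"

abbreviation op_norm :: "real^'d^'d \<Rightarrow> real" where
  "op_norm A \<equiv> onorm (\<lambda>v. A *v v)"

definition matrix_weight :: "(real^'n \<Rightarrow> real^'d^'d) \<Rightarrow> bool" where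
  "matrix_weight W \<longleftrightarrow>
     W \<in> borel_measurable lebesgue \<and> (\<forall>x. W x \<in> psd_matrices) \<and>
     (\<forall>K. compact K \<longrightarrow> set_integrable lebesgue K (\<lambda>x. op_norm (W x)))"

definition invertible_matrix_weight :: "(real^'n \<Rightarrow> real^'d^'d) \<Rightarrow> bool" where
  "invertible_matrix_weight W \<longleftrightarrow>
     matrix_weight W \<and> (AE x in lebesgue. W x \<in> pd_matrices)"

definition cubes :: "(real^'n) set set" where
  "cubes = {cbox a (a + (\<chi> i. l)) | a l. l > 0}"

definition A_const :: "(real^'n \<Rightarrow> ennreal) \<Rightarrow> (real^'n \<Rightarrow> real^'d^'d) \<Rightarrow> ennreal" where
  "A_const p W = (SUP Q\<in>cubes. inverse (emeasure lebesgue Q) *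
     Lp_norm p (\<lambda>x.
       Lp_norm (conj_exponent p) (\<lambda>y. ennreal (op_norm (W x ** matrix_inv (W y))) * indicator Q y)
       * indicator Q x))"

definition A_class :: "(real^'n \<Rightarrow> ennreal) \<Rightarrow> (real^'n \<Rightarrow> real^'d^'d) set" where
  "A_class p = {W. invertible_matrix_weight W \<and> A_const p W < \<infinity>}"

section \<open>Conjugate exponents are well defined\<close>

lemma ennreal_inverse_le_one: "1 \<le> a \<Longrightarrow> inverse a \<le> (1::ennreal)"
  by (cases a rule: ennreal_cases) (auto simp: inverse_ennreal divide_simps simp flip: ennreal_1)

lemma ennreal_one_le_inverse: "a \<le> 1 \<Longrightarrow> 1 \<le> inverse (a::ennreal)"
proof (cases "a = 0")
  case False
  assume "a \<le> 1"
  with False show ?thesis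
    by (cases a rule: ennreal_cases)
      (auto simp: inverse_ennreal divide_simps top_unique simp flip: ennreal_1)
qed simp

lemma ennreal_inverse_invol: "inverse (inverse (a::ennreal)) = a"
proof (cases "a = 0")
  case False
  then show ?thesis
    by (cases a rule: ennreal_cases) (auto simp: inverse_ennreal)
qed simp

lemma ennreal_conj_iff:
  fixes a b :: ennreal
  assumes "1 \<le> a"
  shows "inverse a + inverse b = 1 \<longleftrightarrow> b = inverse (1 - inverse a)"
proof -
  have le: "inverse a \<le> 1"
    using assms by (rule ennreal_inverse_le_one)
  have fin: "inverse a \<noteq> top" using le by (auto simp: top_unique)
  have "inverse a + inverse b = 1 \<longleftrightarrow> inverse b = 1 - inverse a"
  proof
    assume "inverse a + inverse b = 1"
    then have "1 - inverse a = (inverse a + inverse b) - inverse a" by (rule arg_cong[OF sym])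
    also have "\<dots> = inverse b" using fin by (subst ennreal_add_diff_cancel_left) auto
    finally show "inverse b = 1 - inverse a" by (rule sym)
  next
    assume "inverse b = 1 - inverse a"
    then show "inverse a + inverse b = 1" using add_diff_inverse_ennreal[OF le] by metis
  qed
  also have "\<dots> \<longleftrightarrow> b = inverse (1 - inverse a)"
    by (metis ennreal_inverse_invol)
  finally show ?thesis .
qed

lemma conj_exponent_unique:
  assumes "exponent_function p"
  shows "(\<forall>x. 1 / p x + 1 / p' x = 1) \<longleftrightarrow> p' = conj_exponent p"
  using assms ennreal_conj_iff
  by (auto simp: exponent_function_def conj_exponent_def fun_eq_iff divide_ennreal_def)

lemma exponent_function_conj:
  assumes "exponent_function p"
  shows "exponent_function (conj_exponent p)"
proof -
  have "conj_exponent p \<in> borel_measurable lebesgue"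
    using assms unfolding exponent_function_def conj_exponent_def[abs_def]
    by (intro borel_measurable_inverse_ennreal borel_measurable_minus_ennreal) auto
  moreover have "1 \<le> conj_exponent p x" for x
    by (auto simp: conj_exponent_def intro!: ennreal_one_le_inverse diff_le_self_ennreal)
  ultimately show ?thesis by (simp add: exponent_function_def)
qed

text \<open>For every \<open>s \<ge> 1\<close> there is exactly one exponent function \<open>q\<close> with \<open>q' = s p'\<close>.\<close>

lemma scaled_conj_exponent_ex1:
  fixes p :: "real^'n \<Rightarrow> ennreal"
  assumes p: "exponent_function p" and s: "1 \<le> (s::real)"
  shows "\<exists>!q. exponent_function q \<and> (\<forall>x. conj_exponent q x = ennreal s * conj_exponent p x)"
proof -
  have inv: "conj_exponent (conj_exponent r) = r" if "exponent_function r" for r :: "real^'n \<Rightarrow> ennreal"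
    using conj_exponent_unique[OF that, of "conj_exponent r"]
      conj_exponent_unique[OF exponent_function_conj[OF that], of r]
    by (simp add: add.commute)
  let ?r = "\<lambda>x. ennreal s * conj_exponent p x"
  have pc: "exponent_function (conj_exponent p)" by (rule exponent_function_conj[OF p])
  have "1 \<le> ?r x" for x
    using mult_mono[of 1 "ennreal s" 1 "conj_exponent p x"] s pc
    by (simp add: exponent_function_def)
  then have r: "exponent_function ?r"
    using pc by (auto simp: exponent_function_def intro!: borel_measurable_times_ennreal)
  show ?thesis
  proof (rule ex1I[of _ "conj_exponent ?r"])
    show "exponent_function (conj_exponent ?r) \<and> (\<forall>x. conj_exponent (conj_exponent ?r) x = ?r x)"
      using exponent_function_conj[OF r] inv[OF r] by simp
  next
    fix q :: "real^'n \<Rightarrow> ennreal"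
    assume "exponent_function q \<and> (\<forall>x. conj_exponent q x = ?r x)"
    then have "exponent_function q" "conj_exponent q = ?r" by auto
    then show "q = conj_exponent ?r" using inv by metis
  qed
qed

end

theory Submission
  imports Defs
begin

text \<open>
  Write \<open>t = p'\<close>, and for a vector \<open>e\<close> let \<open>w\<^sub>e(y) = \<bar>W\<^sup>-\<^sup>1(y) e\<bar>\<close>. As \<open>\<bar>W(x) W\<^sup>-\<^sup>1(y)\<bar>\<close> is at least \<open>w\<^sub>e(y) / w\<^sub>e(x)\<close>, the
  matrix condition implies the scalar Muckenhoupt condition
  \<open>\<parallel>w\<^sub>e \<chi>\<^sub>Q\<parallel>\<^sub>t \<parallel>w\<^sub>e\<^sup>-\<^sup>1 \<chi>\<^sub>Q\<parallel>\<^sub>p \<le> K \<bar>Q\<bar>\<close> with one constant \<open>K\<close> for all \<open>e\<close>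
  (\<open>dual_weight_admissible\<close>). Conversely \<open>\<bar>W(x) W\<^sup>-\<^sup>1(y)\<bar>\<close> is at most the sum of the \<open>w\<^sub>e(y)\<close> with
  \<open>e = W(x) e\<^sub>i\<close>. The theorem thus rests on a reverse Hoelder inequality for scalar weights,
  \<open>\<parallel>w \<chi>\<^sub>Q\<parallel>\<^sub>s\<^sub>t \<le> C \<parallel>w \<chi>\<^sub>Q\<parallel>\<^sub>t \<parallel>\<chi>\<^sub>Q\<parallel>\<^sub>t powr (1/s - 1)\<close>, uniform over weights with the same Muckenhoupt constant
  (\<open>reverse_hoelder\<close>). It bounds the inner norm with exponent \<open>s t\<close> by that with exponent \<open>t\<close>
  (\<open>inner_norm_improvement\<close>), and the power of \<open>\<parallel>\<chi>\<^sub>Q\<parallel>\<^sub>t\<close> gained there is exactly what Hoelder's inequality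
  costs in passing from the outer exponent \<open>p\<close> to the smaller exponent \<open>q\<close> (\<open>outer_norm_improvement\<close>).

  For the reverse Hoelder inequality let \<open>N\<close> be the norm of \<open>w\<close> on \<open>Q\<close>, so that \<open>(w/N) powr t\<close> is a probability
  density there. Young's inequality turns the Muckenhoupt condition into the lower bound
  \<open>(c \<bar>E\<bar> / \<bar>Q\<bar>) powr P\<close> for the integral of this density over \<open>E \<subseteq> Q\<close> (\<open>admissible\<close>, with \<open>P\<close> an upper bound of \<open>t\<close>);
  what is needed is an upper bound \<open>C (\<bar>E\<bar> / \<bar>Q\<bar>) powr \<eta>\<close> (\<open>admissible_decay\<close>), from which a layer-cake argument concludes.
  For a constant exponent the density is proportional to \<open>w powr t\<close> and this is Muckenhoupt's
  theorem, proved by iterating a stopping-cube decomposition over all subcubes (\<open>power_decay\<close>). For a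
  variable exponent \<open>N powr t(x)\<close> is not constant on \<open>Q\<close>, and the densities of a cube and of its
  subcubes are not proportional.

  The way out is to pass to the single measure \<open>w powr t\<close>, after multiplying \<open>w\<close> by a constant so that its norm
  on a fixed cube at the origin is one; the conclusion is invariant under this. Then \<open>N\<close> is bounded
  above and below by powers of the side of \<open>Q\<close> and of its distance to the origin, and log-Hoelder continuity
  makes \<open>N powr t(x)\<close> constant on \<open>Q\<close> up to bounded factors, except on a cube around the origin whose side is a
  small power of \<open>N\<close> and whose mass is negligible (\<open>flat_dichotomy\<close>). So \<open>w powr t\<close> satisfies the
  hypothesis of the stopping argument (\<open>half_cube_mass\<close>), and its power decay passes back to the normalised
  densities. The layer-cake argument uses the lower bound also for the weight \<open>1\<close>, which amounts to the
  familiar comparison of \<open>\<parallel>\<chi>\<^sub>Q\<parallel>\<^sub>t\<close> with a power of \<open>\<bar>Q\<bar>\<close> (\<open>nrm_one_upper\<close>).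
\<close>

section \<open>Cubes and their dyadic cells\<close>

\<comment> \<open>Lebesgue measure is kept as such, instead of being rewritten to the Borel measure of the main part of a set.\<close>
declare emeasure_completion [simp del] measure_completion [simp del]

abbreviation cube :: "real^'n \<Rightarrow> real \<Rightarrow> (real^'n) set" where
  "cube a l \<equiv> cbox a (a + (\<chi> i. l))"

text \<open>The half-open dyadic cell of generation \<open>k\<close> containing \<open>x\<close>, in the grid with corner \<open>a\<close> whose
  cells of generation 0 have side \<open>l\<close>. Describing it by equality of integer parts makes the cells of one generation a
  partition, and makes nestedness a fact about integer division by two.\<close>

definition cell :: "real^'n \<Rightarrow> real \<Rightarrow> nat \<Rightarrow> real^'n \<Rightarrow> (real^'n) set" where
  "cell a l k x = {y. \<forall>i. \<lfloor>2^k * (y$i - a$i) / l\<rfloor> = \<lfloor>2^k * (x$i - a$i) / l\<rfloor>}"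

lemma one_le_dim: "1 \<le> real CARD('n::finite)"
  by (simp add: Suc_leI)

lemma mem_cube: "x \<in> cube a l \<longleftrightarrow> (\<forall>i. a$i \<le> x$i \<and> x$i \<le> a$i + l)"
  by (simp add: mem_box_cart)

lemma sets_cube [simp, measurable]: "cube a l \<in> sets lebesgue"
  by (meson fmeasurableD lmeasurable_cbox)

lemma measure_cube:
  fixes a :: "real^'n"
  assumes "0 \<le> l"
  shows "measure lebesgue (cube a l) = l ^ CARD('n)"
  using assms by (simp add: measure_completion content_cbox_cart interval_ne_empty_cart(1))

lemma emeasure_cube:
  fixes a :: "real^'n"
  assumes "0 \<le> l"
  shows "emeasure lebesgue (cube a l) = ennreal (l ^ CARD('n))"
  using measure_cube[OF assms, of a] emeasure_eq_ennreal_measure[of lebesgue "cube a l"]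
  using emeasure_lborel_cbox_finite[of a "a + (\<chi> i. l)"] by (auto simp: less_top emeasure_completion)

lemma cell_self [simp]: "x \<in> cell a l k x"
  by (simp add: cell_def)

lemma cell_eq: "y \<in> cell a l k x \<Longrightarrow> cell a l k y = cell a l k x"
  by (auto simp: cell_def)

lemma cell_Suc: "cell a l (Suc k) x \<subseteq> cell a l k x"
proof -
  have half: "\<lfloor>u\<rfloor> = \<lfloor>2 * u\<rfloor> div 2" for u :: real
    by (rule floor_unique) linarith+
  have "\<lfloor>2^k * d / l\<rfloor> = \<lfloor>2 ^ Suc k * d / l\<rfloor> div 2" for d
    using half[of "2^k * d / l"] by (simp add: mult.assoc)
  note coarser = this
  show ?thesis
  proof
    fix y assume y: "y \<in> cell a l (Suc k) x"
    have "\<lfloor>2 ^ k * (y $ i - a $ i) / l\<rfloor> = \<lfloor>2 ^ k * (x $ i - a $ i) / l\<rfloor>" for i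
    proof -
      have "\<lfloor>2 ^ Suc k * (y $ i - a $ i) / l\<rfloor> = \<lfloor>2 ^ Suc k * (x $ i - a $ i) / l\<rfloor>"
        using y unfolding cell_def by blast
      then show ?thesis by (simp only: coarser)
    qed
    then show "y \<in> cell a l k x" unfolding cell_def by blast
  qed
qed

lemma cell_antimono: "j \<le> k \<Longrightarrow> cell a l k x \<subseteq> cell a l j x"
  by (induction k rule: dec_induct) (use cell_Suc in blast)+

definition corner :: "real^'n \<Rightarrow> real \<Rightarrow> nat \<Rightarrow> real^'n \<Rightarrow> real^'n" where
  "corner a l k x = (\<chi> i. a$i + l / 2^k * \<lfloor>2^k * (x$i - a$i) / l\<rfloor>)"

lemma cell_eq_half_open:
  assumes "0 < l"
  shows "cell a l k x = {y. \<forall>i. corner a l k x $ i \<le> y $ i \<and> y $ i < corner a l k x $ i + l / 2^k}"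
proof -
  have "\<lfloor>2^k * d / l\<rfloor> = m \<longleftrightarrow> l / 2^k * m \<le> d \<and> d < l / 2^k * m + l / 2^k" for d and m :: int
    using assms by (simp add: floor_eq_iff field_simps)
  from this[of "_ - _"] show ?thesis
    by (simp add: cell_def corner_def algebra_simps)
qed

lemma cell_subset_cube:
  assumes "0 < l"
  shows "cell a l k x \<subseteq> cube (corner a l k x) (l / 2^k)"
  by (auto simp: cell_eq_half_open[OF assms] mem_box_cart less_imp_le)

lemma box_subset_cell:
  assumes "0 < l"
  shows "box (corner a l k x) (corner a l k x + (\<chi> i. l / 2^k)) \<subseteq> cell a l k x"
  by (auto simp: cell_eq_half_open[OF assms] mem_box_cart less_imp_le)

lemma sets_cell [measurable]:
  assumes "0 < l"
  shows "cell a l k x \<in> sets lebesgue"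
proof -
  have "{y. corner a l k x $ i \<le> y $ i \<and> y $ i < corner a l k x $ i + l / 2^k} \<in> sets borel" for i
    by measurable
  then have "(\<Inter>i. {y. corner a l k x $ i \<le> y $ i \<and> y $ i < corner a l k x $ i + l / 2^k}) \<in> sets borel"
    by (intro sets.countable_INT) auto
  moreover have "cell a l k x = (\<Inter>i. {y. corner a l k x $ i \<le> y $ i \<and> y $ i < corner a l k x $ i + l / 2^k})"
    by (auto simp: cell_eq_half_open[OF assms])
  ultimately show ?thesis by simp
qed

lemma cell_null_diff:
  assumes "0 < l"
  shows "cube (corner a l k x) (l / 2^k) - cell a l k x \<in> null_sets lebesgue"
proof (rule negligible_iff_null_sets[THEN iffD1], rule negligible_subset)
  show "negligible (cube (corner a l k x) (l / 2^k) - box (corner a l k x) (corner a l k x + (\<chi> i. l / 2^k)))"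
    by (rule negligible_frontier_interval)
qed (use box_subset_cell[OF assms] in blast)

lemma emeasure_cell:
  fixes a :: "real^'n"
  assumes "0 < l"
  shows "emeasure lebesgue (cell a l k x) = ennreal ((l / 2^k) ^ CARD('n))"
proof -
  have "emeasure lebesgue (cell a l k x) = emeasure lebesgue (cube (corner a l k x) (l / 2^k))"
  proof (rule emeasure_eq_AE)
    show "AE y in lebesgue. (y \<in> cell a l k x) = (y \<in> cube (corner a l k x) (l / 2^k))"
      by (rule AE_I'[OF cell_null_diff[OF assms, of a k x]])
         (use cell_subset_cube[OF assms, of a k x] in blast)
  qed (use assms in auto)
  then show ?thesis using assms emeasure_cube[of "l/2^k" "corner a l k x"] by simp
qed

lemma corner_0: "corner a l 0 a = a"
  by (simp add: corner_def vec_eq_iff)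

text \<open>Cells of one generation are indexed by integer vectors.\<close>

lemma countable_cells: "countable (range (cell a l k))" for a :: "real^'n"
proof -
  have "cell a l k x = (\<lambda>v::int^'n. {y. \<forall>i. \<lfloor>2^k * (y$i - a$i) / l\<rfloor> = v $ i}) (\<chi> i. \<lfloor>2^k * (x$i - a$i) / l\<rfloor>)" for x
    by (simp add: cell_def)
  then have "range (cell a l k) \<subseteq> range (\<lambda>v::int^'n. {y. \<forall>i. \<lfloor>2^k * (y$i - a$i) / l\<rfloor> = v $ i})"
    by blast
  then show ?thesis by (rule countable_subset) simp
qed

lemma open_contains_cell:
  fixes a :: "real^'n"
  assumes "0 < l" "open U" "x \<in> U"
  shows "\<exists>k. cell a l k x \<subseteq> U"
proof -
  obtain e where e: "0 < e" "ball x e \<subseteq> U"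
    using assms by (meson openE)
  obtain k where k: "l * real CARD('n) / e < 2^k"
    using real_arch_pow[of 2] by auto
  have "dist x y < e" if "y \<in> cell a l k x" for y
  proof -
    have "\<bar>(x - y) $ i\<bar> < l / 2^k" for i
    proof -
      have "corner a l k x $ i \<le> y $ i \<and> y $ i < corner a l k x $ i + l / 2^k"
        using that by (simp add: cell_eq_half_open[OF assms(1)])
      moreover have "corner a l k x $ i \<le> x $ i \<and> x $ i < corner a l k x $ i + l / 2^k"
        using cell_self[of x a l k] unfolding cell_eq_half_open[OF assms(1)] by blast
      ultimately show ?thesis by (simp add: abs_less_iff)
    qed
    then have "(\<Sum>i\<in>UNIV. \<bar>(x - y) $ i\<bar>) < (\<Sum>i\<in>(UNIV::'n set). l / 2^k)"
      by (intro sum_strict_mono) auto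
    then have "norm (x - y) < CARD('n) * (l / 2^k)"
      using norm_le_l1_cart[of "x - y"] by simp
    also have "\<dots> < e"
      using k e by (simp add: field_simps)
    finally show ?thesis by (simp add: dist_norm)
  qed
  then show ?thesis using e by (intro exI[of _ k]) (auto simp: subset_iff)
qed

section \<open>Power decay by stopping cubes\<close>

text \<open>A measure for which a subset filling at most half of a cube carries at most the fraction
  \<open>\<beta>\<close> of its mass. For \<open>\<beta> < 1\<close> this is Muckenhoupt's condition \<open>A\<^sub>\<infinity>\<close> at a single scale; the stopping
  argument below upgrades it to a power law.\<close>

locale halving_measure =
  fixes \<nu> :: "(real^'n) measure" and \<beta> :: real
  assumes sets_nu [simp, measurable_cong]: "sets \<nu> = sets lebesgue"
    and null_nu: "\<And>E. E \<in> null_sets lebesgue \<Longrightarrow> emeasure \<nu> E = 0"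
    and halving: "\<And>a l E. 0 < l \<Longrightarrow> E \<in> sets lebesgue \<Longrightarrow> E \<subseteq> cube a l \<Longrightarrow>
        2 * emeasure lebesgue E \<le> emeasure lebesgue (cube a l) \<Longrightarrow>
        emeasure \<nu> E \<le> ennreal \<beta> * emeasure \<nu> (cube a l)"
begin

lemma measure_cell_eq_cube:
  assumes "0 < l"
  shows "emeasure \<nu> (cell a l k x) = emeasure \<nu> (cube (corner a l k x) (l / 2^k))"
proof (rule emeasure_eq_AE)
  have "cube (corner a l k x) (l / 2^k) - cell a l k x \<in> null_sets \<nu>"
    using cell_null_diff[OF assms, of a k x] null_nu by (auto simp: null_sets_def)
  then show "AE y in \<nu>. (y \<in> cell a l k x) = (y \<in> cube (corner a l k x) (l / 2^k))"
    by (rule AE_I') (use cell_subset_cube[OF assms, of a k x] in blast)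
qed (use assms in auto)

text \<open>One Calderon-Zygmund step. Around each point take the largest cell in which \<open>G\<close> has density above
  \<open>\<alpha>\<close>, and let \<open>G1\<close> be the union of these cells. Maximality bounds the density of \<open>G\<close> in the parent cell by
  \<open>\<alpha>\<close>, hence in the cell itself by \<open>2^n \<alpha> = 1/2\<close>, so that the halving property applies to each cell.
  As \<open>G\<close> is a union of cells, it is covered by \<open>G1\<close> without appeal to a differentiation theorem, and \<open>G1\<close>
  is again a union of cells, so that the step can be repeated.\<close>

lemma stopping_step:
  fixes a :: "real^'n" and G :: "(real^'n) set"
  defines "\<alpha> \<equiv> (1/2) ^ Suc CARD('n) :: real"
  assumes l: "0 < l" and Gm: "G \<in> sets lebesgue" and GQ: "G \<subseteq> cell a l 0 a"
    and Gopen: "\<And>x. x \<in> G \<Longrightarrow> \<exists>k. cell a l k x \<subseteq> G"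
    and small: "emeasure lebesgue G \<le> ennreal \<alpha> * emeasure lebesgue (cell a l 0 a)"
  obtains G1 where "G1 \<in> sets lebesgue" "G1 \<subseteq> cell a l 0 a"
    "\<And>x. x \<in> G1 \<Longrightarrow> \<exists>k. cell a l k x \<subseteq> G1"
    "ennreal \<alpha> * emeasure lebesgue G1 \<le> emeasure lebesgue G"
    "emeasure \<nu> G \<le> ennreal \<beta> * emeasure \<nu> G1"
proof -
  let ?m = "emeasure lebesgue"
  define H where "H k x \<longleftrightarrow> ennreal \<alpha> * ?m (cell a l k x) < ?m (G \<inter> cell a l k x)" for k x
  define G1 where "G1 = {x. \<exists>k. H k x}"
  define K where "K x = (LEAST k. H k x)" for x
  define c where "c x = cell a l (K x) x" for x
  have \<alpha>: "0 < \<alpha>" "\<alpha> < 1" by (auto simp: \<alpha>_def power_less_one_iff simp del: power_Suc)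
  have Hcong: "H k y \<longleftrightarrow> H k x" if "y \<in> cell a l k x" for k x y
    using cell_eq[OF that] by (simp add: H_def)
  have HK: "H (K x) x" if "x \<in> G1" for x
    using that unfolding G1_def K_def by (auto intro: LeastI)
  have notH: "\<not> H k x" if "k < K x" for k x
    using that not_less_Least unfolding K_def by blast
  have stop: "y \<in> G1 \<and> K y = K x \<and> c y = c x" if x: "x \<in> G1" and y: "y \<in> c x" for x y
  proof -
    have le: "H k y \<longleftrightarrow> H k x" if "k \<le> K x" for k
      by (rule Hcong) (use that y cell_antimono[of k "K x" a l x] in \<open>auto simp: c_def\<close>)
    have "H (K x) y" using le[of "K x"] HK[OF x] by simp
    moreover have "K y = K x"
      unfolding K_def[of y]
      by (rule Least_equality) (use \<open>H (K x) y\<close> le notH in \<open>auto simp: not_less[symmetric]\<close>)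
    ultimately show ?thesis
      using y cell_eq[of y a l "K x" x] by (auto simp: G1_def c_def)
  qed
  have cell0: "cell a l 0 x = cell a l 0 a" if "H k x" for k x
  proof -
    have "G \<inter> cell a l k x \<noteq> {}" using that by (auto simp: H_def)
    then obtain z where "z \<in> G" "z \<in> cell a l k x" by blast
    then have "z \<in> cell a l 0 a" "z \<in> cell a l 0 x"
      using GQ cell_antimono[of 0 k a l x] by auto
    then show ?thesis using cell_eq by metis
  qed
  \<comment> \<open>The outermost cell is not a stopping cell, so stopping cells have parents.\<close>
  have Kpos: "K x \<noteq> 0" if x: "x \<in> G1" for x
  proof
    assume "K x = 0"
    then have "H 0 x" using HK[OF x] by simp
    then show False using cell0[OF \<open>H 0 x\<close>] small GQ by (simp add: H_def Int_absorb2 leD)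
  qed
  have halfcell: "2 * ?m (G \<inter> c x) \<le> ?m (c x)" if x: "x \<in> G1" for x
  proof -
    obtain k where k: "K x = Suc k" using Kpos[OF x] not0_implies_Suc by blast
    have "?m (G \<inter> c x) \<le> ?m (G \<inter> cell a l k x)"
      using cell_Suc[of a l k x] Gm l unfolding c_def k by (intro emeasure_mono) auto
    also have "\<dots> \<le> ennreal \<alpha> * ?m (cell a l k x)"
      using notH[of k x] k by (simp add: H_def not_less)
    also have "\<dots> = ennreal (\<alpha> * (l / 2^k) ^ CARD('n))"
      using \<alpha> l by (simp add: emeasure_cell ennreal_mult')
    finally have "2 * ?m (G \<inter> c x) \<le> ennreal 2 * ennreal (\<alpha> * (l / 2^k) ^ CARD('n))"
      by (simp add: mult_left_mono)
    also have "\<dots> = ennreal (2 * (\<alpha> * (l / 2^k) ^ CARD('n)))"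
      using \<alpha> l by (simp add: ennreal_mult')
    also have "2 * (\<alpha> * (l / 2^k) ^ CARD('n)) = (l / 2 ^ Suc k) ^ CARD('n)"
      by (simp add: \<alpha>_def power_divide power_mult_distrib field_simps)
    finally show ?thesis by (simp only: c_def k emeasure_cell[OF l])
  qed
  have betac: "emeasure \<nu> (G \<inter> c x) \<le> ennreal \<beta> * emeasure \<nu> (c x)" if x: "x \<in> G1" for x
  proof -
    have "emeasure \<nu> (G \<inter> c x) \<le> ennreal \<beta> * emeasure \<nu> (cube (corner a l (K x) x) (l / 2 ^ K x))"
    proof (rule halving)
      show "2 * ?m (G \<inter> c x) \<le> ?m (cube (corner a l (K x) x) (l / 2 ^ K x))"
        using halfcell[OF x] l by (simp add: c_def emeasure_cell emeasure_cube)
    qed (use l Gm cell_subset_cube[OF l, of a "K x" x] in \<open>auto simp: c_def\<close>)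
    then show ?thesis by (simp add: c_def measure_cell_eq_cube[OF l])
  qed
  have cm: "c x \<in> sets lebesgue" for x using l by (simp add: c_def)
  have count: "countable (c ` G1)"
  proof (rule countable_subset)
    show "c ` G1 \<subseteq> (\<Union>k. range (cell a l k))" by (auto simp: c_def)
  qed (intro countable_UN countable_cells, simp)
  have cself: "x \<in> c x" for x by (simp add: c_def)
  have G1_eq: "G1 = \<Union>(c ` G1)"
  proof
    show "\<Union>(c ` G1) \<subseteq> G1" using stop by blast
  qed (use cself in blast)
  have G1m: "G1 \<in> sets lebesgue"
    by (subst G1_eq, rule sets.countable_Union) (use count cm in auto)
  have disj: "disjoint_family_on (\<lambda>A. A) (c ` G1)"
    unfolding disjoint_family_on_def using stop by blast
  have disjG: "disjoint_family_on (\<lambda>A. G \<inter> A) (c ` G1)"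
    unfolding disjoint_family_on_def using stop by blast
  have GG1: "G \<subseteq> G1"
  proof
    fix x assume x: "x \<in> G"
    obtain k where k: "cell a l k x \<subseteq> G" using Gopen[OF x] by blast
    have "ennreal \<alpha> * ?m (cell a l k x) < ?m (cell a l k x)"
      using \<alpha> l by (simp add: emeasure_cell ennreal_mult'[symmetric] ennreal_less_iff)
    then have "H k x" using k by (simp add: H_def Int_absorb1)
    then show "x \<in> G1" by (auto simp: G1_def)
  qed
  have sumG: "emeasure M G = (\<integral>\<^sup>+A. emeasure M (G \<inter> A) \<partial>count_space (c ` G1))"
    if "sets M = sets lebesgue" for M :: "(real^'n) measure"
  proof -
    have "G = (\<Union>A\<in>c ` G1. G \<inter> A)" using GG1 G1_eq by auto
    then have "emeasure M G = emeasure M (\<Union>A\<in>c ` G1. G \<inter> A)" by simp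
    also have "\<dots> = (\<integral>\<^sup>+A. emeasure M (G \<inter> A) \<partial>count_space (c ` G1))"
      by (rule emeasure_UN_countable) (use count cm Gm disjG that in auto)
    finally show ?thesis .
  qed
  have sumG1: "emeasure M G1 = (\<integral>\<^sup>+A. emeasure M A \<partial>count_space (c ` G1))"
    if "sets M = sets lebesgue" for M :: "(real^'n) measure"
  proof -
    have "emeasure M G1 = emeasure M (\<Union>A\<in>c ` G1. A)" using G1_eq by simp
    also have "\<dots> = (\<integral>\<^sup>+A. emeasure M A \<partial>count_space (c ` G1))"
      by (rule emeasure_UN_countable) (use count cm disj that in auto)
    finally show ?thesis .
  qed
  show ?thesis
  proof
    show "G1 \<in> sets lebesgue" by fact
    show "G1 \<subseteq> cell a l 0 a"
    proof
      fix x assume "x \<in> G1"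
      then have "cell a l 0 x = cell a l 0 a" using cell0[OF HK] by blast
      then show "x \<in> cell a l 0 a" using cell_self[of x a l 0] by simp
    qed
    show "\<exists>k. cell a l k x \<subseteq> G1" if "x \<in> G1" for x
    proof -
      have "c x \<subseteq> G1" using stop[OF that] by blast
      then show ?thesis unfolding c_def by blast
    qed
    show "ennreal \<alpha> * ?m G1 \<le> ?m G"
      unfolding sumG[OF refl] sumG1[OF refl]
      by (subst nn_integral_cmult[symmetric])
         (auto intro!: nn_integral_mono less_imp_le[OF HK[unfolded H_def]] simp: c_def)
    show "emeasure \<nu> G \<le> ennreal \<beta> * emeasure \<nu> G1"
      unfolding sumG[OF sets_nu] sumG1[OF sets_nu]
      by (subst nn_integral_cmult[symmetric]) (auto intro!: nn_integral_mono betac)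
  qed
qed

lemma cell_open_decay:
  fixes a :: "real^'n" and G :: "(real^'n) set"
  defines "\<alpha> \<equiv> (1/2) ^ Suc CARD('n) :: real"
  assumes l: "0 < l" and \<beta>: "0 \<le> \<beta>"
  shows "G \<in> sets lebesgue \<Longrightarrow> G \<subseteq> cell a l 0 a \<Longrightarrow> (\<And>x. x \<in> G \<Longrightarrow> \<exists>k. cell a l k x \<subseteq> G) \<Longrightarrow>
     emeasure lebesgue G \<le> ennreal (\<alpha> ^ m) * emeasure lebesgue (cell a l 0 a) \<Longrightarrow>
     emeasure \<nu> G \<le> ennreal (\<beta> ^ m) * emeasure \<nu> (cell a l 0 a)"
proof (induction m arbitrary: G)
  case 0
  then show ?case using l by (simp add: emeasure_mono)
next
  case (Suc m)
  have \<alpha>: "0 < \<alpha>" "\<alpha> \<le> 1" by (auto simp: \<alpha>_def power_le_one simp del: power_Suc)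
  have "\<alpha> ^ Suc m \<le> \<alpha>" using \<alpha> power_le_one[of \<alpha> m] by (simp add: mult_left_le)
  then have "emeasure lebesgue G \<le> ennreal \<alpha> * emeasure lebesgue (cell a l 0 a)"
    using Suc.prems(4) by (meson ennreal_leI mult_right_mono order_trans zero_le)
  then obtain G1 where G1: "G1 \<in> sets lebesgue" "G1 \<subseteq> cell a l 0 a"
    "\<And>x. x \<in> G1 \<Longrightarrow> \<exists>k. cell a l k x \<subseteq> G1"
    and a1: "ennreal \<alpha> * emeasure lebesgue G1 \<le> emeasure lebesgue G"
    and n1: "emeasure \<nu> G \<le> ennreal \<beta> * emeasure \<nu> G1"
    using stopping_step[OF l Suc.prems(1-3)] unfolding \<alpha>_def by blast
  have "ennreal \<alpha> * emeasure lebesgue G1 \<le> ennreal \<alpha> * (ennreal (\<alpha> ^ m) * emeasure lebesgue (cell a l 0 a))"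
    using order_trans[OF a1 Suc.prems(4)] \<alpha> by (simp add: ennreal_mult' mult.assoc)
  then have "emeasure lebesgue G1 \<le> ennreal (\<alpha> ^ m) * emeasure lebesgue (cell a l 0 a)"
    using \<alpha> by (subst (asm) ennreal_mult_le_mult_iff) auto
  from Suc.IH[OF G1 this]
  have "ennreal \<beta> * emeasure \<nu> G1 \<le> ennreal \<beta> * (ennreal (\<beta> ^ m) * emeasure \<nu> (cell a l 0 a))"
    by (intro mult_left_mono) (simp_all add: \<beta>)
  then show ?case using n1 \<beta> by (simp add: ennreal_mult' mult.assoc)
qed

text \<open>Open sets are unions of cells, so outer regularity carries the decay from those to measurable sets.\<close>

lemma measurable_decay:
  fixes a :: "real^'n" and E :: "(real^'n) set"
  defines "\<alpha> \<equiv> (1/2) ^ Suc CARD('n) :: real"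
  assumes l: "0 < l" and \<beta>: "0 \<le> \<beta>" and Em: "E \<in> sets lebesgue" and EQ: "E \<subseteq> cube a l"
    and small: "measure lebesgue E < \<alpha> ^ m * measure lebesgue (cube a l)"
  shows "emeasure \<nu> E \<le> ennreal (\<beta> ^ m) * emeasure \<nu> (cube a l)"
proof -
  define d where "d = \<alpha> ^ m * measure lebesgue (cube a l) - measure lebesgue E"
  have d: "0 < d" using small by (simp add: d_def)
  have El: "E \<in> lmeasurable" using Em EQ by (meson lmeasurable_cbox measurable_bounded_by_integrable_imp_integrable fmeasurableI2)
  obtain U where U: "open U" "E \<subseteq> U" "U - E \<in> lmeasurable" "emeasure lebesgue (U - E) < ennreal d"
    using sets_lebesgue_outer_open[OF Em d] by blast
  let ?Q = "cell a l 0 a"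
  have QQ: "?Q \<subseteq> cube a l" "cube a l - ?Q \<in> null_sets lebesgue"
    using cell_subset_cube[OF l, of a 0 a] cell_null_diff[OF l, of a 0 a] by (simp_all add: corner_0)
  have Qm: "emeasure lebesgue ?Q = emeasure lebesgue (cube a l)"
    using l by (simp add: emeasure_cell emeasure_cube)
  have nuQ: "emeasure \<nu> ?Q = emeasure \<nu> (cube a l)"
    by (simp add: measure_cell_eq_cube[OF l] corner_0)
  have Um: "U \<in> sets lebesgue" using U(1) by auto
  have "emeasure lebesgue (U \<inter> ?Q) \<le> emeasure lebesgue ((U - E) \<union> E)"
    using Um Em by (intro emeasure_mono) auto
  also have "\<dots> \<le> emeasure lebesgue (U - E) + emeasure lebesgue E"
    using U(3) Em by (intro emeasure_subadditive) auto
  also have "\<dots> \<le> ennreal d + ennreal (measure lebesgue E)"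
    using U(4) El by (intro add_mono) (auto simp: emeasure_eq_measure2)
  also have "\<dots> = ennreal (\<alpha> ^ m * measure lebesgue (cube a l))"
    using d by (subst ennreal_plus[symmetric]) (auto simp: d_def)
  also have "\<dots> = ennreal (\<alpha> ^ m) * emeasure lebesgue ?Q"
    unfolding Qm emeasure_cube[OF less_imp_le[OF l]] measure_cube[OF less_imp_le[OF l]]
    by (rule ennreal_mult') (simp add: \<alpha>_def)
  finally have le: "emeasure lebesgue (U \<inter> ?Q) \<le> ennreal (\<alpha> ^ m) * emeasure lebesgue ?Q" .
  have op: "\<exists>k. cell a l k x \<subseteq> U \<inter> ?Q" if x: "x \<in> U \<inter> ?Q" for x
  proof -
    obtain k where "cell a l k x \<subseteq> U" using open_contains_cell[OF l U(1), of x a] x by blast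
    moreover have "cell a l k x \<subseteq> ?Q"
      using cell_antimono[of 0 k a l x] cell_eq[of x a l 0 a] x by auto
    ultimately show ?thesis by blast
  qed
  have "emeasure \<nu> E \<le> emeasure \<nu> ((U \<inter> ?Q) \<union> (cube a l - ?Q))"
  proof (rule emeasure_mono)
    have "cube a l - ?Q \<in> sets lebesgue" using QQ(2) by auto
    then show "U \<inter> ?Q \<union> (cube a l - ?Q) \<in> sets \<nu>" using Um l by auto
  qed (use U EQ in blast)
  also have "\<dots> \<le> emeasure \<nu> (U \<inter> ?Q) + emeasure \<nu> (cube a l - ?Q)"
    using Um l by (intro emeasure_subadditive) auto
  also have "\<dots> = emeasure \<nu> (U \<inter> ?Q)" using null_nu[OF QQ(2)] by simp
  also have "\<dots> \<le> ennreal (\<beta> ^ m) * emeasure \<nu> ?Q"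
    by (rule cell_open_decay[OF l \<beta>]) (use Um l op le in \<open>auto simp: \<alpha>_def\<close>)
  finally show ?thesis by (simp add: nuQ)
qed

end

text \<open>Choosing the number \<open>m\<close> of steps so that \<open>\<alpha> ^ m\<close> is close to the proportion of \<open>E\<close> turns geometric decay
  into a power, with exponent \<open>\<eta>\<close> given by \<open>\<alpha> powr \<eta> = \<beta>\<close>. The constants depend on \<open>\<beta>\<close> and the dimension
  alone, which is what makes later estimates uniform over families of weights.\<close>

lemma power_decay:
  fixes \<beta> :: real
  assumes "0 < \<beta>" "\<beta> < 1"
  shows "\<exists>C \<eta>. 1 \<le> C \<and> 0 < \<eta> \<and> (\<forall>(\<nu> :: (real^'n) measure) a l E. halving_measure \<nu> \<beta> \<longrightarrow> 0 < l \<longrightarrow>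
     E \<in> sets lebesgue \<longrightarrow> E \<subseteq> cube a l \<longrightarrow> emeasure \<nu> (cube a l) < \<infinity> \<longrightarrow>
     measure \<nu> E \<le> C * (measure lebesgue E / measure lebesgue (cube a l)) powr \<eta> * measure \<nu> (cube a l))"
proof -
  define \<alpha> where "\<alpha> = ((1/2) ^ Suc CARD('n) :: real)"
  have \<alpha>: "0 < \<alpha>" "\<alpha> < 1" by (auto simp: \<alpha>_def power_less_one_iff simp del: power_Suc)
  define \<eta> where "\<eta> = ln \<beta> / ln \<alpha>"
  have \<eta>: "0 < \<eta>" using assms \<alpha> by (simp add: \<eta>_def divide_neg_neg)
  have ae: "\<alpha> powr \<eta> = \<beta>" using assms \<alpha> by (simp add: \<eta>_def powr_def)
  have "measure \<nu> E \<le> (1 / \<beta>\<^sup>2) * (measure lebesgue E / measure lebesgue (cube a l)) powr \<eta> * measure \<nu> (cube a l)"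
    if H: "halving_measure \<nu> \<beta>" and l: "0 < l" and E: "E \<in> sets lebesgue" "E \<subseteq> cube a l"
      and fin: "emeasure \<nu> (cube a l) < \<infinity>"
    for \<nu> :: "(real^'n) measure" and a l E
  proof -
    interpret halving_measure \<nu> \<beta> by fact
    let ?q = "measure lebesgue E / measure lebesgue (cube a l)"
    have finE: "emeasure \<nu> E < \<infinity>"
      using emeasure_mono[of E "cube a l" \<nu>] fin E by (auto intro: le_less_trans)
    have dec: "measure \<nu> E \<le> \<beta> ^ m * measure \<nu> (cube a l)" if "?q < \<alpha> ^ m" for m
    proof -
      have "measure lebesgue E < \<alpha> ^ m * measure lebesgue (cube a l)"
        using that l by (simp add: measure_cube field_simps)
      then have "emeasure \<nu> E \<le> ennreal (\<beta> ^ m) * emeasure \<nu> (cube a l)"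
        using measurable_decay[OF l _ E] assms unfolding \<alpha>_def by simp
      then have "ennreal (measure \<nu> E) \<le> ennreal (\<beta> ^ m * measure \<nu> (cube a l))"
        using fin finE assms by (simp add: emeasure_eq_ennreal_measure ennreal_mult')
      then show ?thesis using assms by (subst (asm) ennreal_le_iff) auto
    qed
    show ?thesis
    proof (cases "measure lebesgue E = 0")
      case True
      have "E \<in> null_sets lebesgue"
      proof -
        have "E \<in> lmeasurable" using E by (meson fmeasurableI2 lmeasurable_cbox)
        then have "emeasure lebesgue E = 0" using True by (simp add: emeasure_eq_measure2)
        then show ?thesis using E by (simp add: null_sets_def)
      qed
      then have "measure \<nu> E = 0" using null_nu by (simp add: measure_def)
      then show ?thesis using True by simp
    next
      case False
      have q: "0 < ?q" "?q \<le> 1"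
      proof -
        show "0 < ?q" using False l by (simp add: measure_cube zero_less_measure_iff)
        show "?q \<le> 1" using l E by (simp add: measure_cube measure_mono_fmeasurable[of E "cube a l" lebesgue, unfolded measure_cube[OF less_imp_le[OF l]]])
      qed
      define m where "m = nat \<lfloor>ln ?q / ln \<alpha>\<rfloor>"
      have lnn: "0 \<le> ln ?q / ln \<alpha>" using q \<alpha> by (simp add: divide_nonpos_neg)
      have m1: "real m \<le> ln ?q / ln \<alpha>" "ln ?q / ln \<alpha> < real m + 1"
        using lnn unfolding m_def by linarith+
      have "ln ?q > (real m + 1) * ln \<alpha>" using m1(2) \<alpha> by (simp add: field_simps)
      then have lower: "?q powr \<eta> \<ge> \<beta> ^ (m + 1)"
      proof -
        assume "ln ?q > (real m + 1) * ln \<alpha>"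
        then have "\<alpha> powr (real (m+1)) \<le> ?q"
          using q \<alpha> by (simp add: powr_def ln_ge_iff[symmetric] exp_le_cancel_iff add.commute less_imp_le)
        then have "(\<alpha> powr (real (m+1))) powr \<eta> \<le> ?q powr \<eta>"
          using \<eta> by (intro powr_mono2) auto
        moreover have "(\<alpha> powr (real (m+1))) powr \<eta> = (\<alpha> powr \<eta>) powr (real (m+1))"
          by (simp only: powr_powr mult.commute)
        moreover have "\<dots> = \<beta> ^ (m+1)" unfolding ae using assms by (simp only: powr_realpow)
        ultimately show ?thesis by simp
      qed
      \<comment> \<open>One step is lost because \<open>measurable_decay\<close> asks for a strict inequality.\<close>
      have "measure \<nu> E \<le> \<beta> ^ (m - 1) * measure \<nu> (cube a l)"
      proof (cases m)
        case 0
        then show ?thesis using E fin by (simp add: measure_mono_fmeasurable fmeasurable_def)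
      next
        case (Suc j)
        have "real j * ln \<alpha> > ln ?q"
        proof -
          have "real j < ln ?q / ln \<alpha>" using m1(1) Suc by simp
          then show ?thesis using \<alpha> by (simp add: field_simps)
        qed
        then have "?q < \<alpha> ^ j"
          using q(1) \<alpha> by (metis ln_less_cancel_iff ln_realpow zero_less_power)
        then show ?thesis using dec Suc by simp
      qed
      also have "\<beta> ^ (m - 1) \<le> \<beta> ^ (m + 1) / \<beta>\<^sup>2"
        using assms by (cases m) (auto simp: field_simps power2_eq_square)
      also have "\<dots> \<le> ?q powr \<eta> / \<beta>\<^sup>2" using lower assms by (simp add: divide_right_mono)
      finally show ?thesis by (simp add: mult_right_mono)
    qed
  qed
  then show ?thesis
    using \<eta> assms by (intro exI[of _ "1/\<beta>\<^sup>2"] exI[of _ \<eta>]) (auto simp: power_le_one divide_simps)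
qed

section \<open>Modulars and norms of a scalar weight on cubes\<close>

text \<open>A bounded log-Hoelder exponent; \<open>\<tau>\<close> is its value at infinity and \<open>P\<close> an upper bound.\<close>

locale lh_exponent =
  fixes t :: "real^'n \<Rightarrow> real" and P C0 Ci \<tau> :: real
  assumes t_meas [measurable]: "t \<in> borel_measurable lebesgue"
    and t_ge1: "\<And>x. 1 \<le> t x" and t_le: "\<And>x. t x \<le> P"
    and C0: "0 \<le> C0" and Ci: "0 \<le> Ci"
    and tau_ge1: "1 \<le> \<tau>" and tau_le: "\<tau> \<le> P"
    and lh_local: "\<And>x y. norm (x - y) < 1/2 \<Longrightarrow> \<bar>t x - t y\<bar> \<le> C0 / (- ln (norm (x - y)))"
    and lh_inf: "\<And>x. \<bar>t x - \<tau>\<bar> \<le> Ci / ln (exp 1 + norm x)"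
begin

text \<open>Integrating \<open>(w/N) powr t\<close>. The measure with \<open>N = 1\<close> is the mass \<open>w powr t\<close>, to which the stopping argument
  applies; the one whose \<open>N\<close> is the norm of \<open>w\<close> on a cube gives that cube mass one.\<close>

definition modular_measure :: "(real^'n \<Rightarrow> real) \<Rightarrow> real \<Rightarrow> (real^'n) measure" where
  "modular_measure w N = density lebesgue (\<lambda>x. ennreal ((w x / N) powr t x))"

abbreviation V :: "(real^'n \<Rightarrow> real) \<Rightarrow> real \<Rightarrow> (real^'n) set \<Rightarrow> real" where
  "V w N \<equiv> measure (modular_measure w N)"

definition weight :: "(real^'n \<Rightarrow> real) \<Rightarrow> bool" where
  "weight w \<longleftrightarrow> w \<in> borel_measurable lebesgue \<and> (\<forall>x. 0 < w x) \<and>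
     (\<forall>a l. 0 < l \<longrightarrow> emeasure (modular_measure w 1) (cube a l) < \<infinity>)"

text \<open>For a weight of finite mass on cubes, the Luxemburg norm on a cube is the unique \<open>N\<close> at which the
  modular equals one.\<close>

definition nrm :: "(real^'n \<Rightarrow> real) \<Rightarrow> (real^'n) set \<Rightarrow> real" where
  "nrm w Q = (SOME N. 0 < N \<and> V w N Q = 1)"

definition bounded_set :: "(real^'n) set \<Rightarrow> bool" where
  "bounded_set E \<longleftrightarrow> E \<in> sets lebesgue \<and> (\<exists>a l. 0 < l \<and> E \<subseteq> cube a l)"

lemma P_ge1: "1 \<le> P"
  using t_ge1[of 0] t_le[of 0] by linarith

lemma sets_modular_measure [simp, measurable_cong]: "sets (modular_measure w N) = sets lebesgue"
  by (simp add: modular_measure_def)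

lemma bounded_setI: "0 < l \<Longrightarrow> E \<in> sets lebesgue \<Longrightarrow> E \<subseteq> cube a l \<Longrightarrow> bounded_set E"
  by (auto simp: bounded_set_def)

lemma bounded_set_sets: "bounded_set E \<Longrightarrow> E \<in> sets lebesgue"
  by (simp add: bounded_set_def)

lemma emeasure_modular_measure:
  assumes "w \<in> borel_measurable lebesgue" "E \<in> sets lebesgue"
  shows "emeasure (modular_measure w N) E = (\<integral>\<^sup>+x\<in>E. ennreal ((w x / N) powr t x) \<partial>lebesgue)"
proof -
  have [measurable]: "w \<in> borel_measurable lebesgue" by fact
  show ?thesis unfolding modular_measure_def by (rule emeasure_density) (use assms(2) in measurable)
qed

text \<open>The two densities differ by the factor \<open>(N'/N) powr t\<close>, so that bounding this factor on \<open>E\<close> is all that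
  is needed to pass from one scale to another.\<close>

lemma emeasure_compare:
  assumes w: "w \<in> borel_measurable lebesgue" "\<And>x. 0 < w x" and E: "E \<in> sets lebesgue"
    and N: "0 < N" "0 < N'" and A: "\<And>x. x \<in> E \<Longrightarrow> (N' / N) powr t x \<le> A"
  shows "emeasure (modular_measure w N) E \<le> ennreal A * emeasure (modular_measure w N') E"
proof -
  have "(\<integral>\<^sup>+x\<in>E. ennreal ((w x / N) powr t x) \<partial>lebesgue)
      \<le> (\<integral>\<^sup>+x. ennreal A * (ennreal ((w x / N') powr t x) * indicator E x) \<partial>lebesgue)"
  proof (rule nn_integral_mono)
    fix x
    have "(w x / N) powr t x \<le> A * (w x / N') powr t x" if "x \<in> E"
    proof -
      have "w x / N = (N' / N) * (w x / N')" using N by simp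
      then have "(w x / N) powr t x = (N' / N) powr t x * (w x / N') powr t x"
        by (simp only: powr_mult)
      then show ?thesis using A[OF that] by (simp add: mult_right_mono)
    qed
    moreover have "0 \<le> A" if "x \<in> E" using A[OF that] powr_ge_zero[of "N'/N" "t x"] by linarith
    ultimately show "ennreal ((w x / N) powr t x) * indicator E x
        \<le> ennreal A * (ennreal ((w x / N') powr t x) * indicator E x)"
      by (auto simp: indicator_def ennreal_mult'[symmetric] intro!: ennreal_leI)
  qed
  also have "\<dots> = ennreal A * (\<integral>\<^sup>+x\<in>E. ennreal ((w x / N') powr t x) \<partial>lebesgue)"
    by (rule nn_integral_cmult) (use w E in measurable)
  finally show ?thesis using w E by (simp add: emeasure_modular_measure)
qed

lemma emeasure_finite:
  assumes w: "weight w" and E: "bounded_set E" and N: "0 < N"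
  shows "emeasure (modular_measure w N) E < \<infinity>"
proof -
  obtain a l where al: "0 < l" "E \<subseteq> cube a l" using E by (auto simp: bounded_set_def)
  have "(1 / N) powr t x \<le> max 1 ((1/N) powr P)" for x
  proof (cases "1 / N \<le> 1")
    case True
    have "(1/N) powr t x \<le> 1 powr t x"
      using True t_ge1[of x] N by (intro powr_mono2) auto
    then show ?thesis by simp
  next
    case False
    then have "(1/N) powr t x \<le> (1/N) powr P" using t_le by (intro powr_mono) auto
    then show ?thesis by simp
  qed
  then have "emeasure (modular_measure w N) E \<le> ennreal (max 1 ((1/N) powr P)) * emeasure (modular_measure w 1) E"
    using w E N by (intro emeasure_compare) (auto simp: weight_def bounded_set_def)
  also have "\<dots> \<le> ennreal (max 1 ((1/N) powr P)) * emeasure (modular_measure w 1) (cube a l)"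
    using al by (intro mult_left_mono emeasure_mono) auto
  also have "\<dots> < \<infinity>"
    using w al by (auto simp: weight_def ennreal_mult_less_top)
  finally show ?thesis .
qed

lemma fmeasurable_modular_measure:
  assumes "weight w" "bounded_set E" "0 < N"
  shows "E \<in> fmeasurable (modular_measure w N)"
  using emeasure_finite[OF assms] assms(2) by (simp add: fmeasurable_def bounded_set_def)

lemma emeasure_V:
  assumes "weight w" "bounded_set E" "0 < N"
  shows "emeasure (modular_measure w N) E = ennreal (V w N E)"
  using emeasure_finite[OF assms] by (intro emeasure_eq_ennreal_measure) auto

lemma V_mono:
  assumes "weight w" "bounded_set F" "0 < N" "E \<in> sets lebesgue" "E \<subseteq> F"
  shows "V w N E \<le> V w N F"
  using assms by (intro measure_mono_fmeasurable) (auto simp: fmeasurable_modular_measure)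

lemma bounded_subset: "bounded_set F \<Longrightarrow> E \<in> sets lebesgue \<Longrightarrow> E \<subseteq> F \<Longrightarrow> bounded_set E"
  unfolding bounded_set_def by blast

lemma V_split:
  assumes "weight w" "bounded_set E" "0 < N" "B \<in> sets lebesgue"
  shows "V w N E = V w N (E \<inter> B) + V w N (E - B)"
proof -
  have E: "E \<in> sets lebesgue" using assms by (simp add: bounded_set_def)
  have "V w N ((E \<inter> B) \<union> (E - B)) = V w N (E \<inter> B) + V w N (E - B)"
  proof (rule measure_Un_AE)
    show "E \<inter> B \<in> fmeasurable (modular_measure w N)" "E - B \<in> fmeasurable (modular_measure w N)"
      using assms E by (auto intro!: fmeasurable_modular_measure bounded_subset[of E])
  qed auto
  then show ?thesis by (simp add: Int_Diff_Un)
qed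

lemma V_compare:
  assumes w: "weight w" and E: "bounded_set E" and N: "0 < N" "0 < N'"
    and A: "0 \<le> A" "\<And>x. x \<in> E \<Longrightarrow> (N' / N) powr t x \<le> A"
  shows "V w N E \<le> A * V w N' E"
proof -
  have "ennreal (V w N E) \<le> ennreal A * ennreal (V w N' E)"
    using emeasure_compare[of w E N N' A] w E N A by (simp add: emeasure_V[symmetric] weight_def bounded_set_def)
  then show ?thesis using A by (simp add: ennreal_mult'[symmetric])
qed

lemma V_scale_down:
  assumes "weight w" "bounded_set E" "0 < N" "N \<le> N'"
  shows "V w N' E \<le> N / N' * V w N E"
proof (rule V_compare)
  fix x
  have "(N / N') powr t x \<le> (N / N') powr 1"
    using assms t_ge1[of x] by (intro powr_mono') auto
  then show "(N / N') powr t x \<le> N / N'" using assms by simp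
qed (use assms in auto)

lemma V_scale_up:
  assumes "weight w" "bounded_set E" "0 < N" "N \<le> N'"
  shows "V w N E \<le> (N' / N) powr P * V w N' E"
  by (rule V_compare) (use assms t_le in \<open>auto intro!: powr_mono\<close>)

lemma V_pos:
  assumes w: "weight w" and l: "0 < l" and N: "0 < N"
  shows "0 < V w N (cube a l)"
proof -
  have wm: "w \<in> borel_measurable lebesgue" "\<And>x. 0 < w x" using w by (auto simp: weight_def)
  have "emeasure (modular_measure w N) (cube a l) \<noteq> 0"
  proof
    assume "emeasure (modular_measure w N) (cube a l) = 0"
    then have "(\<integral>\<^sup>+x\<in>cube a l. ennreal ((w x / N) powr t x) \<partial>lebesgue) = 0"
      using wm by (simp add: emeasure_modular_measure)
    then have "AE x in lebesgue. ennreal ((w x / N) powr t x) * indicator (cube a l) x = 0"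
      by (subst (asm) nn_integral_0_iff_AE) (use wm in measurable)
    then have "AE x in lebesgue. x \<notin> cube a l"
    proof (rule eventually_mono)
      fix x assume "ennreal ((w x / N) powr t x) * indicator (cube a l) x = 0"
      moreover have "0 < (w x / N) powr t x" using wm(2)[of x] N by simp
      ultimately show "x \<notin> cube a l" by (auto simp: indicator_def)
    qed
    then have "emeasure lebesgue (cube a l) = 0"
      by (subst (asm) AE_iff_measurable[of "cube a l"]) auto
    then show False using l by (simp add: emeasure_cube)
  qed
  then show ?thesis
    using emeasure_V[OF w bounded_setI[OF l sets_cube order_refl, of a] N]
    by (simp add: zero_less_measure_iff)
qed

lemma bounded_cube [simp]: "0 < l \<Longrightarrow> bounded_set (cube a l)"
  by (auto simp: bounded_set_def)

text \<open>The infimum of the scales with modular at most one. The scaling bounds say that the modular cannot jump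
  there, since a change of scale by a factor \<open>a\<close> changes it by a factor at most \<open>a powr P\<close>.\<close>

lemma nrm_exists:
  assumes w: "weight w" and l: "0 < l"
  shows "\<exists>N. 0 < N \<and> V w N (cube a l) = 1"
proof -
  let ?Q = "cube a l"
  note bQ = bounded_cube[OF l, of a]
  have p: "0 < V w N ?Q" if "0 < N" for N using V_pos[OF w l that] .
  define S where "S = {N. 0 < N \<and> V w N ?Q \<le> 1}"
  define b where "b = min 1 (V w 1 ?Q)"
  have lower: "b \<le> N" if "N \<in> S" for N
  proof (rule ccontr)
    assume "\<not> b \<le> N"
    then have N: "0 < N" "N < 1" "N < V w 1 ?Q" "V w N ?Q \<le> 1" using that by (auto simp: S_def b_def)
    have "V w 1 ?Q \<le> N / 1 * V w N ?Q" by (rule V_scale_down) (use w bQ N in auto)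
    also have "\<dots> \<le> N" using N by (simp add: mult_left_le)
    finally show False using N by simp
  qed
  have "max 1 (V w 1 ?Q) \<in> S"
  proof -
    have "V w (max 1 (V w 1 ?Q)) ?Q \<le> 1 / max 1 (V w 1 ?Q) * V w 1 ?Q"
      by (rule V_scale_down) (use w bQ in auto)
    also have "\<dots> \<le> 1" by (simp add: divide_le_eq max_def)
    finally show ?thesis by (simp add: S_def)
  qed
  then have ne: "S \<noteq> {}" by blast
  have bdd: "bdd_below S" using lower by (meson bdd_belowI)
  define N where "N = Inf S"
  have b: "0 < b" using p[of 1] by (simp add: b_def)
  have N: "0 < N" using lower ne b cInf_greatest[of S b] by (simp add: N_def)
  have above: "V w M ?Q \<le> 1" if "N < M" for M
  proof -
    obtain s where s: "s \<in> S" "s < M" using \<open>N < M\<close> ne bdd cInf_less_iff by (auto simp: N_def)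
    have "V w M ?Q \<le> s / M * V w s ?Q" by (rule V_scale_down) (use s w bQ in \<open>auto simp: S_def\<close>)
    also have "\<dots> \<le> 1 * 1" using s by (intro mult_mono) (auto simp: S_def divide_le_eq)
    finally show ?thesis by simp
  qed
  have below: "1 < V w M ?Q" if "0 < M" "M < N" for M
    using that cInf_lower[OF _ bdd, of M] by (auto simp: S_def N_def not_less[symmetric])
  have up: "V w N ?Q \<le> a powr P" if "1 < a" for a
  proof -
    have "V w N ?Q \<le> (a * N / N) powr P * V w (a * N) ?Q"
      by (rule V_scale_up) (use w bQ N that in auto)
    also have "\<dots> \<le> a powr P * 1" using above[of "a * N"] N that by (intro mult_mono) auto
    finally show ?thesis by simp
  qed
  have down: "1 \<le> a powr P * V w N ?Q" if "1 < a" for a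
  proof -
    have "V w (N / a) ?Q \<le> (N / (N / a)) powr P * V w N ?Q"
      by (rule V_scale_up) (use w bQ N that in \<open>auto simp: divide_le_eq\<close>)
    moreover have "N / (N / a) = a" using N by simp
    moreover have "1 < V w (N / a) ?Q"
      by (rule below) (use N that in \<open>auto simp: divide_less_eq\<close>)
    ultimately show ?thesis by simp
  qed
  have lim: "((\<lambda>a. a powr P) \<longlongrightarrow> 1 powr P) (at_right (1::real))"
    by (intro tendsto_intros) auto
  have "V w N ?Q \<le> 1 powr P"
    by (rule tendsto_lowerbound[OF lim])
       (use up in \<open>auto simp: eventually_at_right_field intro!: exI[of _ 2]\<close>)
  moreover have "1 \<le> 1 powr P * V w N ?Q"
  proof (rule tendsto_lowerbound[OF tendsto_mult_right[OF lim]])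
  qed (use down in \<open>auto simp: eventually_at_right_field intro!: exI[of _ 2]\<close>)
  ultimately show ?thesis using N by auto
qed

lemma nrm_pos: "weight w \<Longrightarrow> 0 < l \<Longrightarrow> 0 < nrm w (cube a l)"
  and V_nrm: "weight w \<Longrightarrow> 0 < l \<Longrightarrow> V w (nrm w (cube a l)) (cube a l) = 1"
  using someI_ex[OF nrm_exists] unfolding nrm_def by blast+

lemma le_norm_if_modular_ge_1:
  assumes w: "weight w" and l: "0 < l" and "0 < N" "1 \<le> V w N (cube a l)"
  shows "N \<le> nrm w (cube a l)"
proof (rule ccontr)
  let ?M = "nrm w (cube a l)"
  assume "\<not> N \<le> ?M"
  then have "V w N (cube a l) \<le> ?M / N * V w ?M (cube a l)"
    by (intro V_scale_down[OF w bounded_cube[OF l] nrm_pos[OF w l]]) simp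
  also have "\<dots> = ?M / N" using V_nrm[OF w l, of a] by simp
  also have "\<dots> < 1" using \<open>\<not> N \<le> ?M\<close> \<open>0 < N\<close> by simp
  finally show False using assms(4) by simp
qed

lemma norm_le_if_modular_le_1:
  assumes w: "weight w" and l: "0 < l" and b: "0 < b" "V w b (cube a l) \<le> 1"
  shows "nrm w (cube a l) \<le> b"
proof (rule ccontr)
  let ?M = "nrm w (cube a l)"
  assume "\<not> ?M \<le> b"
  then have M: "b < ?M" by simp
  have "V w ?M (cube a l) \<le> b / ?M * V w b (cube a l)"
    by (rule V_scale_down[OF w bounded_cube[OF l] b(1)]) (use M in simp)
  also have "\<dots> \<le> b / ?M * 1" using b M by (intro mult_left_mono) auto
  also have "\<dots> < 1" using M b by simp
  finally show False using V_nrm[OF w l, of a] by simp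
qed

lemma nrm_mono:
  assumes w: "weight w" and l: "0 < l" "0 < l'" and sub: "cube a l \<subseteq> cube a' l'"
  shows "nrm w (cube a l) \<le> nrm w (cube a' l')"
proof (rule le_norm_if_modular_ge_1[OF w l(2) nrm_pos[OF w l(1)]])
  show "1 \<le> V w (nrm w (cube a l)) (cube a' l')"
    unfolding V_nrm[OF w l(1), of a, symmetric]
    by (rule V_mono[OF w bounded_cube[OF l(2)] nrm_pos[OF w l(1)] sets_cube sub])
qed

text \<open>The trace that the Muckenhoupt condition on \<open>w\<close> leaves after the dual norm is eliminated by Young's
  inequality: a subset that is large for Lebesgue measure is large for the normalised modular. It is
  invariant under multiplying \<open>w\<close> by constants, and its two parameters \<open>c\<close> and \<open>P\<close> are all that the
  constants in the reverse Hoelder inequality depend on, besides the exponent and the dimension.\<close>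

definition admissible :: "real \<Rightarrow> (real^'n \<Rightarrow> real) \<Rightarrow> bool" where
  "admissible c w \<longleftrightarrow> weight w \<and> 0 < c \<and> c \<le> 1 \<and>
     (\<forall>a l E. 0 < l \<longrightarrow> E \<in> sets lebesgue \<longrightarrow> E \<subseteq> cube a l \<longrightarrow>
       (c * measure lebesgue E / measure lebesgue (cube a l)) powr P \<le> V w (nrm w (cube a l)) E)"

lemma admissibleD:
  assumes "admissible c w"
  shows "weight w" "0 < c" "c \<le> 1"
    "\<And>a l E. 0 < l \<Longrightarrow> E \<in> sets lebesgue \<Longrightarrow> E \<subseteq> cube a l \<Longrightarrow>
       (c * measure lebesgue E / l ^ CARD('n)) powr P \<le> V w (nrm w (cube a l)) E"
proof -
  show "weight w" "0 < c" "c \<le> 1" using assms by (auto simp: admissible_def)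
next
  fix a :: "real^'n" and l :: real and E
  assume l: "0 < l" and E: "E \<in> sets lebesgue" "E \<subseteq> cube a l"
  have "(c * measure lebesgue E / measure lebesgue (cube a l)) powr P \<le> V w (nrm w (cube a l)) E"
    using assms l E unfolding admissible_def by blast
  then show "(c * measure lebesgue E / l ^ CARD('n)) powr P \<le> V w (nrm w (cube a l)) E"
    by (simp only: measure_cube[OF less_imp_le[OF l]])
qed

text \<open>Admissibility with \<open>E\<close> a subcube.\<close>

lemma nrm_doubling:
  assumes adm: "admissible c w" and l: "0 < l" "0 < l'" and sub: "cube a l \<subseteq> cube a' l'"
  shows "nrm w (cube a' l') \<le> (l' ^ CARD('n) / (c * l ^ CARD('n))) powr P * nrm w (cube a l)"
proof -
  note w = admissibleD(1)[OF adm] and c = admissibleD(2,3)[OF adm]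
  let ?N = "nrm w (cube a l)" and ?N' = "nrm w (cube a' l')" and ?q = "l' ^ CARD('n) / (c * l ^ CARD('n))"
  have pos: "0 < ?N" "0 < ?N'" using nrm_pos w l by auto
  have q: "0 < ?q" using l c by simp
  have inv: "c * l ^ CARD('n) / l' ^ CARD('n) = 1 / ?q" by simp
  have "(c * measure lebesgue (cube a l) / l' ^ CARD('n)) powr P \<le> V w ?N' (cube a l)"
    by (rule admissibleD(4)[OF adm l(2) sets_cube sub])
  then have "(1 / ?q) powr P \<le> V w ?N' (cube a l)"
    by (simp only: measure_cube[OF less_imp_le[OF l(1)]] inv)
  also have "\<dots> \<le> ?N / ?N' * V w ?N (cube a l)"
    by (rule V_scale_down[OF w bounded_cube[OF l(1)] pos(1) nrm_mono[OF w l sub]])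
  also have "\<dots> = ?N / ?N'" using V_nrm[OF w l(1)] by simp
  finally have "(1 / ?q) powr P \<le> ?N / ?N'" .
  then have "1 / (?q powr P) \<le> ?N / ?N'" by (simp only: powr_divide powr_one_eq_one)
  moreover have "0 < ?q powr P" using q by (simp only: powr_gt_zero)
  ultimately have "1 \<le> ?N / ?N' * ?q powr P" by (simp only: pos_divide_le_eq)
  also have "\<dots> = (?q powr P * ?N) / ?N'" by (simp add: mult_ac)
  finally show ?thesis using pos(2) by (simp only: pos_le_divide_eq mult_1_left)
qed

end

section \<open>Comparing norm and modular under log-Hoelder continuity\<close>

text \<open>The cube of side \<open>2 R\<close> centred at the origin.\<close>

abbreviation ctr :: "real \<Rightarrow> (real^'n) set" where
  "ctr R \<equiv> cube (\<chi> i. - R) (2 * R)"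

lemma ctr_mono: "R \<le> R' \<Longrightarrow> ctr R \<subseteq> ctr R'"
  by (simp add: subset_iff mem_cube) (smt (verit))

lemma norm_gt_if_not_in_ctr: "x \<notin> ctr R \<Longrightarrow> R < norm x"
proof (rule ccontr)
  assume x: "x \<notin> ctr R" and "\<not> R < norm x"
  then have "\<bar>x $ i\<bar> \<le> R" for i
    using component_le_norm_cart[of x i] by linarith
  then have "- R \<le> x $ i \<and> x $ i \<le> - R + 2 * R" for i
    by (metis abs_le_D1 abs_le_D2 add.commute mult_2 add_diff_cancel_left' diff_conv_add_uminus minus_le_iff)
  then show False using x by (simp add: mem_cube)
qed

lemma cube_subset_ctr:
  fixes a x0 :: "real^'n" and l r :: real
  assumes "x0 \<in> cube a l" "\<And>i. \<bar>x0 $ i\<bar> \<le> r"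
  shows "cube a l \<subseteq> ctr (r + l)"
proof
  fix x assume x: "x \<in> cube a l"
  have "- (r + l) \<le> x $ i \<and> x $ i \<le> - (r + l) + 2 * (r + l)" for i
  proof -
    have "a $ i \<le> x $ i" "x $ i \<le> a $ i + l" "a $ i \<le> x0 $ i" "x0 $ i \<le> a $ i + l"
      using x assms(1) by (auto simp: mem_cube)
    moreover have "- r \<le> x0 $ i" "x0 $ i \<le> r" using assms(2)[of i] by (simp_all add: abs_le_iff minus_le_iff)
    ultimately have "- (r + l) \<le> x $ i" "x $ i \<le> - (r + l) + 2 * (r + l)"
      by (simp_all only: mult_2)
    then show ?thesis by blast
  qed
  then show "x \<in> ctr (r + l)" by (simp add: mem_cube)
qed

lemma powr_near:
  fixes N s u L :: real
  assumes "0 < N" "\<bar>ln N\<bar> * \<bar>s - u\<bar> \<le> L"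
  shows "N powr u \<le> exp L * N powr s" "N powr s \<le> exp L * N powr u"
proof -
  have "\<bar>ln N * (s - u)\<bar> \<le> L" using assms(2) by (simp add: abs_mult)
  then have "s * ln N \<le> L + u * ln N" "u * ln N \<le> L + s * ln N"
    unfolding abs_le_iff by (simp_all add: algebra_simps)
  then show "N powr u \<le> exp L * N powr s" "N powr s \<le> exp L * N powr u"
    using assms(1) by (simp_all add: powr_def exp_add[symmetric])
qed

lemma dist_in_cube:
  fixes a :: "real^'n" and l :: real
  assumes "x \<in> cube a l" "y \<in> cube a l"
  shows "norm (x - y) \<le> CARD('n) * l"
proof -
  have "\<bar>(x - y) $ i\<bar> \<le> l" for i
  proof -
    have "a $ i \<le> x $ i" "x $ i \<le> a $ i + l" "a $ i \<le> y $ i" "y $ i \<le> a $ i + l"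
      using assms by (auto simp: mem_cube)
    then show ?thesis by simp
  qed
  then have "(\<Sum>i\<in>UNIV. \<bar>(x - y) $ i\<bar>) \<le> (\<Sum>i\<in>(UNIV::'n set). l)" by (intro sum_mono) auto
  then show ?thesis using norm_le_l1_cart[of "x - y"] by simp
qed

context lh_exponent
begin

text \<open>The normalisation breaks the scaling invariance: it ties the size of the norm on a cube to the side of
  the cube and its distance from the origin, and only for norms of such moderate size can log-Hoelder
  continuity compare \<open>N powr t x\<close> with \<open>N powr t y\<close>.\<close>

definition normalized :: "real \<Rightarrow> (real^'n \<Rightarrow> real) \<Rightarrow> bool" where
  "normalized c w \<longleftrightarrow> admissible c w \<and> nrm w (ctr 1) = 1"

lemma normalizedD: "normalized c w \<Longrightarrow> admissible c w" "normalized c w \<Longrightarrow> weight w"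
    "normalized c w \<Longrightarrow> nrm w (ctr 1) = 1"
  by (auto simp: normalized_def admissible_def)

text \<open>The decay condition at infinity lets \<open>t\<close> be replaced by \<open>\<tau>\<close> in \<open>N powr t x\<close> as long as \<open>\<bar>ln N\<bar>\<close> is of
  order at most \<open>ln \<bar>x\<bar>\<close>.\<close>

lemma deviation_at_infinity:
  assumes "0 \<le> k" "\<bar>ln N\<bar> \<le> k * ln (exp 1 + norm x)"
  shows "\<bar>ln N\<bar> * \<bar>t x - \<tau>\<bar> \<le> k * Ci"
proof -
  have "1 < exp 1 + norm x" by (smt (verit) exp_gt_one norm_ge_zero)
  then have l: "0 < ln (exp 1 + norm x)" by simp
  have "\<bar>ln N\<bar> * \<bar>t x - \<tau>\<bar> \<le> (k * ln (exp 1 + norm x)) * (Ci / ln (exp 1 + norm x))"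
    using assms lh_inf[of x] l by (intro mult_mono) auto
  then show ?thesis using l by simp
qed

text \<open>The diameter is at most \<open>n * l \<le> sqrt l\<close>, where \<open>n\<close> is the dimension, and the logarithm of \<open>sqrt l\<close> is half of that of \<open>l\<close>.\<close>

lemma oscillation_small_cube:
  fixes l :: real
  assumes l: "0 < l" "4 * (CARD('n) * CARD('n)) * l < 1" and x: "x \<in> cube a l" "y \<in> cube a l"
  shows "\<bar>t x - t y\<bar> \<le> 2 * C0 / ln (1 / l)"
proof -
  define n where "n = real CARD('n)"
  have n: "1 \<le> n" unfolding n_def by (rule one_le_dim)
  have nnl: "4 * (n * (n * l)) < 1" using l by (simp add: n_def mult_ac)
  have nl: "1 * l \<le> n * l" "1 * (n * l) \<le> n * (n * l)"
    using n l by (auto intro!: mult_right_mono simp del: mult_1_left)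
  then have l1: "l < 1" using nnl l by linarith
  have L: "0 < ln (1 / l)" using l l1 by simp
  show ?thesis
  proof (cases "x = y")
    case True
    then show ?thesis using C0 L by simp
  next
  case False
  have d0: "0 < norm (x - y)" using False by simp
  have d: "norm (x - y) \<le> n * l" using dist_in_cube[OF x] by (simp add: n_def)
  then have dh: "norm (x - y) < 1/2" using nl nnl by linarith
  have "(n * l) * (n * l) \<le> l"
    using mult_right_mono[of "n*(n*l)" 1 l] nnl l n by (simp add: mult_ac)
  then have "ln ((n * l) * (n * l)) \<le> ln l" using n l by (subst ln_le_cancel_iff) auto
  then have "2 * ln (n * l) \<le> - ln (1 / l)" using n l by (simp add: ln_mult ln_div)
  moreover have "ln (norm (x - y)) \<le> ln (n * l)" using d d0 n l by (subst ln_le_cancel_iff) auto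
  ultimately have lnd: "ln (1 / l) / 2 \<le> - ln (norm (x - y))" by simp
  have "\<bar>t x - t y\<bar> \<le> C0 / (- ln (norm (x - y)))" by (rule lh_local[OF dh])
  also have "\<dots> \<le> C0 / (ln (1 / l) / 2)" using lnd C0 L by (intro divide_left_mono mult_pos_pos) auto
  finally show ?thesis by (simp add: mult.commute)
  qed
qed

lemma nrm_ctr_ge1:
  assumes "normalized c w" "1 \<le> R"
  shows "1 \<le> nrm w (ctr R)"
  using nrm_mono[OF normalizedD(2)[OF assms(1)], of "2*1" "2*R" "\<chi> i. - 1" "\<chi> i. - R"]
    ctr_mono[OF assms(2)] assms normalizedD(3)[OF assms(1)] by simp

lemma nrm_ctr_le:
  assumes w: "normalized c w" and R: "1 \<le> R"
  shows "nrm w (ctr R) \<le> (R ^ CARD('n) / c) powr P"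
proof -
  have "nrm w (ctr R) \<le> ((2*R) ^ CARD('n) / (c * (2*1) ^ CARD('n))) powr P * nrm w (ctr 1)"
    using ctr_mono[OF R] R by (intro nrm_doubling[OF normalizedD(1)[OF w]]) auto
  also have "(2*R) ^ CARD('n) / (c * (2*1) ^ CARD('n)) = R ^ CARD('n) / c"
    by (simp add: power_mult_distrib)
  finally show ?thesis using normalizedD(3)[OF w] by simp
qed

lemma nrm_cube_ge:
  assumes w: "normalized c w" and R: "1 \<le> R" and l: "0 < l" and sub: "cube a l \<subseteq> ctr R"
  shows "(c * (l / (2*R)) ^ CARD('n)) powr P \<le> nrm w (cube a l)"
proof -
  note adm = normalizedD(1)[OF w]
  have c: "0 < c" using admissibleD(2)[OF adm] .
  define q where "q = (2*R) ^ CARD('n) / (c * l ^ CARD('n))"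
  have q: "0 < q" using R c l by (simp add: q_def)
  have "1 \<le> nrm w (ctr R)" by (rule nrm_ctr_ge1[OF w R])
  also have "\<dots> \<le> q powr P * nrm w (cube a l)"
    unfolding q_def using R l sub by (intro nrm_doubling[OF adm]) auto
  finally have "1 / q powr P \<le> nrm w (cube a l)"
    using q by (simp add: pos_divide_le_eq mult.commute)
  moreover have "1 / q powr P = (1 / q) powr P" by (simp add: powr_divide)
  moreover have "1 / q = c * (l / (2*R)) ^ CARD('n)" by (simp add: q_def power_divide)
  ultimately show ?thesis by simp
qed

text \<open>The cube \<open>ctr (N powr (1 / bad_exp))\<close> is where \<open>t\<close> cannot be replaced by \<open>\<tau>\<close> when the norm \<open>N\<close> is
  large. The exponent is chosen so that the mass of this cube is at most of order \<open>N powr (1/2)\<close>, and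
  hence negligible against \<open>N powr \<tau>\<close>.\<close>

definition bad_exp :: real where "bad_exp = 2 * CARD('n) * P * P"

lemma bad_exp_pos: "0 < bad_exp" "bad_exp \<ge> 2 * CARD('n)" "1 \<le> bad_exp"
proof -
  have n: "1 \<le> real CARD('n)" by (simp add: Suc_leI)
  have "1 * 1 \<le> P * P" using P_ge1 by (intro mult_mono) auto
  then show "bad_exp \<ge> 2 * CARD('n)"
    using n mult_left_mono[of 1 "P * P" "2 * real CARD('n)"] by (simp add: bad_exp_def mult.assoc)
  then show "0 < bad_exp" "1 \<le> bad_exp" using n by linarith+
qed

lemma mass_le_norm_power:
  assumes "weight w" "0 < l" "1 \<le> nrm w (cube a l)"
  shows "V w 1 (cube a l) \<le> nrm w (cube a l) powr P"
proof -
  have "V w 1 (cube a l) \<le> (nrm w (cube a l) / 1) powr P * V w (nrm w (cube a l)) (cube a l)"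
    by (rule V_scale_up) (use assms in auto)
  then show ?thesis using V_nrm[OF assms(1,2), of a] by simp
qed

lemma mass_ctr_le:
  assumes w: "normalized c w" and N: "1 \<le> N"
  shows "V w 1 (ctr (N powr (1 / bad_exp))) \<le> (1/c) powr (P*P) * N powr (1/2)"
proof -
  let ?R = "N powr (1 / bad_exp)"
  have c: "0 < c" using admissibleD(2)[OF normalizedD(1)[OF w]] .
  have R: "1 \<le> ?R" using N bad_exp_pos by (simp add: ge_one_powr_ge_zero)
  have "V w 1 (ctr ?R) \<le> nrm w (ctr ?R) powr P"
    using R by (intro mass_le_norm_power normalizedD(2)[OF w] nrm_ctr_ge1[OF w]) auto
  also have "\<dots> \<le> ((?R ^ CARD('n) / c) powr P) powr P"
    using nrm_ctr_le[OF w R] nrm_ctr_ge1[OF w R] P_ge1 by (intro powr_mono2) auto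
  also have "\<dots> = (?R ^ CARD('n) / c) powr (P * P)" by (simp add: powr_powr)
  also have "\<dots> = (1/c) powr (P*P) * (?R ^ CARD('n)) powr (P * P)"
    by (simp add: powr_divide)
  also have "(?R ^ CARD('n)) powr (P * P) = N powr (1/2)"
  proof -
    have "(?R ^ CARD('n)) powr (P * P) = N powr ((1 / bad_exp * CARD('n)) * (P * P))"
      using N by (simp add: powr_powr powr_realpow[symmetric])
    also have "(1 / bad_exp * CARD('n)) * (P * P) = 1/2"
      using P_ge1 by (simp add: bad_exp_def)
    finally show ?thesis .
  qed
  finally show ?thesis .
qed

text \<open>With \<open>N < 1\<close> the norm on the cube, three things can happen. Either the whole cube is at distance at least
  \<open>N powr (-1/k)\<close> from the origin, and the condition at infinity applies. Or the cube is near the origin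
  compared with its side, or of side bounded below; then doubling against a centred cube bounds \<open>N\<close> below.
  Or the side \<open>l\<close> is small and doubling gives \<open>N \<ge> const * l powr k\<close>, so that \<open>\<bar>ln N\<bar>\<close> is at most of order
  \<open>ln (1/l)\<close> and local log-Hoelder continuity applies.\<close>

lemma flat_if_small:
  assumes c: "0 < c" "c \<le> 1"
  shows "\<exists>D\<ge>1. \<forall>w a l. normalized c w \<longrightarrow> 0 < l \<longrightarrow> nrm w (cube a l) < 1 \<longrightarrow>
     (\<exists>T>0. \<forall>x\<in>cube a l. T \<le> D * nrm w (cube a l) powr t x \<and> nrm w (cube a l) powr t x \<le> D * T)"
proof -
  define n where "n = real CARD('n)"
  have n: "1 \<le> n" by (simp add: n_def Suc_leI)
  define k where "k = 2 * n * P"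
  have k: "1 \<le> k" using n P_ge1 mult_mono[of 1 n 1 P] by (simp add: k_def)
  define c3 where "c3 = (c / 4 ^ CARD('n)) powr P"
  define l0 where "l0 = 1 / (4 * n * n)"
  have l0: "0 < l0" "l0 \<le> 1/4" using n mult_mono[of 1 n 1 n] by (auto simp: l0_def divide_simps)
  have c3: "0 < c3" "c3 \<le> 1"
  proof -
    show "0 < c3" using c by (simp add: c3_def)
    have "c / 4 ^ CARD('n) \<le> 1" using c by (simp add: divide_le_eq) (meson c(2) dual_order.trans one_le_numeral one_le_power)
    then show "c3 \<le> 1" using c P_ge1 powr_mono2[of P "c / 4 ^ CARD('n)" 1] by (simp add: c3_def)
  qed
  define c4 where "c4 = c3 * (c3 * l0 powr k)"
  have c4: "0 < c4" "c4 \<le> c3"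
  proof -
    have "l0 powr k \<le> 1" using l0 k powr_mono2[of k l0 1] by simp
    then have "c3 * l0 powr k \<le> 1" using c3 mult_mono[of c3 1 "l0 powr k" 1] by simp
    then show "c4 \<le> c3" "0 < c4" using c3 l0 by (auto simp: c4_def mult_left_le)
  qed
  define L where "L = 2 * C0 * (2 * ln (1 / c3) + k)"
  define D where "D = max (exp (k * Ci)) (max (1 / c4 powr P) (exp L))"
  have D: "1 \<le> D" "exp (k * Ci) \<le> D" "1 / c4 powr P \<le> D" "exp L \<le> D"
    using k Ci by (auto simp: D_def le_max_iff_disj)
  have "\<exists>T>0. \<forall>x\<in>cube a l. T \<le> D * nrm w (cube a l) powr t x \<and> nrm w (cube a l) powr t x \<le> D * T"
    if w: "normalized c w" and l: "0 < l" and small: "nrm w (cube a l) < 1" for w a l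
  proof -
    let ?Q = "cube a l"
    define N where "N = nrm w ?Q"
    have N: "0 < N" "N < 1" using small nrm_pos[OF normalizedD(2)[OF w] l] by (auto simp: N_def)
    have ln: "ln N < 0" using N by simp
    have close: "\<exists>T>0. \<forall>x\<in>?Q. T \<le> D * N powr t x \<and> N powr t x \<le> D * T"
      if "exp M \<le> D" "\<And>x. x \<in> ?Q \<Longrightarrow> \<bar>ln N\<bar> * \<bar>t x - u\<bar> \<le> M" for u M
    proof (intro exI[of _ "N powr u"] conjI ballI)
      fix x assume x: "x \<in> ?Q"
      show "N powr u \<le> D * N powr t x" "N powr t x \<le> D * N powr u"
        using powr_near[OF N(1) that(2)[OF x]] that(1)
        by (smt (verit) mult_right_mono powr_ge_zero)+
    qed (use N in auto)
    define R1 where "R1 = N powr (- 1 / k)"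
    have R1: "1 \<le> R1" "ln R1 = - ln N / k"
    proof -
      show "ln R1 = - ln N / k" using N by (simp add: R1_def ln_powr)
      have "0 \<le> ln R1" using ln k unfolding \<open>ln R1 = - ln N / k\<close> by (simp add: divide_nonpos_pos)
      moreover have "0 < R1" using N by (simp add: R1_def)
      ultimately show "1 \<le> R1" by (simp only: ln_ge_zero_iff)
    qed
    show ?thesis unfolding N_def[symmetric]
    proof (cases "\<forall>x\<in>?Q. R1 \<le> norm x")
      case True
      show "\<exists>T>0. \<forall>x\<in>?Q. T \<le> D * N powr t x \<and> N powr t x \<le> D * T"
      proof (rule close[OF D(2), of \<tau>])
        fix x assume "x \<in> ?Q"
        then have "R1 \<le> exp 1 + norm x" using True by (smt (verit) exp_gt_zero)
        then have "ln R1 \<le> ln (exp 1 + norm x)" using R1(1) by (subst ln_le_cancel_iff) auto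
        then have "- ln N \<le> k * ln (exp 1 + norm x)"
          using R1(2) k by (simp add: field_simps)
        then show "\<bar>ln N\<bar> * \<bar>t x - \<tau>\<bar> \<le> k * Ci" using ln k by (intro deviation_at_infinity) auto
      qed
    next
      case False
      then obtain x0 where x0: "x0 \<in> ?Q" "norm x0 < R1" by (auto simp: not_le)
      have sub: "?Q \<subseteq> ctr (R1 + l)"
        using x0 component_le_norm_cart[of x0] by (intro cube_subset_ctr[of x0]) (auto intro: order_trans less_imp_le)
      have big: "\<exists>T>0. \<forall>x\<in>?Q. T \<le> D * N powr t x \<and> N powr t x \<le> D * T" if "c4 \<le> N"
      proof (intro exI[of _ 1] conjI ballI)
        fix x
        have "c4 powr P \<le> N powr P" using that c4 P_ge1 by (intro powr_mono2) auto
        also have "\<dots> \<le> N powr t x" using N t_le[of x] by (intro powr_mono') auto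
        finally have "1 / c4 powr P * c4 powr P \<le> D * N powr t x"
          using D c4 by (intro mult_mono) auto
        then show "1 \<le> D * N powr t x" using c4 by simp
        have "N powr t x \<le> 1 powr t x" using N t_ge1[of x] by (intro powr_mono2) auto
        then show "N powr t x \<le> D * 1" using D by simp
      qed simp
      show "\<exists>T>0. \<forall>x\<in>?Q. T \<le> D * N powr t x \<and> N powr t x \<le> D * T"
      proof (cases "R1 \<le> l")
        case True
        have "?Q \<subseteq> ctr (2 * l)" using sub ctr_mono[of "R1 + l" "2 * l"] True by auto
        then have "(c * (l / (2*(2*l))) ^ CARD('n)) powr P \<le> N"
          unfolding N_def using True R1 l by (intro nrm_cube_ge[OF w]) auto
        also have "c * (l / (2*(2*l))) ^ CARD('n) = c / 4 ^ CARD('n)"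
          using l by (simp add: power_divide)
        finally have "c4 \<le> N" using c4 by (simp add: c3_def)
        then show ?thesis by (rule big)
      next
        case False
        have "?Q \<subseteq> ctr (2 * R1)" using sub ctr_mono[of "R1 + l" "2 * R1"] False by auto
        then have "(c * (l / (2*(2*R1))) ^ CARD('n)) powr P \<le> N"
          unfolding N_def using R1 l by (intro nrm_cube_ge[OF w]) auto
        moreover have "(c * (l / (2*(2*R1))) ^ CARD('n)) powr P = c3 * l powr (n * P) * N powr (1/2)"
        proof -
          have eq: "c * (l / (2*(2*R1))) ^ CARD('n) = (c / 4 ^ CARD('n)) * (l / R1) ^ CARD('n)"
            by (simp add: power_divide power_mult_distrib)
          have "(c * (l / (2*(2*R1))) ^ CARD('n)) powr P = c3 * ((l / R1) ^ CARD('n)) powr P"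
            unfolding eq c3_def by (rule powr_mult)
          also have "((l / R1) ^ CARD('n)) powr P = (l / R1) powr (n * P)"
            using l R1 by (simp add: powr_realpow[symmetric] powr_powr n_def)
          also have "\<dots> = l powr (n * P) / R1 powr (n * P)" by (simp add: powr_divide)
          also have "R1 powr (n * P) = N powr (- 1/2)"
            using n P_ge1 by (simp add: R1_def powr_powr k_def)
          also have "l powr (n * P) / N powr (- 1/2) = l powr (n * P) * N powr (1/2)"
            using N by (simp add: powr_minus divide_simps powr_add[symmetric])
          finally show ?thesis by simp
        qed
        ultimately have "c3 * l powr (n * P) * N powr (1/2) \<le> N powr (1/2) * N powr (1/2)"
          using N by (simp add: powr_add[symmetric])
        then have half: "c3 * l powr (n * P) \<le> N powr (1/2)" using N by simp
        then have "(c3 * l powr (n * P)) * (c3 * l powr (n * P)) \<le> N powr (1/2) * N powr (1/2)"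
          using c3 by (intro mult_mono) auto
        also have "\<dots> = N" using N by (simp add: powr_add[symmetric])
        also have "(c3 * l powr (n * P)) * (c3 * l powr (n * P)) = c3 * (c3 * l powr k)"
          by (simp add: k_def powr_add[symmetric] mult_ac)
        finally have lowN: "c3 * (c3 * l powr k) \<le> N" .
        show ?thesis
        proof (cases "l0 \<le> l")
          case True
          have "l0 powr k \<le> l powr k" using True l0 k by (intro powr_mono2) auto
          then have "c4 \<le> N" using lowN c3 unfolding c4_def by (meson mult_left_mono less_imp_le order_trans)
          then show ?thesis by (rule big)
        next
          case False
          define \<Lambda> where "\<Lambda> = ln (1 / l)"
          have "ln (exp 1) \<le> \<Lambda>"
          proof -
            have "exp 1 < (4::real)" using exp_le by (smt (verit))
            moreover have "4 \<le> 1 / l" using False l l0 by (simp add: le_divide_eq)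
            ultimately show ?thesis unfolding \<Lambda>_def using l by (subst ln_le_cancel_iff) auto
          qed
          then have \<Lambda>: "1 \<le> \<Lambda>" by simp
          have lnN: "\<bar>ln N\<bar> \<le> 2 * ln (1 / c3) + k * \<Lambda>"
          proof -
            have "ln (c3 * (c3 * l powr k)) \<le> ln N" using lowN c3 l N by (subst ln_le_cancel_iff) auto
            then have "2 * ln c3 + k * ln l \<le> ln N" using c3 l by (simp add: ln_mult ln_powr)
            then show ?thesis using ln c3 l by (simp add: \<Lambda>_def ln_div)
          qed
          show ?thesis
          proof (rule close[OF D(4), of "t a"])
            fix x assume x: "x \<in> ?Q"
            have a: "a \<in> ?Q" using l by (simp add: mem_cube)
            have "\<bar>t x - t a\<bar> \<le> 2 * C0 / \<Lambda>"
              unfolding \<Lambda>_def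
              by (rule oscillation_small_cube[OF l _ x a]) (use False n l in \<open>simp add: l0_def n_def field_simps\<close>)
            then have "\<bar>ln N\<bar> * \<bar>t x - t a\<bar> \<le> (2 * ln (1 / c3) + k * \<Lambda>) * (2 * C0 / \<Lambda>)"
              using lnN C0 \<Lambda> by (intro mult_mono) auto
            also have "\<dots> \<le> ((2 * ln (1 / c3) + k) * \<Lambda>) * (2 * C0 / \<Lambda>)"
            proof (rule mult_right_mono)
              have "0 \<le> ln (1 / c3)" using c3 by (simp add: ln_ge_zero_iff)
              then show "2 * ln (1 / c3) + k * \<Lambda> \<le> (2 * ln (1 / c3) + k) * \<Lambda>"
                using \<Lambda> mult_left_mono[of 1 \<Lambda> "2 * ln (1/c3)"] by (simp add: distrib_right)
            qed (use C0 \<Lambda> in auto)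
            also have "\<dots> = L" using \<Lambda> by (simp add: L_def field_simps)
            finally show "\<bar>ln N\<bar> * \<bar>t x - t a\<bar> \<le> L" .
          qed
        qed
      qed
    qed
  qed
  then show ?thesis using D(1) by blast
qed

text \<open>Up to the factor \<open>D\<close>, the function \<open>N powr t x\<close> has the constant value \<open>T\<close> on \<open>Q - B\<close>, where \<open>N\<close> is the norm
  of \<open>w\<close> on \<open>Q\<close>; the exceptional set \<open>B\<close> occurs only for large norms.\<close>

definition flat_off :: "real \<Rightarrow> (real^'n \<Rightarrow> real) \<Rightarrow> (real^'n) set \<Rightarrow> real \<Rightarrow> (real^'n) set \<Rightarrow> bool" where
  "flat_off D w Q T B \<longleftrightarrow> 0 < T \<and>
     (B = {} \<or> 1 \<le> nrm w Q \<and> T = nrm w Q powr \<tau> \<and> B = Q \<inter> ctr (nrm w Q powr (1 / bad_exp))) \<and>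
     (\<forall>x\<in>Q - B. T \<le> D * nrm w Q powr t x \<and> nrm w Q powr t x \<le> D * T)"

lemma flat_dichotomy:
  assumes c: "0 < c" "c \<le> 1"
  shows "\<exists>D\<ge>1. \<forall>w a l. normalized c w \<longrightarrow> 0 < l \<longrightarrow> (\<exists>T B. flat_off D w (cube a l) T B)"
proof -
  obtain D1 where D1: "1 \<le> D1" and small: "\<And>w a l. normalized c w \<Longrightarrow> 0 < l \<Longrightarrow> nrm w (cube a l) < 1 \<Longrightarrow>
     \<exists>T>0. \<forall>x\<in>cube a l. T \<le> D1 * nrm w (cube a l) powr t x \<and> nrm w (cube a l) powr t x \<le> D1 * T"
    using flat_if_small[OF c] by blast
  define D where "D = max D1 (exp (bad_exp * Ci))"
  have D: "1 \<le> D" "D1 \<le> D" "exp (bad_exp * Ci) \<le> D" using D1 by (auto simp: D_def)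
  have main: "\<exists>T>0. \<exists>B. (B = {} \<or> 1 \<le> N \<and> T = N powr \<tau> \<and> B = cube a l \<inter> ctr (N powr (1 / bad_exp))) \<and>
       (\<forall>x\<in>cube a l - B. T \<le> D * N powr t x \<and> N powr t x \<le> D * T)"
    if w: "normalized c w" and l: "0 < l" and N_def: "N = nrm w (cube a l)" for w a l N
  proof (cases "N < 1")
    case True
    then obtain T where T: "T > 0" "\<And>x. x\<in>cube a l \<Longrightarrow> T \<le> D1 * N powr t x \<and> N powr t x \<le> D1 * T"
      using small[OF w l] unfolding N_def by blast
    have "T \<le> D * N powr t x \<and> N powr t x \<le> D * T" if "x \<in> cube a l" for x
      using T(2)[OF that] D(2) T(1) by (smt (verit) mult_right_mono powr_ge_zero)
    then show ?thesis using T(1) by (intro exI[of _ T] conjI exI[of _ "{}"]) auto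
  next
    case False
    then have N: "1 \<le> N" by simp
    have "N powr \<tau> \<le> D * N powr t x \<and> N powr t x \<le> D * N powr \<tau>"
      if "x \<notin> ctr (N powr (1 / bad_exp))" for x
    proof -
      have "N powr (1 / bad_exp) < norm x" using that by (rule norm_gt_if_not_in_ctr)
      also have "norm x \<le> exp 1 + norm x" by simp
      finally have "ln (N powr (1 / bad_exp)) \<le> ln (exp 1 + norm x)"
        using N by (subst ln_le_cancel_iff) (auto simp: add_pos_nonneg)
      then have "\<bar>ln N\<bar> \<le> bad_exp * ln (exp 1 + norm x)"
        using N bad_exp_pos by (simp add: ln_powr pos_divide_le_eq mult.commute)
      then have "\<bar>ln N\<bar> * \<bar>t x - \<tau>\<bar> \<le> bad_exp * Ci" using bad_exp_pos by (intro deviation_at_infinity) auto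
      from powr_near[OF _ this] N
      have "N powr \<tau> \<le> exp (bad_exp * Ci) * N powr t x" "N powr t x \<le> exp (bad_exp * Ci) * N powr \<tau>"
        by auto
      then show ?thesis using D(3) by (smt (verit) mult_right_mono powr_ge_zero)
    qed
    then show ?thesis using N
      by (intro exI[of _ "N powr \<tau>"] conjI exI[of _ "cube a l \<inter> ctr (N powr (1 / bad_exp))"]) auto
  qed
  have "\<exists>T B. flat_off D w (cube a l) T B" if "normalized c w" "0 < l" for w a l
    using main[OF that refl, of a] unfolding flat_off_def by blast
  then show ?thesis using D(1) by blast
qed

section \<open>Power decay of the normalised modular\<close>

lemma mass_modular_compare:
  assumes w: "weight w" and E: "bounded_set E" and N: "0 < N" and T: "0 < T" and D: "0 \<le> D"
    and flat: "\<And>x. x \<in> E \<Longrightarrow> T \<le> D * N powr t x \<and> N powr t x \<le> D * T"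
  shows "V w 1 E \<le> D * T * V w N E" "V w N E \<le> D / T * V w 1 E"
proof -
  show "V w 1 E \<le> D * T * V w N E"
    by (rule V_compare[OF w E]) (use N T D flat in auto)
  show "V w N E \<le> D / T * V w 1 E"
  proof (rule V_compare[OF w E])
    fix x assume x: "x \<in> E"
    have "0 < N powr t x" using N by simp
    then show "(1 / N) powr t x \<le> D / T"
      using flat[OF x] T by (simp add: powr_divide field_simps)
  qed (use N T D in auto)
qed

lemma measure_ctr: "0 \<le> R \<Longrightarrow> measure lebesgue (ctr R :: (real^'n) set) = (2 * R) ^ CARD('n)"
  using measure_cube[of "2 * R"] by simp

text \<open>Off the exceptional set the mass is at most of order \<open>T\<close> because the modular of the cube is one; on it, the
  bound \<open>N powr (1/2) \<le> N powr \<tau> = T\<close> takes over.\<close>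

lemma flat_mass_upper:
  assumes w: "normalized c w" and l: "0 < l" and D: "1 \<le> D" and fo: "flat_off D w (cube a l) T B"
  shows "V w 1 (cube a l) \<le> (D + (1/c) powr (P*P)) * T"
proof -
  let ?Q = "cube a l"
  define N where "N = nrm w ?Q"
  define K where "K = (1/c) powr (P*P)"
  note wt = normalizedD(2)[OF w]
  have K: "0 < K" using admissibleD(2)[OF normalizedD(1)[OF w]] by (simp add: K_def)
  have N: "0 < N" using nrm_pos[OF wt l] by (simp add: N_def)
  have bQ: "bounded_set ?Q" using l by simp
  have one: "V w N ?Q = 1" using V_nrm[OF wt l] by (simp add: N_def)
  from fo have T: "0 < T" and B: "B = {} \<or> 1 \<le> N \<and> T = N powr \<tau> \<and> B = ?Q \<inter> ctr (N powr (1 / bad_exp))"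
    and flat: "\<And>x. x\<in>?Q - B \<Longrightarrow> T \<le> D * N powr t x \<and> N powr t x \<le> D * T"
    unfolding flat_off_def N_def by blast+
  have Bm: "B \<in> sets lebesgue" using B by auto
  have VB: "V w 1 (ctr (N powr (1 / bad_exp))) \<le> K * N powr (1/2)" if "B \<noteq> {}"
    unfolding K_def using B that by (intro mass_ctr_le[OF w]) auto
  have "V w 1 ?Q = V w 1 (?Q \<inter> B) + V w 1 (?Q - B)" by (rule V_split[OF wt bQ _ Bm]) simp
  moreover have "V w 1 (?Q - B) \<le> D * T * V w N (?Q - B)"
    using bounded_subset[OF bQ, of "?Q - B"] Bm D by (intro mass_modular_compare(1)[OF wt _ N T _ flat]) auto
  moreover have "V w N (?Q - B) \<le> 1"
    using V_mono[OF wt bQ N, of "?Q - B"] Bm one by auto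
  then have "D * T * V w N (?Q - B) \<le> D * T" using D T by (simp add: mult_left_le)
  moreover have "V w 1 (?Q \<inter> B) \<le> K * T"
  proof (cases "B = {}")
    case True then show ?thesis using K T by simp
  next
    case False
    then have B': "?Q \<inter> B \<subseteq> ctr (N powr (1 / bad_exp))" "1 \<le> N" "T = N powr \<tau>" using B by auto
    have "V w 1 (?Q \<inter> B) \<le> V w 1 (ctr (N powr (1 / bad_exp)))"
      using B' Bm N by (intro V_mono[OF wt]) auto
    moreover have "N powr (1/2) \<le> N powr \<tau>" using \<open>1 \<le> N\<close> tau_ge1 by (intro powr_mono) auto
    ultimately show ?thesis using VB[OF False] K B'(3)
      by (smt (verit) mult_left_mono)
  qed
  ultimately show ?thesis unfolding K_def[symmetric] by (simp add: distrib_right)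
qed

text \<open>A set filling half of a cube has normalised modular bounded below, by admissibility. To convert this into
  a bound for its mass, the exceptional set has to be removed: its modular is of order \<open>N powr (-1/2)\<close>, so
  it matters only for \<open>N\<close> below a fixed bound \<open>N0\<close>, where mass and modular are comparable anyway.\<close>

lemma half_cube_mass:
  assumes c: "0 < c" "c \<le> 1"
  shows "\<exists>\<delta>>0. \<forall>w a l E. normalized c w \<longrightarrow> 0 < l \<longrightarrow> E \<in> sets lebesgue \<longrightarrow> E \<subseteq> cube a l \<longrightarrow>
     l ^ CARD('n) \<le> 2 * measure lebesgue E \<longrightarrow> \<delta> * V w 1 (cube a l) \<le> V w 1 E"
proof -
  obtain D where D: "1 \<le> D" and dich: "\<And>w a l. normalized c w \<Longrightarrow> 0 < l \<Longrightarrow>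
     \<exists>T B. flat_off D w (cube a l) T B"
    using flat_dichotomy[OF c] by blast
  define K where "K = (1/c) powr (P*P)"
  have K: "0 < K" using c by (simp add: K_def)
  define c1 where "c1 = (c / 2) powr P"
  have c1: "0 < c1" using c by (simp add: c1_def)
  define N0 where "N0 = max 1 ((2 * K / c1) * (2 * K / c1))"
  have N0: "1 \<le> N0" by (simp add: N0_def)
  define d where "d = min (c1 / (2 * D)) (c1 / N0 powr P)"
  have d: "0 < d" using c1 D N0 by (simp add: d_def)
  have "d / (D + K) * V w 1 (cube a l) \<le> V w 1 E"
    if w: "normalized c w" and l: "0 < l" and E: "E \<in> sets lebesgue" "E \<subseteq> cube a l"
      and half: "l ^ CARD('n) \<le> 2 * measure lebesgue E" for w a l E
  proof -
    let ?Q = "cube a l"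
    define N where "N = nrm w ?Q"
    note wt = normalizedD(2)[OF w]
    have N: "0 < N" using nrm_pos[OF wt l] by (simp add: N_def)
    have bQ: "bounded_set ?Q" using l by simp
    have bE: "bounded_set E" using bQ E by (rule bounded_subset)
    obtain T B where fo: "flat_off D w ?Q T B" using dich[OF w l] by blast
    then have T: "0 < T" and B: "B = {} \<or> 1 \<le> N \<and> T = N powr \<tau> \<and> B = ?Q \<inter> ctr (N powr (1 / bad_exp))"
      and flat: "\<And>x. x\<in>?Q - B \<Longrightarrow> T \<le> D * N powr t x \<and> N powr t x \<le> D * T"
      unfolding flat_off_def N_def by blast+
    have Bm: "B \<in> sets lebesgue" using B by auto
    have one: "V w N ?Q = 1" using V_nrm[OF wt l] by (simp add: N_def)
    have VB: "V w 1 B \<le> K * N powr (1/2)" if "B \<noteq> {}"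
    proof -
      have "1 \<le> N" using B that by blast
      then have "0 < N powr (1 / bad_exp)" by simp
      then have "V w 1 B \<le> V w 1 (ctr (N powr (1 / bad_exp)))"
        using B that by (intro V_mono[OF wt]) auto
      also have "\<dots> \<le> K * N powr (1/2)" unfolding K_def by (rule mass_ctr_le[OF w \<open>1 \<le> N\<close>])
      finally show ?thesis .
    qed
    have up: "V w 1 ?Q \<le> (D + K) * T"
      unfolding K_def by (rule flat_mass_upper[OF w l D fo])
    have lowN: "c1 \<le> V w N E"
    proof -
      have "(c / 2) powr P \<le> (c * measure lebesgue E / l ^ CARD('n)) powr P"
        using half l c P_ge1 by (intro powr_mono2) (auto simp: field_simps)
      also have "\<dots> \<le> V w N E" unfolding N_def by (rule admissibleD(4)[OF normalizedD(1)[OF w] l E])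
      finally show ?thesis by (simp add: c1_def)
    qed
    have goodpart: "d * T \<le> V w 1 E" if "c1 / 2 \<le> V w N (E - B)"
    proof -
      have bEB: "bounded_set (E - B)" using bounded_subset[OF bE, of "E - B"] E Bm by auto
      have "c1 / 2 \<le> D / T * V w 1 (E - B)"
        using that mass_modular_compare(2)[OF wt bEB N T _ flat] D E by (meson Diff_mono order_refl order_trans subsetD zero_le_one)
      then have "c1 / (2 * D) * T \<le> V w 1 (E - B)" using T D by (simp add: field_simps)
      also have "\<dots> \<le> V w 1 E" using E Bm by (intro V_mono[OF wt bE]) auto
      finally have "c1 / (2 * D) * T \<le> V w 1 E" .
      moreover have "d * T \<le> c1 / (2 * D) * T" using T by (intro mult_right_mono) (auto simp: d_def)
      ultimately show ?thesis by linarith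
    qed
    have "d * T \<le> V w 1 E"
    proof (cases "B = {}")
      case True
      then show ?thesis using lowN c1 by (intro goodpart) auto
    next
      case False
      then have N1: "1 \<le> N" and TN: "T = N powr \<tau>" using B by auto
      show ?thesis
      proof (cases "K * N powr (-1/2) \<le> c1 / 2")
        case True
        have "V w N (E \<inter> B) \<le> V w N B" using B False E Bm bQ by (intro V_mono[OF wt _ N] bounded_subset[OF bQ]) auto
        also have "\<dots> \<le> 1 / N * V w 1 B"
          using B False Bm N1 by (intro V_scale_down[OF wt] bounded_subset[OF bQ]) auto
        also have "\<dots> \<le> 1 / N * (K * N powr (1/2))" using VB[OF False] N by (intro mult_left_mono) auto
        also have "\<dots> = K * N powr (-1/2)"
        proof -
          have "N powr (-1/2) * N = N powr (1/2)" using N powr_mult_base[of N "-1/2"] by (simp add: mult.commute)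
          then show ?thesis using N by (simp add: field_simps)
        qed
        also have "\<dots> \<le> c1 / 2" by fact
        finally have "c1 / 2 \<le> V w N (E - B)" using V_split[OF wt bE N Bm] lowN by simp
        then show ?thesis by (rule goodpart)
      next
        case False
        then have "c1 < 2 * K * N powr (-1/2)" by simp
        then have "c1 * N powr (1/2) < 2 * K * N powr (-1/2) * N powr (1/2)"
          using N by (intro mult_strict_right_mono) auto
        then have "c1 * N powr (1/2) < 2 * K" using N by (simp add: mult.assoc powr_add[symmetric])
        then have s: "N powr (1/2) \<le> 2 * K / c1" using c1 by (simp add: field_simps)
        have "N = N powr (1/2) * N powr (1/2)" using N by (simp add: powr_add[symmetric])
        also have "\<dots> \<le> 2 * K / c1 * (2 * K / c1)" using s K c1 by (intro mult_mono) auto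
        finally have NN0: "N \<le> N0" by (simp add: N0_def)
        have "T \<le> N powr P" unfolding TN using N1 tau_le by (intro powr_mono) auto
        also have "\<dots> \<le> N0 powr P" using NN0 N1 P_ge1 by (intro powr_mono2) auto
        finally have TN0: "T \<le> N0 powr P" .
        have "c1 \<le> 1 / N * V w 1 E" using lowN V_scale_down[OF wt bE, of 1 N] N1 by simp
        also have "\<dots> \<le> 1 * V w 1 E" using N1 by (intro mult_right_mono) auto
        finally have c1E: "c1 \<le> V w 1 E" by simp
        have "d * T \<le> c1 / N0 powr P * N0 powr P"
          using TN0 T c1 by (intro mult_mono) (auto simp: d_def)
        also have "\<dots> = c1" using N0 by simp
        finally show ?thesis using c1E by simp
      qed
    qed
    moreover have "d / (D + K) * V w 1 ?Q \<le> d / (D + K) * ((D + K) * T)"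
      using up d D K by (intro mult_left_mono) auto
    moreover have "d / (D + K) * ((D + K) * T) = d * T" using D K by simp
    ultimately show ?thesis by linarith
  qed
  moreover have "0 < d / (D + K)" using d D K by simp
  ultimately show ?thesis by blast
qed

text \<open>Applied to complements, the previous bound is the halving property of the mass.\<close>

lemma unnormalized_decay:
  assumes c: "0 < c" "c \<le> 1"
  shows "\<exists>C \<eta>. 1 \<le> C \<and> 0 < \<eta> \<and> (\<forall>w a l E. normalized c w \<longrightarrow> 0 < l \<longrightarrow> E \<in> sets lebesgue \<longrightarrow> E \<subseteq> cube a l \<longrightarrow>
     V w 1 E \<le> C * (measure lebesgue E / l ^ CARD('n)) powr \<eta> * V w 1 (cube a l))"
proof -
  obtain \<delta>' where d': "0 < \<delta>'" and hm': "\<And>w a l E. normalized c w \<Longrightarrow> 0 < l \<Longrightarrow> E \<in> sets lebesgue \<Longrightarrow> E \<subseteq> cube a l \<Longrightarrow>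
     l ^ CARD('n) \<le> 2 * measure lebesgue E \<Longrightarrow> \<delta>' * V w 1 (cube a l) \<le> V w 1 E"
    using half_cube_mass[OF c] by blast
  define \<delta> where "\<delta> = min \<delta>' (1/2)"
  have d: "0 < \<delta>" "\<delta> < 1" using d' by (auto simp: \<delta>_def)
  have hm: "\<delta> * V w 1 (cube a l) \<le> V w 1 E" if "normalized c w" "0 < l" "E \<in> sets lebesgue" "E \<subseteq> cube a l"
     "l ^ CARD('n) \<le> 2 * measure lebesgue E" for w a l E
  proof -
    have "\<delta> * V w 1 (cube a l) \<le> \<delta>' * V w 1 (cube a l)" by (intro mult_right_mono) (auto simp: \<delta>_def)
    then show ?thesis using hm'[OF that] by linarith
  qed
  have halv: "halving_measure (modular_measure w 1) (1 - \<delta>)" if w: "normalized c w" for w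
  proof
    note wt = normalizedD(2)[OF w]
    have [measurable]: "w \<in> borel_measurable lebesgue" using wt by (simp add: weight_def)
    show "sets (modular_measure w 1) = sets lebesgue" by simp
    show "emeasure (modular_measure w 1) E = 0" if E: "E \<in> null_sets lebesgue" for E
    proof -
      have "AE x in lebesgue. ennreal ((w x / 1) powr t x) * indicator E x = 0"
        using AE_not_in[OF E] by eventually_elim simp
      then show ?thesis
        using E by (subst emeasure_modular_measure) (auto simp: nn_integral_0_iff_AE)
    qed
    fix a :: "real^'n" and l :: real and E
    assume l: "0 < l" and E: "E \<in> sets lebesgue" "E \<subseteq> cube a l"
      and half: "2 * emeasure lebesgue E \<le> emeasure lebesgue (cube a l)"
    let ?Q = "cube a l"
    have El: "E \<in> lmeasurable" using E by (meson fmeasurableI2 lmeasurable_cbox)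
    have "ennreal (2 * measure lebesgue E) \<le> ennreal (l ^ CARD('n))"
      using half El l by (simp add: emeasure_eq_measure2 ennreal_mult' measure_cube)
    then have "2 * measure lebesgue E \<le> l ^ CARD('n)" using l by (subst (asm) ennreal_le_iff) auto
    moreover have "measure lebesgue (?Q - E) = l ^ CARD('n) - measure lebesgue E"
      using measurable_measure_Diff[OF lmeasurable_cbox E] l by (simp add: measure_cube)
    ultimately have "l ^ CARD('n) \<le> 2 * measure lebesgue (?Q - E)" by simp
    then have "\<delta> * V w 1 ?Q \<le> V w 1 (?Q - E)" using E by (intro hm[OF w l]) auto
    moreover have "V w 1 ?Q = V w 1 (?Q \<inter> E) + V w 1 (?Q - E)"
      by (rule V_split[OF wt _ _ E(1)]) (use l in auto)
    moreover have "?Q \<inter> E = E" using E by auto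
    ultimately have "V w 1 E \<le> (1 - \<delta>) * V w 1 ?Q" by (simp add: algebra_simps)
    then have "ennreal (V w 1 E) \<le> ennreal ((1 - \<delta>) * V w 1 ?Q)" by (rule ennreal_leI)
    then show "emeasure (modular_measure w 1) E \<le> ennreal (1 - \<delta>) * emeasure (modular_measure w 1) ?Q"
      using emeasure_V[OF wt bounded_setI[OF l E] zero_less_one] emeasure_V[OF wt bounded_cube[OF l] zero_less_one] d
      by (simp add: ennreal_mult')
  qed
  obtain C \<eta> where C: "1 \<le> C" "0 < \<eta>" and dec: "\<And>(\<nu> :: (real^'n) measure) a l E. halving_measure \<nu> (1 - \<delta>) \<Longrightarrow> 0 < l \<Longrightarrow>
     E \<in> sets lebesgue \<Longrightarrow> E \<subseteq> cube a l \<Longrightarrow> emeasure \<nu> (cube a l) < \<infinity> \<Longrightarrow>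
     measure \<nu> E \<le> C * (measure lebesgue E / measure lebesgue (cube a l)) powr \<eta> * measure \<nu> (cube a l)"
    using power_decay[where ?'n = 'n, of "1 - \<delta>"] d by auto
  have "V w 1 E \<le> C * (measure lebesgue E / l ^ CARD('n)) powr \<eta> * V w 1 (cube a l)"
    if "normalized c w" "0 < l" "E \<in> sets lebesgue" "E \<subseteq> cube a l" for w a l E
    using dec[OF halv[OF that(1)] that(2-4)] emeasure_finite[OF normalizedD(2)[OF that(1)] bounded_cube[OF that(2)] zero_less_one] that(2)
    by (simp add: measure_cube)
  then show ?thesis using C by blast
qed

lemma V_rescale: "0 < b \<Longrightarrow> V (\<lambda>x. w x / b) N E = V w (b * N) E"
  by (simp add: modular_measure_def mult.commute)

lemma weight_rescale:
  assumes w: "weight w" and b: "0 < b"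
  shows "weight (\<lambda>x. w x / b)"
proof -
  have "emeasure (modular_measure (\<lambda>x. w x / b) 1) (cube a l) < \<infinity>" if "0 < l" for a l
    using emeasure_finite[OF w bounded_cube[OF that] b] by (simp add: modular_measure_def)
  then show ?thesis using w b by (auto simp: weight_def)
qed

lemma nrm_unique:
  assumes w: "weight w" and l: "0 < l" and N: "0 < N" "V w N (cube a l) = 1"
  shows "nrm w (cube a l) = N"
proof (rule antisym)
  let ?M = "nrm w (cube a l)"
  note M = nrm_pos[OF w l, of a]
  show "N \<le> ?M" using le_norm_if_modular_ge_1[OF w l N(1), of a] N(2) by simp
  then have "V w ?M (cube a l) \<le> N / ?M * V w N (cube a l)"
    by (intro V_scale_down[OF w bounded_cube[OF l] N(1)])
  then have "1 \<le> N / ?M" using V_nrm[OF w l, of a] N(2) by simp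
  then show "?M \<le> N" using M by (simp add: le_divide_eq)
qed

lemma nrm_rescale:
  assumes w: "weight w" and l: "0 < l" and b: "0 < b"
  shows "nrm (\<lambda>x. w x / b) (cube a l) = nrm w (cube a l) / b"
  by (rule nrm_unique[OF weight_rescale[OF w b] l])
     (use nrm_pos[OF w l, of a] V_nrm[OF w l, of a] b in \<open>simp_all add: V_rescale\<close>)

lemma admissible_rescale:
  assumes w: "admissible c w" and b: "0 < b"
  shows "admissible c (\<lambda>x. w x / b)"
proof -
  note wt = admissibleD(1)[OF w]
  show ?thesis
    unfolding admissible_def
    using weight_rescale[OF wt b] w b
    by (auto simp: nrm_rescale[OF wt _ b] V_rescale[OF b] admissible_def)
qed

lemma normalized_rescale:
  assumes w: "admissible c w"
  shows "normalized c (\<lambda>x. w x / nrm w (ctr 1))"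
proof -
  have b: "0 < nrm w (ctr 1)" by (rule nrm_pos[OF admissibleD(1)[OF w]]) simp
  have "nrm (\<lambda>x. w x / nrm w (ctr 1)) (ctr 1) = nrm w (ctr 1) / nrm w (ctr 1)"
    by (rule nrm_rescale[OF admissibleD(1)[OF w] _ b]) simp
  then show ?thesis
    unfolding normalized_def using admissible_rescale[OF w b] b by simp
qed

text \<open>Off the exceptional set, mass and normalised modular are proportional up to constants, and the decay
  of the mass is inherited. On it, the mass decays relative to the centred cube of radius
  \<open>N powr (1 / bad_exp)\<close> and is of order \<open>N powr (1/2)\<close>, while passing to the normalised modular gains
  \<open>1/N\<close>. What remains is to express the proportion in the centred cube through that in \<open>Q\<close>, which costs
  a small power of the volume of \<open>Q\<close>; that volume is bounded by a power of \<open>N\<close>, since the mass of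
  a large cube near the origin grows at least like a power of its volume.\<close>

lemma normalized_decay:
  assumes c: "0 < c" "c \<le> 1"
  shows "\<exists>C \<eta>. 1 \<le> C \<and> 0 < \<eta> \<and> (\<forall>w a l E. normalized c w \<longrightarrow> 0 < l \<longrightarrow> E \<in> sets lebesgue \<longrightarrow> E \<subseteq> cube a l \<longrightarrow>
     V w (nrm w (cube a l)) E \<le> C * (measure lebesgue E / l ^ CARD('n)) powr \<eta>)"
proof -
  obtain D where D: "1 \<le> D" and dich: "\<And>w a l. normalized c w \<Longrightarrow> 0 < l \<Longrightarrow>
     \<exists>T B. flat_off D w (cube a l) T B"
    using flat_dichotomy[OF c] by blast
  obtain A \<eta> where A: "1 \<le> A" "0 < \<eta>" and dec: "\<And>w a l E. normalized c w \<Longrightarrow> 0 < l \<Longrightarrow> E \<in> sets lebesgue \<Longrightarrow> E \<subseteq> cube a l \<Longrightarrow>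
     V w 1 E \<le> A * (measure lebesgue E / l ^ CARD('n)) powr \<eta> * V w 1 (cube a l)"
    using unnormalized_decay[OF c] by blast
  define K where "K = (1/c) powr (P*P)"
  have K: "0 < K" using c by (simp add: K_def)
  \<comment> \<open>Small enough that the volume of \<open>Q\<close> to the power \<open>\<epsilon>\<close> is at most of order \<open>N powr (1/2)\<close>.\<close>
  define \<epsilon> where "\<epsilon> = min 1 (min \<eta> (\<eta> / (2 * P)))"
  have e: "0 < \<epsilon>" "\<epsilon> \<le> 1" "\<epsilon> \<le> \<eta>" "\<epsilon> \<le> \<eta> / (2 * P)" using A P_ge1 by (auto simp: \<epsilon>_def)
  define K2 where "K2 = (A * (4 ^ CARD('n) / c) powr (P * P)) powr (\<epsilon> / \<eta>)"
  have K2: "0 < K2" using A c by (simp add: K2_def)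
  define C1 where "C1 = D * A * (D + K)"
  have C1: "1 \<le> C1"
  proof -
    have "1 * 1 \<le> D * A" using D A by (intro mult_mono) auto
    then have "1 * 1 \<le> (D * A) * (D + K)" using D K by (intro mult_mono) auto
    then show ?thesis by (simp add: C1_def)
  qed
  define C where "C = C1 + A * K * max 1 K2"
  have C: "1 \<le> C" using C1 A K by (simp add: C_def add_increasing2)
  have "V w N E \<le> C * (measure lebesgue E / l ^ CARD('n)) powr \<epsilon>"
    if w: "normalized c w" and l: "0 < l" and E: "E \<in> sets lebesgue" "E \<subseteq> cube a l"
      and N_def: "N = nrm w (cube a l)" for w a l E N
  proof -
    let ?Q = "cube a l"
    let ?q = "measure lebesgue E / l ^ CARD('n)"
    note wt = normalizedD(2)[OF w]
    have N: "0 < N" using nrm_pos[OF wt l] by (simp add: N_def)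
    have bQ: "bounded_set ?Q" using l by simp
    have bE: "bounded_set E" using bQ E by (rule bounded_subset)
    have q: "0 \<le> ?q" "?q \<le> 1"
      using l E measure_mono_fmeasurable[of E ?Q lebesgue] by (auto simp: measure_cube)
    have qe: "?q powr \<eta> \<le> ?q powr \<epsilon>" using q e by (cases "?q = 0") (auto intro!: powr_mono' simp del: divide_eq_0_iff)
    obtain T B where fo: "flat_off D w ?Q T B" using dich[OF w l] by blast
    then have T: "0 < T" and B: "B = {} \<or> 1 \<le> N \<and> T = N powr \<tau> \<and> B = ?Q \<inter> ctr (N powr (1 / bad_exp))"
      and flat: "\<And>x. x\<in>?Q - B \<Longrightarrow> T \<le> D * N powr t x \<and> N powr t x \<le> D * T"
      unfolding flat_off_def N_def by blast+
    have Bm: "B \<in> sets lebesgue" using B by auto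
    have one: "V w N ?Q = 1" using V_nrm[OF wt l] by (simp add: N_def)
    have VB: "V w 1 (ctr (N powr (1 / bad_exp))) \<le> K * N powr (1/2)" if "B \<noteq> {}"
      unfolding K_def using B that by (intro mass_ctr_le[OF w]) auto
    have up: "V w 1 ?Q \<le> (D + K) * T"
      unfolding K_def by (rule flat_mass_upper[OF w l D fo])
    have good: "V w N (E - B) \<le> C1 * ?q powr \<epsilon>"
    proof -
      have "V w N (E - B) \<le> D / T * V w 1 (E - B)"
        using bounded_subset[OF bE, of "E - B"] E Bm D flat
        by (intro mass_modular_compare(2)[OF wt _ N T]) auto
      also have "\<dots> \<le> D / T * V w 1 E"
        using T D E Bm by (intro mult_left_mono V_mono[OF wt bE]) auto
      also have "\<dots> \<le> D / T * (A * ?q powr \<eta> * V w 1 ?Q)"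
        using T D dec[OF w l E] by (intro mult_left_mono) auto
      also have "\<dots> \<le> D / T * (A * ?q powr \<epsilon> * ((D + K) * T))"
        using T D A up qe by (intro mult_left_mono mult_mono) auto
      also have "\<dots> = C1 * ?q powr \<epsilon>" using T by (simp add: C1_def)
      finally show ?thesis .
    qed
    have bad: "V w N (E \<inter> B) \<le> (A * K * max 1 K2) * ?q powr \<epsilon>"
    proof (cases "E \<inter> B = {}")
      case True
      then show ?thesis using A K by simp
    next
      case False
      then have "B \<noteq> {}" by auto
      then have N1: "1 \<le> N" and BQ: "B = ?Q \<inter> ctr (N powr (1 / bad_exp))" using B by auto
      define R where "R = N powr (1 / bad_exp)"
      have R: "1 \<le> R" using N1 bad_exp_pos by (simp add: R_def ge_one_powr_ge_zero)
      have EB: "E \<inter> B \<in> sets lebesgue" "E \<inter> B \<subseteq> ctr R" "bounded_set (E \<inter> B)"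
        using E Bm BQ bounded_subset[OF bE, of "E \<inter> B"] by (auto simp: R_def)
      have mEB: "measure lebesgue (E \<inter> B) \<le> measure lebesgue E"
        using bE E Bm fmeasurableI2[OF lmeasurable_cbox E(2) E(1)] by (intro measure_mono_fmeasurable) auto
      let ?r = "measure lebesgue (E \<inter> B) / (2 * R) ^ CARD('n)"
      have pn: "1 \<le> (2 * R) ^ CARD('n)" using R by (intro one_le_power) auto
      have r: "0 \<le> ?r" "?r \<le> measure lebesgue E" "?r \<le> 1"
      proof -
        show "0 \<le> ?r" using R by simp
        have "?r \<le> measure lebesgue (E \<inter> B) / 1" using pn by (intro divide_left_mono) auto
        then show "?r \<le> measure lebesgue E" using mEB by simp
        have "measure lebesgue (E \<inter> B) \<le> (2 * R) ^ CARD('n)"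
          using measure_mono_fmeasurable[OF EB(2,1) lmeasurable_cbox] R by (simp add: measure_ctr)
        then show "?r \<le> 1" using pn by simp
      qed
      have sizeQ: "(l ^ CARD('n)) powr \<epsilon> \<le> max 1 K2 * N powr (1/2)"
      proof (cases "l \<le> R")
        case True
        have "(l ^ CARD('n)) powr \<epsilon> \<le> (R ^ CARD('n)) powr \<epsilon>"
          using True l e by (intro powr_mono2 power_mono) auto
        also have "\<dots> \<le> (R ^ CARD('n)) powr 1" using R e by (intro powr_mono one_le_power) auto
        also have "\<dots> = N powr (1 / bad_exp * CARD('n))"
          using R N1 by (simp add: R_def powr_realpow[symmetric] powr_powr)
        also have "\<dots> \<le> N powr (1/2)"
          using N1 bad_exp_pos by (intro powr_mono) (auto simp: field_simps)
        also have "\<dots> \<le> max 1 K2 * N powr (1/2)" by (simp add: mult_right_mono[of 1 "max 1 K2" "N powr (1/2)", simplified])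
        finally show ?thesis .
      next
        case False
        obtain x0 where x0: "x0 \<in> ?Q" "x0 \<in> ctr R" using \<open>B \<noteq> {}\<close> BQ by (auto simp: R_def)
        have comp: "\<bar>x0 $ i\<bar> \<le> R" for i
        proof -
          have "- R \<le> x0 $ i" "x0 $ i \<le> - R + 2 * R" using x0(2) by (auto simp: mem_cube)
          then show ?thesis by (simp add: abs_le_iff)
        qed
        have sub: "?Q \<subseteq> ctr (2 * l)"
          using cube_subset_ctr[OF x0(1) comp] ctr_mono[of "R + l" "2 * l"] False by auto
        have l1: "1 \<le> 2 * l" using False R by simp
        \<comment> \<open>The decay compares the fixed cube \<open>ctr 1\<close>, of mass one, with \<open>ctr (2 * l)\<close>; this is the lower growth bound.\<close>
        have in1: "ctr 1 \<subseteq> ctr (2 * l)" by (rule ctr_mono[OF l1])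
        have V1: "V w 1 (ctr 1) = 1"
          using V_nrm[OF wt, of 2 "\<chi> i. -1"] normalizedD(3)[OF w] by simp
        have "1 \<le> A * (measure lebesgue (ctr 1 :: (real^'n) set) / (2 * (2 * l)) ^ CARD('n)) powr \<eta> * V w 1 (ctr (2 * l))"
          using dec[OF w _ sets_cube in1] l V1 by simp
        also have "measure lebesgue (ctr 1 :: (real^'n) set) / (2 * (2 * l)) ^ CARD('n) = 1 / (2 * l) ^ CARD('n)"
        proof -
          have "(4::real) ^ CARD('n) = 2 ^ CARD('n) * 2 ^ CARD('n)" by (simp flip: power_mult_distrib)
          then show ?thesis using measure_ctr[of 1] l by (simp add: power_mult_distrib)
        qed
        also have "(1 / (2 * l) ^ CARD('n)) powr \<eta> \<le> (1 / l ^ CARD('n)) powr \<eta>"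
          using l A by (intro powr_mono2 divide_left_mono power_mono) auto
        also have "V w 1 (ctr (2 * l)) \<le> nrm w (ctr (2 * l)) powr P"
          using l1 by (intro mass_le_norm_power wt nrm_ctr_ge1[OF w]) auto
        also have "\<dots> \<le> ((4 ^ CARD('n) / c) powr P * N) powr P"
        proof (rule powr_mono2)
          have "nrm w (ctr (2 * l)) \<le> ((2 * (2 * l)) ^ CARD('n) / (c * l ^ CARD('n))) powr P * N"
            unfolding N_def using l sub by (intro nrm_doubling[OF normalizedD(1)[OF w]]) auto
          also have "(2 * (2 * l)) ^ CARD('n) / (c * l ^ CARD('n)) = 4 ^ CARD('n) / c"
            using l by (simp add: power_mult_distrib)
          finally show "nrm w (ctr (2 * l)) \<le> (4 ^ CARD('n) / c) powr P * N" .
        qed (use P_ge1 nrm_ctr_ge1[OF w l1] in auto)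
        also have "\<dots> = (4 ^ CARD('n) / c) powr (P * P) * N powr P"
          by (simp add: powr_mult powr_powr)
        finally have "1 \<le> A * (1 / l ^ CARD('n)) powr \<eta> * ((4 ^ CARD('n) / c) powr (P * P) * N powr P)"
          using A by (simp add: mult_left_mono mult_right_mono)
        then have "(l ^ CARD('n)) powr \<eta> \<le> A * (4 ^ CARD('n) / c) powr (P * P) * N powr P"
        proof -
          define y where "y = (l ^ CARD('n)) powr \<eta>"
          define u where "u = (4 ^ CARD('n) / c) powr (P * P)"
          define v where "v = N powr P"
          have y: "0 < y" using l by (simp add: y_def)
          have inv: "(1 / l ^ CARD('n)) powr \<eta> = 1 / y" by (simp add: y_def powr_divide)
          assume "1 \<le> A * (1 / l ^ CARD('n)) powr \<eta> * ((4 ^ CARD('n) / c) powr (P * P) * N powr P)"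
          then have "1 \<le> A * (1 / y) * (u * v)" by (simp only: inv u_def v_def)
          also have "\<dots> = (A * u * v) / y" by simp
          finally have "y \<le> A * u * v" using y by (simp only: pos_le_divide_eq mult_1)
          then show ?thesis by (simp only: y_def u_def v_def)
        qed
        then have "((l ^ CARD('n)) powr \<eta>) powr (\<epsilon> / \<eta>) \<le> (A * (4 ^ CARD('n) / c) powr (P * P) * N powr P) powr (\<epsilon> / \<eta>)"
          using e A by (intro powr_mono2) auto
        also have "\<dots> = K2 * N powr (P * (\<epsilon> / \<eta>))"
          by (simp only: powr_mult powr_powr K2_def)
        also have "N powr (P * (\<epsilon> / \<eta>)) \<le> N powr (1/2)"
          using e A P_ge1 N1 by (intro powr_mono) (auto simp: field_simps)
        finally have "(l ^ CARD('n)) powr \<epsilon> \<le> K2 * N powr (1/2)"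
          using A K2 by (simp add: powr_powr)
        also have "\<dots> \<le> max 1 K2 * N powr (1/2)" by (intro mult_right_mono) auto
        finally show ?thesis .
      qed
      have "V w N (E \<inter> B) \<le> 1 / N * V w 1 (E \<inter> B)"
        using N1 by (intro V_scale_down[OF wt EB(3)]) auto
      also have "\<dots> \<le> 1 / N * (A * ?r powr \<eta> * V w 1 (ctr R))"
        using dec[OF w _ EB(1,2)] R N by (intro mult_left_mono) auto
      also have "\<dots> \<le> 1 / N * (A * measure lebesgue E powr \<epsilon> * (K * N powr (1/2)))"
      proof -
        have "?r powr \<eta> \<le> ?r powr \<epsilon>" using r e by (cases "?r = 0") (auto intro!: powr_mono' simp del: divide_eq_0_iff)
        also have "\<dots> \<le> measure lebesgue E powr \<epsilon>" using r e by (intro powr_mono2) auto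
        finally show ?thesis using A N VB[OF \<open>B \<noteq> {}\<close>] unfolding R_def[symmetric]
          by (intro mult_left_mono mult_mono) auto
      qed
      also have "measure lebesgue E powr \<epsilon> = ?q powr \<epsilon> * (l ^ CARD('n)) powr \<epsilon>"
        using l by (simp add: powr_mult[symmetric])
      also have "1 / N * (A * (?q powr \<epsilon> * (l ^ CARD('n)) powr \<epsilon>) * (K * N powr (1/2)))
          \<le> 1 / N * (A * (?q powr \<epsilon> * (max 1 K2 * N powr (1/2))) * (K * N powr (1/2)))"
        using sizeQ A K N by (intro mult_left_mono mult_right_mono) auto
      also have "\<dots> = (A * K * max 1 K2) * ?q powr \<epsilon> * ((N powr (1/2) * N powr (1/2)) / N)"
        by (simp add: mult_ac)
      also have "(N powr (1/2) * N powr (1/2)) / N = 1" using N by (simp add: powr_add[symmetric])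
      finally show ?thesis by simp
    qed
    have "V w N E = V w N (E \<inter> B) + V w N (E - B)" by (rule V_split[OF wt bE N Bm])
    then show ?thesis using good bad by (simp add: C_def distrib_right)
  qed
  then show ?thesis using C e(1) by blast
qed

text \<open>Rescaling the weight changes neither admissibility nor the normalised modular.\<close>

lemma admissible_decay:
  assumes c: "0 < c" "c \<le> 1"
  shows "\<exists>C \<eta>. 1 \<le> C \<and> 0 < \<eta> \<and> (\<forall>w a l E. admissible c w \<longrightarrow> 0 < l \<longrightarrow> E \<in> sets lebesgue \<longrightarrow> E \<subseteq> cube a l \<longrightarrow>
     V w (nrm w (cube a l)) E \<le> C * (measure lebesgue E / l ^ CARD('n)) powr \<eta>)"
proof -
  obtain C \<eta> where C: "1 \<le> C" "0 < \<eta>" and dec: "\<And>w a l E. normalized c w \<Longrightarrow> 0 < l \<Longrightarrow> E \<in> sets lebesgue \<Longrightarrow> E \<subseteq> cube a l \<Longrightarrow>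
     V w (nrm w (cube a l)) E \<le> C * (measure lebesgue E / l ^ CARD('n)) powr \<eta>"
    using normalized_decay[OF c] by blast
  have "V w (nrm w (cube a l)) E \<le> C * (measure lebesgue E / l ^ CARD('n)) powr \<eta>"
    if w: "admissible c w" and l: "0 < l" and E: "E \<in> sets lebesgue" "E \<subseteq> cube a l" for w a l E
  proof -
    note wt = admissibleD(1)[OF w]
    define b where "b = nrm w (ctr 1)"
    have b: "0 < b" unfolding b_def by (rule nrm_pos[OF wt]) simp
    have "normalized c (\<lambda>x. w x / b)" unfolding b_def by (rule normalized_rescale[OF w])
    from dec[OF this l E] show ?thesis
      using b by (simp add: V_rescale[OF b] nrm_rescale[OF wt l b])
  qed
  then show ?thesis using C by blast
qed

lemma admissible_antimono:
  assumes adm: "admissible c w" and c': "0 < c'" "c' \<le> c"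
  shows "admissible c' w"
proof -
  have "(c' * measure lebesgue E / measure lebesgue (cube a l)) powr P \<le> V w (nrm w (cube a l)) E"
    if l: "0 < l" and E: "E \<in> sets lebesgue" "E \<subseteq> cube a l" for a l E
  proof -
    have "(c' * measure lebesgue E / measure lebesgue (cube a l)) powr P \<le> (c * measure lebesgue E / measure lebesgue (cube a l)) powr P"
      using c' P_ge1 by (intro powr_mono2 divide_right_mono mult_right_mono) auto
    also have "\<dots> \<le> V w (nrm w (cube a l)) E" using adm l E by (auto simp: admissible_def)
    finally show ?thesis .
  qed
  then show ?thesis using adm c' by (auto simp: admissible_def)
qed

section \<open>The reverse Hoelder inequality\<close>

text \<open>It selects the term of the layer-cake sum in the next proof that absorbs \<open>g powr \<sigma>\<close>.\<close>

lemma level_bound: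
  fixes g \<sigma> \<epsilon> :: real
  assumes g: "0 < g" and s: "0 \<le> \<sigma>" "\<sigma> \<le> \<epsilon>"
  shows "g powr \<sigma> \<le> 1 \<or> (\<exists>j::nat. 2 ^ j < g \<and> g powr \<sigma> \<le> 2 powr ((real j + 1) * \<epsilon>))"
proof (cases "g \<le> 1")
  case True
  then have "g powr \<sigma> \<le> 1 powr \<sigma>" using g s by (intro powr_mono2) auto
  then show ?thesis by simp
next
  case False
  then have lg: "0 < log 2 g" by simp
  define j where "j = nat (\<lceil>log 2 g\<rceil> - 1)"
  have j: "real j < log 2 g" "log 2 g \<le> real j + 1"
    using lg unfolding j_def by linarith+
  have "2 powr real j < g" using j(1) g by (simp add: less_log_iff)
  then have "2 ^ j < g" by (simp add: powr_realpow)
  moreover have "g \<le> 2 powr (real j + 1)" using j(2) g by (simp add: log_le_iff)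
  then have "g powr \<epsilon> \<le> (2 powr (real j + 1)) powr \<epsilon>" using g s by (intro powr_mono2) auto
  moreover have "g powr \<sigma> \<le> g powr \<epsilon>" using False s by (intro powr_mono) auto
  ultimately show ?thesis by (intro disjI2 exI[of _ j]) (simp add: powr_powr)
qed

text \<open>With \<open>N\<close> and \<open>M\<close> the norms of \<open>w\<close> and of \<open>1\<close> on the cube, this says that the norm of \<open>w\<close> with exponent \<open>s t\<close> is
  at most a constant times \<open>N * M powr (1/s - 1)\<close>. Put \<open>g = (w M / N) powr t\<close>; the integrand is
  \<open>g powr (s - 1)\<close> times the normalised density of \<open>w\<close>. On the set \<open>A j\<close> where \<open>g > 2 ^ j\<close> the normalised density
  of \<open>1\<close> is at most \<open>2 ^ (-j)\<close> times that of \<open>w\<close>, so that the modular of \<open>1\<close> there is at most \<open>2 ^ (-j)\<close>.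
  Admissibility of \<open>1\<close> then makes \<open>A j\<close> a small part of the cube, and the decay for \<open>w\<close> makes its
  \<open>w\<close>-modular geometrically small. For \<open>s\<close> close to one the sum over \<open>j\<close> converges.\<close>

lemma reverse_hoelder:
  assumes c: "0 < c" "c \<le> 1" and adm1: "admissible c (\<lambda>_. 1)"
  shows "\<exists>C r. 1 \<le> C \<and> 1 < r \<and> (\<forall>w a l s. admissible c w \<longrightarrow> 0 < l \<longrightarrow> s \<in> {1..r} \<longrightarrow>
     (\<integral>\<^sup>+x\<in>cube a l. ennreal ((w x / nrm w (cube a l) * nrm (\<lambda>_. 1) (cube a l) powr (1 - 1/s)) powr (s * t x)) \<partial>lebesgue)
       \<le> ennreal C)"
proof -
  obtain A0 \<eta> where A0: "1 \<le> A0" and eta: "0 < \<eta>" and dec: "\<And>w a l E. admissible c w \<Longrightarrow> 0 < l \<Longrightarrow> E \<in> sets lebesgue \<Longrightarrow> E \<subseteq> cube a l \<Longrightarrow>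
     V w (nrm w (cube a l)) E \<le> A0 * (measure lebesgue E / l ^ CARD('n)) powr \<eta>"
    using admissible_decay[OF c] by blast
  \<comment> \<open>The modular of \<open>w\<close> on \<open>A j\<close> decays like \<open>2 powr (- 2 * j * \<epsilon>)\<close>, half of which is spent on \<open>g powr (s - 1)\<close>.\<close>
  define \<epsilon> where "\<epsilon> = \<eta> / (2 * P)"
  have e: "0 < \<epsilon>" using eta P_ge1 by (simp add: \<epsilon>_def)
  define C1 where "C1 = A0 * (1/c) powr \<eta> * 2 powr \<epsilon>"
  have C1: "0 \<le> C1" using A0 by (simp add: C1_def)
  define z where "z = 2 powr (- \<epsilon>)"
  have z: "0 < z" "z < 1" using e powr_less_mono[of "-\<epsilon>" 0 2] by (auto simp: z_def)
  define C where "C = 1 + C1 / (1 - z)"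
  have "(\<integral>\<^sup>+x\<in>cube a l. ennreal ((w x / N * M powr (1 - 1/s)) powr (s * t x)) \<partial>lebesgue) \<le> ennreal C"
    if w: "admissible c w" and l: "0 < l" and s: "s \<in> {1..1+\<epsilon>}"
      and N_def: "N = nrm w (cube a l)" and M_def: "M = nrm (\<lambda>_. 1) (cube a l)" for w a l s N M
  proof -
    let ?Q = "cube a l"
    note wt = admissibleD(1)[OF w] and w1 = admissibleD(1)[OF adm1]
    have N: "0 < N" and M: "0 < M" using nrm_pos[OF wt l] nrm_pos[OF w1 l] by (auto simp: N_def M_def)
    have wm [measurable]: "w \<in> borel_measurable lebesgue" and wp: "\<And>x. 0 < w x"
      using wt by (auto simp: weight_def)
    have [measurable]: "?Q \<in> sets lebesgue" by simp
    define h where "h x = (w x / N) powr t x" for x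
    define g where "g x = h x * M powr t x" for x
    have hm [measurable]: "h \<in> borel_measurable lebesgue" unfolding h_def by measurable
    have gm [measurable]: "g \<in> borel_measurable lebesgue" unfolding g_def by measurable
    have hp: "0 < h x" and gp: "0 < g x" for x using wp[of x] N M by (auto simp: h_def g_def)
    define A where "A j = {x \<in> ?Q. 2 ^ j < g x}" for j :: nat
    have Am [measurable]: "A j \<in> sets lebesgue" for j
    proof -
      have "{x \<in> space lebesgue. 2 ^ j < g x} \<in> sets lebesgue" by measurable
      then have "?Q \<inter> {x \<in> space lebesgue. 2 ^ j < g x} \<in> sets lebesgue" by (intro sets.Int) simp_all
      moreover have "A j = ?Q \<inter> {x \<in> space lebesgue. 2 ^ j < g x}" by (auto simp: A_def)
      ultimately show ?thesis by simp
    qed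
    have AQ: "A j \<subseteq> ?Q" for j by (auto simp: A_def)
    have bA: "bounded_set (A j)" for j using bounded_setI[OF l Am AQ] .
    have em: "emeasure (modular_measure w N) E = (\<integral>\<^sup>+x. ennreal (h x) * indicator E x \<partial>lebesgue)"
      if "E \<in> sets lebesgue" for E
      using that by (simp add: emeasure_modular_measure h_def)
    have VQ: "V w N ?Q = 1" using V_nrm[OF wt l] by (simp add: N_def)
    have VA: "V w N (A j) \<le> A0 * (1/c) powr \<eta> * 2 powr (- (2 * real j * \<epsilon>))" for j
    proof -
      let ?q = "measure lebesgue (A j) / l ^ CARD('n)"
      have "V w N (A j) \<le> V w N ?Q" using AQ Am l by (intro V_mono[OF wt _ N]) auto
      then have VA1: "V w N (A j) \<le> 1" using VQ by simp
      have "emeasure (modular_measure (\<lambda>_. 1) M) (A j)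
          \<le> (\<integral>\<^sup>+x. ennreal (1 / 2 ^ j) * (ennreal (h x) * indicator (A j) x) \<partial>lebesgue)"
        unfolding emeasure_modular_measure[OF borel_measurable_const Am]
      proof (rule nn_integral_mono)
        fix x
        have "(1 / M) powr t x \<le> 1 / 2 ^ j * h x" if "x \<in> A j"
        proof -
          have "2 ^ j \<le> h x * M powr t x" using that by (simp add: A_def g_def)
          then show ?thesis using M by (simp add: powr_divide field_simps)
        qed
        then show "ennreal ((1 / M) powr t x) * indicator (A j) x \<le> ennreal (1 / 2 ^ j) * (ennreal (h x) * indicator (A j) x)"
          using hp[of x] by (auto simp: indicator_def ennreal_mult'[symmetric] intro!: ennreal_leI)
      qed
      also have "\<dots> = ennreal (1 / 2 ^ j) * emeasure (modular_measure w N) (A j)"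
        unfolding em[OF Am] using Am by (intro nn_integral_cmult) measurable
      finally have "ennreal (V (\<lambda>_. 1) M (A j)) \<le> ennreal (1 / 2 ^ j) * ennreal (V w N (A j))"
        using emeasure_V[OF wt bA N] emeasure_V[OF w1 bA M] by simp
      then have "V (\<lambda>_. 1) M (A j) \<le> 1 / 2 ^ j * V w N (A j)"
        by (simp add: ennreal_mult'[symmetric])
      moreover have "1 / 2 ^ j * V w N (A j) \<le> 1 / 2 ^ j * 1" using VA1 by (intro mult_left_mono) auto
      ultimately have "(c * measure lebesgue (A j) / l ^ CARD('n)) powr P \<le> 1 / 2 ^ j"
      proof -
        have "(c * measure lebesgue (A j) / l ^ CARD('n)) powr P \<le> V (\<lambda>_. 1) M (A j)"
          unfolding M_def by (rule admissibleD(4)[OF adm1 l Am AQ])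
        then show ?thesis using \<open>V (\<lambda>_. 1) M (A j) \<le> 1 / 2 ^ j * V w N (A j)\<close>
            \<open>1 / 2 ^ j * V w N (A j) \<le> 1 / 2 ^ j * 1\<close> by linarith
      qed
      also have "1 / 2 ^ j = (2::real) powr (- real j)" by (simp add: powr_minus powr_realpow divide_simps)
      finally have "((c * measure lebesgue (A j) / l ^ CARD('n)) powr P) powr (\<eta> / P) \<le> (2 powr (- real j)) powr (\<eta> / P)"
        using eta P_ge1 by (intro powr_mono2) auto
      then have "(c * ?q) powr \<eta> \<le> 2 powr (- (2 * real j * \<epsilon>))"
        using P_ge1 by (simp add: powr_powr \<epsilon>_def)
      then have "(1/c) powr \<eta> * (c * ?q) powr \<eta> \<le> (1/c) powr \<eta> * 2 powr (- (2 * real j * \<epsilon>))"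
        by (intro mult_left_mono) auto
      moreover have "(1/c) powr \<eta> * (c * ?q) powr \<eta> = ?q powr \<eta>"
        using c by (simp only: powr_mult[symmetric]) simp
      ultimately have "A0 * ?q powr \<eta> \<le> A0 * ((1/c) powr \<eta> * 2 powr (- (2 * real j * \<epsilon>)))"
        using A0 by (intro mult_left_mono) auto
      moreover have "V w N (A j) \<le> A0 * ?q powr \<eta>" unfolding N_def by (rule dec[OF w l Am AQ])
      ultimately show ?thesis by (simp only: mult.assoc)
    qed
    define F where "F j x = ennreal (2 powr ((real j + 1) * \<epsilon>)) * (ennreal (h x) * indicator (A j) x)" for j x
    have Fm: "F j \<in> borel_measurable lebesgue" for j
      unfolding F_def using Am by measurable
    have "(\<integral>\<^sup>+x\<in>?Q. ennreal ((w x / N * M powr (1 - 1/s)) powr (s * t x)) \<partial>lebesgue)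
        \<le> (\<integral>\<^sup>+x. ennreal (h x) * indicator ?Q x + (\<Sum>j. F j x) \<partial>lebesgue)"
    proof (rule nn_integral_mono)
      fix x
      have eq: "(w x / N * M powr (1 - 1/s)) powr (s * t x) = g x powr (s - 1) * h x"
      proof -
        have "(w x / N * M powr (1 - 1/s)) powr (s * t x) = (w x / N) powr (s * t x) * M powr ((1 - 1/s) * (s * t x))"
          by (simp only: powr_mult powr_powr)
        moreover have "(1 - 1/s) * (s * t x) = t x * (s - 1)" using s by (simp add: field_simps)
        moreover have "s * t x = t x * (s - 1) + t x" by (simp add: field_simps)
        moreover have "(w x / N) powr (t x * (s - 1) + t x) = h x powr (s - 1) * h x"
          using wp[of x] N by (simp add: powr_add h_def powr_powr)
        moreover have "g x powr (s - 1) = h x powr (s - 1) * M powr (t x * (s - 1))"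
          by (simp only: g_def powr_mult powr_powr)
        ultimately show ?thesis by (metis mult.assoc mult.commute)
      qed
      show "ennreal ((w x / N * M powr (1 - 1/s)) powr (s * t x)) * indicator ?Q x
          \<le> ennreal (h x) * indicator ?Q x + (\<Sum>j. F j x)"
      proof (cases "x \<in> ?Q")
        case True
        have "g x powr (s - 1) \<le> 1 \<or> (\<exists>j::nat. 2 ^ j < g x \<and> g x powr (s - 1) \<le> 2 powr ((real j + 1) * \<epsilon>))"
          using s by (intro level_bound gp) auto
        then show ?thesis
        proof (elim disjE exE conjE)
          assume "g x powr (s - 1) \<le> 1"
          then have "g x powr (s - 1) * h x \<le> h x" using hp[of x] by (simp add: mult_left_le_one_le)
          then have "ennreal (g x powr (s - 1) * h x) \<le> ennreal (h x) + (\<Sum>j. F j x)"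
            by (intro add_increasing2 ennreal_leI) auto
          then show ?thesis using True unfolding eq by simp
        next
          fix j :: nat assume j: "2 ^ j < g x" "g x powr (s - 1) \<le> 2 powr ((real j + 1) * \<epsilon>)"
          have "ennreal (g x powr (s - 1) * h x) \<le> ennreal (2 powr ((real j + 1) * \<epsilon>) * h x)"
            using j hp[of x] by (intro ennreal_leI mult_right_mono) auto
          also have "\<dots> = F j x" using True j hp[of x] by (simp add: F_def A_def ennreal_mult')
          also have "\<dots> \<le> (\<Sum>j. F j x)" using sum_le_suminf[of "\<lambda>j. F j x" "{j}"] by (simp add: summableI)
          finally have "ennreal (g x powr (s - 1) * h x) \<le> ennreal (h x) + (\<Sum>j. F j x)"
            by (intro add_increasing) auto
          then show ?thesis using True unfolding eq by simp
        qed
      qed simp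
    qed
    also have "\<dots> = (\<integral>\<^sup>+x. ennreal (h x) * indicator ?Q x \<partial>lebesgue) + (\<integral>\<^sup>+x. (\<Sum>j. F j x) \<partial>lebesgue)"
      by (rule nn_integral_add) (use Fm in measurable)
    also have "(\<integral>\<^sup>+x. ennreal (h x) * indicator ?Q x \<partial>lebesgue) = 1"
      using em[of ?Q] emeasure_V[OF wt bounded_cube[OF l] N] VQ by simp
    also have "(\<integral>\<^sup>+x. (\<Sum>j. F j x) \<partial>lebesgue) = (\<Sum>j. \<integral>\<^sup>+x. F j x \<partial>lebesgue)"
      by (rule nn_integral_suminf) (rule Fm)
    also have "\<dots> \<le> (\<Sum>j. ennreal (C1 * z ^ j))"
    proof (rule suminf_le)
      fix j
      have "(\<integral>\<^sup>+x. F j x \<partial>lebesgue) = ennreal (2 powr ((real j + 1) * \<epsilon>)) * emeasure (modular_measure w N) (A j)"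
        unfolding F_def em[OF Am] using Am by (intro nn_integral_cmult) measurable
      also have "\<dots> = ennreal (2 powr ((real j + 1) * \<epsilon>) * V w N (A j))"
        by (simp add: emeasure_V[OF wt bA N] ennreal_mult')
      also have "\<dots> \<le> ennreal (2 powr ((real j + 1) * \<epsilon>) * (A0 * (1/c) powr \<eta> * 2 powr (- (2 * real j * \<epsilon>))))"
        using VA[of j] by (intro ennreal_leI mult_left_mono) auto
      also have "2 powr ((real j + 1) * \<epsilon>) * (A0 * (1/c) powr \<eta> * 2 powr (- (2 * real j * \<epsilon>)))
          = (A0 * (1/c) powr \<eta>) * 2 powr ((real j + 1) * \<epsilon> + (- (2 * real j * \<epsilon>)))"
        by (simp only: powr_add) simp
      also have "(real j + 1) * \<epsilon> + (- (2 * real j * \<epsilon>)) = \<epsilon> + (- \<epsilon>) * real j" by (simp add: algebra_simps)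
      also have "2 powr (\<epsilon> + (- \<epsilon>) * real j) = 2 powr \<epsilon> * z ^ j"
        by (simp only: powr_add powr_powr[symmetric] z_def) (simp add: powr_realpow)
      finally show "(\<integral>\<^sup>+x. F j x \<partial>lebesgue) \<le> ennreal (C1 * z ^ j)" by (simp add: C1_def mult.assoc)
    qed (auto intro: summableI)
    also have "\<dots> = ennreal (C1 * (1 / (1 - z)))"
      by (rule suminf_ennreal_eq) (use C1 z sums_mult[OF geometric_sums[of z], of C1] in simp_all)
    also have "1 + ennreal (C1 * (1 / (1 - z))) = ennreal C"
      using C1 z by (simp add: C_def ennreal_plus)
    finally show ?thesis by (simp add: add_left_mono)
  qed
  moreover have "1 \<le> C" using C1 z by (simp add: C_def)
  moreover have "1 < 1 + \<epsilon>" using e by simp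
  ultimately show ?thesis by blast
qed

section \<open>Admissible weights\<close>

lemma modular_measure_one:
  assumes E: "E \<in> sets lebesgue" and M: "0 < M"
  shows "emeasure (modular_measure (\<lambda>_. 1) M) E = (\<integral>\<^sup>+x\<in>E. ennreal (M powr - t x) \<partial>lebesgue)"
proof -
  have "(1 / M) powr t x = M powr - t x" for x by (simp add: powr_divide powr_minus_divide)
  then show ?thesis using E by (simp add: emeasure_modular_measure)
qed

lemma weight_one: "weight (\<lambda>_. 1)"
proof -
  have "emeasure (modular_measure (\<lambda>_. 1) 1) (cube a l) < \<infinity>" if "0 < l" for a l
    using that by (subst modular_measure_one) (auto simp: emeasure_cube)
  then show ?thesis by (simp add: weight_def)
qed

lemma V_one_le:
  assumes E: "bounded_set E" and M: "0 < M" and A: "0 \<le> A" "\<And>x. x \<in> E \<Longrightarrow> M powr - t x \<le> A"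
  shows "V (\<lambda>_. 1) M E \<le> A * measure lebesgue E"
proof -
  have "E \<in> lmeasurable" using E by (auto simp: bounded_set_def intro: fmeasurableI2[OF lmeasurable_cbox])
  then have fin: "emeasure lebesgue E = ennreal (measure lebesgue E)" by (rule emeasure_eq_measure2)
  have "ennreal (V (\<lambda>_. 1) M E) = (\<integral>\<^sup>+x\<in>E. ennreal (M powr - t x) \<partial>lebesgue)"
    using emeasure_V[OF weight_one E M] modular_measure_one[OF bounded_set_sets[OF E] M] by simp
  also have "\<dots> \<le> (\<integral>\<^sup>+x. ennreal A * indicator E x \<partial>lebesgue)"
    using A by (intro nn_integral_mono) (auto simp: indicator_def intro!: ennreal_leI)
  also have "\<dots> = ennreal (A * measure lebesgue E)"
    using bounded_set_sets[OF E] fin A by (simp add: nn_integral_cmult_indicator ennreal_mult')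
  finally show ?thesis using A by (subst (asm) ennreal_le_iff) auto
qed

lemma V_one_one: "bounded_set E \<Longrightarrow> V (\<lambda>_. 1) 1 E = measure lebesgue E"
  using modular_measure_one[of E 1] by (simp add: measure_def bounded_set_sets)

text \<open>The norm of \<open>1\<close> on a cube is at most of the size it would have for a constant exponent, namely \<open>\<tau>\<close> for large
  cubes and the value at the corner for small ones. For large cubes, unless the norm \<open>M\<close> is below a
  fixed bound, the points of \<open>ctr (M powr (1/k))\<close> contribute at most half of the modular, and at the others
  \<open>t\<close> may be replaced by \<open>\<tau>\<close>.\<close>

lemma nrm_one_upper:
  "\<exists>A\<ge>1. \<forall>a l. 0 < l \<longrightarrow> nrm (\<lambda>_. 1) (cube a l) \<le> A * (l ^ CARD('n)) powr (1 / (if 1 \<le> l then \<tau> else t a))"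
proof -
  define n where "n = real CARD('n)"
  have n: "1 \<le> n" unfolding n_def by (rule one_le_dim)
  define k where "k = 2 * n"
  define l0 where "l0 = 1 / (4 * (n * n))"
  have l0: "0 < l0" using n by (simp add: l0_def)
  define A where "A = max (max (4 * 4 ^ CARD('n)) (2 * exp (k * Ci))) (max ((1 / l0) ^ CARD('n)) (exp (2 * C0 * n)))"
  have A: "4 * 4 ^ CARD('n) \<le> A" "2 * exp (k * Ci) \<le> A" "(1 / l0) ^ CARD('n) \<le> A" "exp (2 * C0 * n) \<le> A"
    by (auto simp: A_def)
  have A1: "1 \<le> A" using A(1) one_le_power[of "4::real" "CARD('n)"] by linarith
  have "nrm (\<lambda>_. 1) (cube a l) \<le> A * (l ^ CARD('n)) powr (1 / (if 1 \<le> l then \<tau> else t a))"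
    if l: "0 < l" for a l
  proof -
    let ?Q = "cube a l"
    define M where "M = nrm (\<lambda>_. 1) ?Q"
    have M: "0 < M" using nrm_pos[OF weight_one l] by (simp add: M_def)
    have one: "V (\<lambda>_. 1) M ?Q = 1" using V_nrm[OF weight_one l] by (simp add: M_def)
    have bQ: "bounded_set ?Q" using l by simp
    have mQ: "measure lebesgue ?Q = l ^ CARD('n)" using l by (simp add: measure_cube)
    have root: "M \<le> A' * (l ^ CARD('n)) powr (1 / u)" if "1 \<le> u" "M powr u \<le> A' * l ^ CARD('n)" "1 \<le> A'" for u A'
    proof -
      have "M = (M powr u) powr (1 / u)" using that M by (simp add: powr_powr)
      also have "\<dots> \<le> (A' * l ^ CARD('n)) powr (1 / u)" using that by (intro powr_mono2) auto
      also have "\<dots> = A' powr (1 / u) * (l ^ CARD('n)) powr (1 / u)" by (rule powr_mult)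
      also have "\<dots> \<le> A' powr 1 * (l ^ CARD('n)) powr (1 / u)"
        using that by (intro mult_right_mono powr_mono) (auto simp: divide_le_eq)
      finally show ?thesis using that by simp
    qed
    show ?thesis unfolding M_def[symmetric]
    proof (cases "1 \<le> l")
      case True
      have L1: "1 \<le> (l ^ CARD('n)) powr (1 / \<tau>)"
        using True tau_ge1 by (intro ge_one_powr_ge_zero one_le_power) auto
      show "M \<le> A * (l ^ CARD('n)) powr (1 / (if 1 \<le> l then \<tau> else t a))"
      proof (cases "M \<le> 4 * 4 ^ CARD('n)")
        case True
        then have "M * 1 \<le> A * (l ^ CARD('n)) powr (1 / \<tau>)" using A(1) A1 L1 M by (intro mult_mono) auto
        then show ?thesis using \<open>1 \<le> l\<close> by simp
      next
        case False
        then have Mbig: "4 * 4 ^ CARD('n) < M" by simp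
        have "(1::real) \<le> 4 ^ CARD('n)" by simp
        then have M1: "1 \<le> M" using Mbig by linarith
        define R where "R = M powr (1 / k)"
        have R: "1 \<le> R" using M1 n by (simp add: R_def k_def ge_one_powr_ge_zero)
        have bR: "bounded_set (ctr R)" using R by simp
        have "V (\<lambda>_. 1) M (?Q \<inter> ctr R) \<le> V (\<lambda>_. 1) M (ctr R)"
          by (intro V_mono[OF weight_one bR M]) auto
        also have "\<dots> \<le> 1 / M * measure lebesgue (ctr R :: (real^'n) set)"
        proof (rule V_one_le[OF bR M])
          fix x
          have "M powr - t x \<le> M powr - 1" using M1 t_ge1 by (intro powr_mono) auto
          then show "M powr - t x \<le> 1 / M" using M by (simp add: powr_minus_divide)
        qed (use M in auto)
        also have "measure lebesgue (ctr R :: (real^'n) set) = 2 ^ CARD('n) * R ^ CARD('n)"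
          using R by (simp add: measure_ctr power_mult_distrib)
        also have "R ^ CARD('n) = M powr (1/2)"
          using M n by (simp add: R_def powr_realpow[symmetric] powr_powr k_def n_def)
        also have "1 / M * (2 ^ CARD('n) * M powr (1/2)) = 2 ^ CARD('n) * M powr (-1/2)"
          using M powr_mult_base[of M "-1/2"] by (simp add: field_simps)
        also have "\<dots> \<le> 1/2"
        proof -
          have "(2 * 2 ^ CARD('n)) * (2 * 2 ^ CARD('n)) = (4 * 4 ^ CARD('n) :: real)"
            by (simp flip: power_mult_distrib)
          then have "(2 * 2 ^ CARD('n) :: real) = (4 * 4 ^ CARD('n)) powr (1/2)"
            by (metis powr_half_sqrt real_sqrt_abs2 abs_of_nonneg zero_le_mult_iff zero_le_numeral zero_le_power)
          also have "\<dots> \<le> M powr (1/2)" using Mbig by (intro powr_mono2) auto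
          finally have "2 * 2 ^ CARD('n) * M powr (-1/2) \<le> M powr (1/2) * M powr (-1/2)"
            by (intro mult_right_mono) auto
          also have "\<dots> = 1" using M by (simp add: powr_add[symmetric])
          finally show ?thesis by simp
        qed
        finally have near: "V (\<lambda>_. 1) M (?Q \<inter> ctr R) \<le> 1/2" .
        have "1 = V (\<lambda>_. 1) M (?Q \<inter> ctr R) + V (\<lambda>_. 1) M (?Q - ctr R)"
          using V_split[OF weight_one bQ M sets_cube] one by simp
        then have "1/2 \<le> V (\<lambda>_. 1) M (?Q - ctr R)" using near by linarith
        also have "\<dots> \<le> (exp (k * Ci) * M powr - \<tau>) * measure lebesgue (?Q - ctr R)"
        proof (rule V_one_le[OF _ M])
          show "bounded_set (?Q - ctr R)" by (rule bounded_subset[OF bQ]) auto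
          fix x assume "x \<in> ?Q - ctr R"
          then have "R < norm x" by (intro norm_gt_if_not_in_ctr) auto
          then have "R \<le> exp 1 + norm x" by (smt (verit) exp_gt_zero)
          then have "ln R \<le> ln (exp 1 + norm x)" using R by (subst ln_le_cancel_iff) auto
          then have "\<bar>ln M\<bar> \<le> k * ln (exp 1 + norm x)"
            using M1 n by (simp add: R_def ln_powr k_def field_simps)
          then have "\<bar>ln M\<bar> * \<bar>t x - \<tau>\<bar> \<le> k * Ci" using n by (intro deviation_at_infinity) (auto simp: k_def)
          then have "\<bar>ln M\<bar> * \<bar>(- t x) - (- \<tau>)\<bar> \<le> k * Ci" by (simp add: abs_minus_commute)
          from powr_near(2)[OF M this] show "M powr - t x \<le> exp (k * Ci) * M powr - \<tau>" .
        qed auto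
        also have "\<dots> \<le> (exp (k * Ci) * M powr - \<tau>) * l ^ CARD('n)"
          unfolding mQ[symmetric] by (intro mult_left_mono measure_mono_fmeasurable) auto
        finally have "1/2 * M powr \<tau> \<le> (exp (k * Ci) * M powr - \<tau>) * l ^ CARD('n) * M powr \<tau>"
          by (intro mult_right_mono) auto
        also have "\<dots> = exp (k * Ci) * l ^ CARD('n) * (M powr - \<tau> * M powr \<tau>)" by simp
        also have "M powr - \<tau> * M powr \<tau> = 1" using M by (simp add: powr_add[symmetric])
        finally have "M powr \<tau> \<le> (2 * exp (k * Ci)) * l ^ CARD('n)" by simp
        also have "\<dots> \<le> A * l ^ CARD('n)" using A l by (intro mult_right_mono) auto
        finally show ?thesis using root[of \<tau> A] tau_ge1 A1 \<open>1 \<le> l\<close> by simp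
      qed
    next
      case False
      then have l1: "l < 1" by simp
      have pl: "0 < l ^ CARD('n)" "l ^ CARD('n) \<le> 1" using l l1 by (auto intro: power_le_one)
      have Mle: "M \<le> 1"
      proof (rule ccontr)
        assume "\<not> M \<le> 1"
        then have M1: "1 < M" by simp
        have "V (\<lambda>_. 1) M ?Q \<le> 1 / M * V (\<lambda>_. 1) 1 ?Q"
          by (rule V_scale_down[OF weight_one bQ]) (use M1 in auto)
        also have "\<dots> = 1 / M * l ^ CARD('n)" using V_one_one[OF bQ] mQ by simp
        also have "\<dots> \<le> 1 / M * 1" using pl M by (intro mult_left_mono) auto
        also have "\<dots> < 1" using M1 by simp
        finally show False using one by simp
      qed
      have Mge: "l ^ CARD('n) \<le> M"
        using V_scale_down[OF weight_one bQ M Mle] one V_one_one[OF bQ] mQ by simp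
      have goal: "M \<le> A * (l ^ CARD('n)) powr (1 / t a)"
      proof (cases "l < l0")
        case True
        have L: "0 < ln (1 / l)" using l l1 by simp
        have lnM: "\<bar>ln M\<bar> \<le> n * ln (1 / l)"
        proof -
          have "ln (l ^ CARD('n)) \<le> ln M" using Mge pl M by (subst ln_le_cancel_iff) auto
          then have "n * ln l \<le> ln M" using l by (simp add: ln_realpow n_def)
          moreover have "ln M \<le> 0" using Mle M by simp
          ultimately show ?thesis using l by (simp add: ln_div)
        qed
        have "V (\<lambda>_. 1) M ?Q \<le> (exp (2 * C0 * n) * M powr - t a) * measure lebesgue ?Q"
        proof (rule V_one_le[OF bQ M])
          fix x assume x: "x \<in> ?Q"
          have a: "a \<in> ?Q" using l by (simp add: mem_cube)
          have "\<bar>t x - t a\<bar> \<le> 2 * C0 / ln (1 / l)"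
            by (rule oscillation_small_cube[OF l _ x a]) (use True n l in \<open>simp add: l0_def n_def field_simps\<close>)
          then have "\<bar>ln M\<bar> * \<bar>t x - t a\<bar> \<le> (n * ln (1 / l)) * (2 * C0 / ln (1 / l))"
            using lnM L n C0 by (intro mult_mono) auto
          also have "\<dots> = 2 * C0 * n" using L by simp
          finally have "\<bar>ln M\<bar> * \<bar>(- t x) - (- t a)\<bar> \<le> 2 * C0 * n" by (simp add: abs_minus_commute)
          from powr_near(2)[OF M this] show "M powr - t x \<le> exp (2 * C0 * n) * M powr - t a" .
        qed auto
        then have "1 * M powr t a \<le> (exp (2 * C0 * n) * M powr - t a) * l ^ CARD('n) * M powr t a"
          unfolding mQ one by (intro mult_right_mono) auto
        also have "\<dots> = exp (2 * C0 * n) * l ^ CARD('n) * (M powr - t a * M powr t a)" by simp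
        also have "M powr - t a * M powr t a = 1" using M by (simp add: powr_add[symmetric])
        finally have "M powr t a \<le> exp (2 * C0 * n) * l ^ CARD('n)" by simp
        also have "\<dots> \<le> A * l ^ CARD('n)" using A l by (intro mult_right_mono) auto
        finally show ?thesis using root[of "t a" A] t_ge1 A1 by simp
      next
        case False
        have "M \<le> (1 / l0) ^ CARD('n) * l0 ^ CARD('n)" using Mle l0 by (simp add: power_divide)
        also have "\<dots> \<le> A * (l ^ CARD('n)) powr 1"
          using A A1 False l l0 by (intro mult_mono) (auto intro!: power_mono)
        also have "\<dots> \<le> A * (l ^ CARD('n)) powr (1 / t a)"
          using A1 pl t_ge1[of a] by (intro mult_left_mono powr_mono') (auto simp: divide_le_eq)
        finally show ?thesis .
      qed
      then show "M \<le> A * (l ^ CARD('n)) powr (1 / (if 1 \<le> l then \<tau> else t a))" using False by simp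
    qed
  qed
  then show ?thesis using A1 by blast
qed

text \<open>Muckenhoupt's condition implies admissibility: here \<open>B\<close> bounds the norm of \<open>1/w\<close> for the conjugate exponent.
  Integrating Young's inequality for the product of \<open>w/(\<theta> N)\<close> and \<open>1/(w B)\<close> over \<open>E\<close> bounds the measure
  of \<open>E\<close> in terms of its modular, and the parameter \<open>\<theta>\<close>, half the proportion of \<open>E\<close> in the cube up
  to the factor \<open>K\<close>, is small enough to absorb the second term.\<close>

lemma admissible_if_norm_product:
  assumes w: "weight w" and K: "1 \<le> K" and t1: "\<And>x. 1 < t x"
    and u: "u \<in> borel_measurable lebesgue" "\<And>x. u x = t x / (t x - 1)"
    and B: "\<And>a l. 0 < l \<Longrightarrow> \<exists>B>0. (\<integral>\<^sup>+x\<in>cube a l. ennreal ((1 / (w x * B)) powr u x) \<partial>lebesgue) \<le> 1 \<and>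
              nrm w (cube a l) * B \<le> K * l ^ CARD('n)"
  shows "admissible (1 / (2 * K)) w"
proof -
  have "(1 / (2 * K) * measure lebesgue E / measure lebesgue (cube a l)) powr P \<le> V w (nrm w (cube a l)) E"
    if l: "0 < l" and E: "E \<in> sets lebesgue" "E \<subseteq> cube a l" for a l E
  proof (cases "measure lebesgue E = 0")
    case True
    then show ?thesis by simp
  next
    case False
    let ?Q = "cube a l"
    define N where "N = nrm w ?Q"
    have N: "0 < N" using nrm_pos[OF w l] by (simp add: N_def)
    have bE: "bounded_set E" by (rule bounded_setI[OF l E])
    have [measurable]: "w \<in> borel_measurable lebesgue" and wp: "\<And>x. 0 < w x" using w by (auto simp: weight_def)
    note u(1)[measurable] E(1)[measurable]
    obtain B where B: "0 < B" and int: "(\<integral>\<^sup>+x\<in>?Q. ennreal ((1 / (w x * B)) powr u x) \<partial>lebesgue) \<le> 1"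
      and NB: "N * B \<le> K * l ^ CARD('n)" using B[OF l, of a] unfolding N_def by blast
    define e where "e = measure lebesgue E"
    have El: "E \<in> lmeasurable" using E by (meson fmeasurableI2 lmeasurable_cbox)
    have e: "0 < e" "e \<le> l ^ CARD('n)"
      using False measure_mono_fmeasurable[OF E(2,1) lmeasurable_cbox] l
      by (auto simp: e_def measure_cube zero_less_measure_iff)
    define \<theta> where "\<theta> = e / (2 * K * l ^ CARD('n))"
    have th: "0 < \<theta>" "\<theta> \<le> 1"
    proof -
      have pl: "0 < l ^ CARD('n)" using l by simp
      then show "0 < \<theta>" using e K by (simp add: \<theta>_def)
      have "1 * l ^ CARD('n) \<le> (2 * K) * l ^ CARD('n)" using K pl by (intro mult_right_mono) auto
      then have "e \<le> (2 * K) * l ^ CARD('n)" using e(2) by linarith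
      then show "\<theta> \<le> 1" using K pl by (simp add: \<theta>_def divide_le_eq)
    qed
    define \<alpha> where "\<alpha> = N * B * \<theta>"
    have al: "0 < \<alpha>" using N B th by (simp add: \<alpha>_def)
    define \<gamma> where "\<gamma> = (1 / \<theta>) powr P"
    have pt: "1 \<le> \<alpha> * \<gamma> * (w x / N) powr t x + \<alpha> * (1 / (w x * B)) powr u x" for x
    proof -
      have tx: "1 < t x" by (rule t1)
      have ux: "1 < u x" "1 / t x + 1 / u x = 1" using tx by (auto simp: u(2) field_simps)
      have "w x / (\<theta> * N) * (1 / (w x * B)) \<le> (w x / (\<theta> * N)) powr t x / t x + (1 / (w x * B)) powr u x / u x"
        by (rule Youngs_inequality) (use tx ux wp[of x] N B th in auto)
      also have "\<dots> \<le> (w x / (\<theta> * N)) powr t x + (1 / (w x * B)) powr u x"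
        using tx ux by (intro add_mono) (simp_all add: divide_le_eq mult_le_cancel_left1)
      also have "(w x / (\<theta> * N)) powr t x = (1 / \<theta>) powr t x * (w x / N) powr t x"
        by (simp add: powr_mult[symmetric])
      also have "\<dots> \<le> \<gamma> * (w x / N) powr t x"
        unfolding \<gamma>_def using th t_le[of x] by (intro mult_right_mono powr_mono) auto
      finally have "w x / (\<theta> * N) * (1 / (w x * B)) \<le> \<gamma> * (w x / N) powr t x + (1 / (w x * B)) powr u x" by simp
      then have "\<alpha> * (w x / (\<theta> * N) * (1 / (w x * B))) \<le> \<alpha> * (\<gamma> * (w x / N) powr t x + (1 / (w x * B)) powr u x)"
        using al by (intro mult_left_mono) auto
      moreover have "\<alpha> * (w x / (\<theta> * N) * (1 / (w x * B))) = 1"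
        using wp[of x] N B th by (simp add: \<alpha>_def)
      ultimately show ?thesis by (simp add: distrib_left mult.assoc)
    qed
    have g0: "0 \<le> \<gamma>" by (simp add: \<gamma>_def)
    have "ennreal e = (\<integral>\<^sup>+x. indicator E x \<partial>lebesgue)"
      using El E by (simp add: e_def emeasure_eq_measure2)
    also have "\<dots> \<le> (\<integral>\<^sup>+x. ennreal (\<alpha> * \<gamma>) * (ennreal ((w x / N) powr t x) * indicator E x)
        + ennreal \<alpha> * (ennreal ((1 / (w x * B)) powr u x) * indicator E x) \<partial>lebesgue)"
    proof (rule nn_integral_mono)
      fix x
      have "1 \<le> ennreal (\<alpha> * \<gamma> * (w x / N) powr t x + \<alpha> * (1 / (w x * B)) powr u x)"
        using pt[of x] by (metis ennreal_1 ennreal_leI)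
      also have "\<dots> = ennreal (\<alpha> * \<gamma>) * ennreal ((w x / N) powr t x) + ennreal \<alpha> * ennreal ((1 / (w x * B)) powr u x)"
        using al g0 by (simp add: ennreal_mult' ennreal_plus)
      finally show "indicator E x \<le> ennreal (\<alpha> * \<gamma>) * (ennreal ((w x / N) powr t x) * indicator E x)
        + ennreal \<alpha> * (ennreal ((1 / (w x * B)) powr u x) * indicator E x)" by (simp add: indicator_def)
    qed
    also have "\<dots> = (\<integral>\<^sup>+x. ennreal (\<alpha> * \<gamma>) * (ennreal ((w x / N) powr t x) * indicator E x) \<partial>lebesgue)
        + (\<integral>\<^sup>+x. ennreal \<alpha> * (ennreal ((1 / (w x * B)) powr u x) * indicator E x) \<partial>lebesgue)"
      by (rule nn_integral_add) measurable
    also have "(\<integral>\<^sup>+x. ennreal (\<alpha> * \<gamma>) * (ennreal ((w x / N) powr t x) * indicator E x) \<partial>lebesgue)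
        = ennreal (\<alpha> * \<gamma>) * ennreal (V w N E)"
      unfolding emeasure_V[OF w bE N, symmetric]
      by (subst emeasure_modular_measure) (auto intro!: nn_integral_cmult)
    also have "(\<integral>\<^sup>+x. ennreal \<alpha> * (ennreal ((1 / (w x * B)) powr u x) * indicator E x) \<partial>lebesgue)
        = ennreal \<alpha> * (\<integral>\<^sup>+x\<in>E. ennreal ((1 / (w x * B)) powr u x) \<partial>lebesgue)"
      by (rule nn_integral_cmult) measurable
    also have "(\<integral>\<^sup>+x\<in>E. ennreal ((1 / (w x * B)) powr u x) \<partial>lebesgue) \<le> 1"
      using E(2) by (intro order_trans[OF nn_integral_mono int]) (auto simp: indicator_def)
    finally have "ennreal e \<le> ennreal (\<alpha> * \<gamma>) * ennreal (V w N E) + ennreal \<alpha> * 1"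
      by (simp add: add_left_mono mult_left_mono)
    also have "\<dots> = ennreal (\<alpha> * \<gamma> * V w N E + \<alpha>)"
      using al g0 by (simp add: ennreal_mult' ennreal_plus)
    finally have "e \<le> \<alpha> * (\<gamma> * V w N E + 1)"
      using al g0 by (subst (asm) ennreal_le_iff) (auto simp: distrib_left mult.assoc)
    also have "\<dots> \<le> (e / 2) * (\<gamma> * V w N E + 1)"
    proof (rule mult_right_mono)
      have "\<alpha> \<le> K * l ^ CARD('n) * \<theta>" unfolding \<alpha>_def using NB th by (intro mult_right_mono) auto
      also have "\<dots> = e / 2" using K l by (simp add: \<theta>_def)
      finally show "\<alpha> \<le> e / 2" .
    qed (use g0 in auto)
    finally have "e * 1 \<le> e * ((\<gamma> * V w N E + 1) / 2)" by simp
    then have "1 \<le> (\<gamma> * V w N E + 1) / 2" using e(1) by (simp only: mult_le_cancel_left_pos)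
    then have "1 \<le> \<gamma> * V w N E" by simp
    then have "\<theta> powr P * 1 \<le> \<theta> powr P * (\<gamma> * V w N E)" by (intro mult_left_mono) auto
    also have "\<dots> = V w N E"
    proof -
      have "\<theta> powr P * \<gamma> = 1" using th by (simp add: \<gamma>_def powr_mult[symmetric])
      then show ?thesis by (simp add: mult.assoc[symmetric])
    qed
    finally have "\<theta> powr P \<le> V w N E" by simp
    moreover have "1 / (2 * K) * measure lebesgue E / measure lebesgue ?Q = \<theta>"
      using l by (simp add: \<theta>_def e_def measure_cube)
    ultimately show ?thesis unfolding N_def by simp
  qed
  then show ?thesis using w K by (auto simp: admissible_def)
qed

end

section \<open>Norms of functions with values in the extended half-line\<close>

text \<open>The outer norm in the \<open>\<A>\<close>-condition is taken of a function whose values are norms and whose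
  measurability is not evident. For such \<open>f\<close> the integral is a lower integral, which is still subadditive as long
  as one summand is measurable.\<close>

lemma nn_integral_add_le:
  assumes g: "g \<in> borel_measurable M" and fin: "\<And>x. g x < \<infinity>"
  shows "(\<integral>\<^sup>+x. f x + g x \<partial>M) \<le> (\<integral>\<^sup>+x. f x \<partial>M) + (\<integral>\<^sup>+x. g x \<partial>M)"
  unfolding nn_integral_def[of M "\<lambda>x. f x + g x"]
proof (rule SUP_least, clarify)
  fix \<phi> assume sf: "simple_function M \<phi>" and le: "\<phi> \<le> (\<lambda>x. f x + g x)"
  have \<phi>m: "\<phi> \<in> borel_measurable M" using sf by (rule borel_measurable_simple_function)
  have "integral\<^sup>S M \<phi> = (\<integral>\<^sup>+x. \<phi> x \<partial>M)" using sf by (simp add: nn_integral_eq_simple_integral)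
  also have "\<dots> \<le> (\<integral>\<^sup>+x. (\<phi> x - g x) + g x \<partial>M)"
    by (intro nn_integral_mono) (metis diff_add_cancel_ennreal add_increasing ennreal_minus_cancel_iff linear zero_le diff_eq_0_ennreal)
  also have "\<dots> = (\<integral>\<^sup>+x. \<phi> x - g x \<partial>M) + (\<integral>\<^sup>+x. g x \<partial>M)"
    using \<phi>m g by (intro nn_integral_add) auto
  also have "(\<integral>\<^sup>+x. \<phi> x - g x \<partial>M) \<le> (\<integral>\<^sup>+x. f x \<partial>M)"
  proof (rule nn_integral_mono)
    fix x
    have "\<phi> x \<le> g x + f x" using le by (simp add: le_fun_def add.commute)
    then show "\<phi> x - g x \<le> f x" using fin[of x] by (auto simp: ennreal_minus_le_iff)
  qed
  finally show "integral\<^sup>S M \<phi> \<le> (\<integral>\<^sup>+x. f x \<partial>M) + (\<integral>\<^sup>+x. g x \<partial>M)" by (simp add: add_right_mono)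
qed

text \<open>As above, for a function \<open>f\<close> that need not be measurable.\<close>

lemma nn_integral_cmult_le:
  assumes c: "0 < c"
  shows "(\<integral>\<^sup>+x. ennreal c * f x \<partial>M) \<le> ennreal c * (\<integral>\<^sup>+x. f x \<partial>M)"
  unfolding nn_integral_def[of M "\<lambda>x. ennreal c * f x"]
proof (rule SUP_least, clarify)
  fix \<phi> assume sf: "simple_function M \<phi>" and le: "\<phi> \<le> (\<lambda>x. ennreal c * f x)"
  have \<phi>m: "\<phi> \<in> borel_measurable M" using sf by (rule borel_measurable_simple_function)
  have cc: "ennreal (1 / c) * ennreal c = 1" "ennreal c * ennreal (1 / c) = 1"
    using c by (simp_all flip: ennreal_mult' ennreal_1)
  have "integral\<^sup>S M \<phi> = (\<integral>\<^sup>+x. ennreal c * (ennreal (1 / c) * \<phi> x) \<partial>M)"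
    using sf by (simp add: nn_integral_eq_simple_integral mult.assoc[symmetric] cc)
  also have "\<dots> = ennreal c * (\<integral>\<^sup>+x. ennreal (1 / c) * \<phi> x \<partial>M)"
    using \<phi>m by (intro nn_integral_cmult) auto
  also have "\<dots> \<le> ennreal c * (\<integral>\<^sup>+x. f x \<partial>M)"
  proof (intro mult_left_mono nn_integral_mono)
    fix x
    have "ennreal (1 / c) * \<phi> x \<le> ennreal (1 / c) * (ennreal c * f x)"
      using le by (intro mult_left_mono) (auto simp: le_fun_def)
    then show "ennreal (1 / c) * \<phi> x \<le> f x" by (simp add: mult.assoc[symmetric] cc)
  qed simp
  finally show "integral\<^sup>S M \<phi> \<le> ennreal c * (\<integral>\<^sup>+x. f x \<partial>M)" .
qed

lemma ennreal_powr_ennreal: "0 \<le> r \<Longrightarrow> ennreal_powr (ennreal r) t = ennreal (r powr t)"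
  by (simp add: ennreal_powr_def)

lemma ennreal_powr_top [simp]: "ennreal_powr top t = top"
  by (simp add: ennreal_powr_def)

lemma ennreal_powr_0 [simp]: "ennreal_powr 0 t = 0"
  by (simp add: ennreal_powr_def)

lemma ennreal_powr_mono:
  assumes "a \<le> b" "0 \<le> t"
  shows "ennreal_powr a t \<le> ennreal_powr b t"
proof (cases "b = top")
  case False
  then have "a \<noteq> top" using assms(1) by (auto simp: top_unique)
  then show ?thesis
    using assms False by (auto simp: ennreal_powr_def less_top intro!: ennreal_leI powr_mono2 enn2real_mono)
qed simp

lemma ennreal_divide_left_mono:
  fixes a :: ennreal
  assumes "0 < l" "l \<le> c"
  shows "a / ennreal c \<le> a / ennreal l"
  unfolding divide_ennreal_def using assms
  by (intro mult_left_mono) (auto simp: inverse_ennreal intro!: ennreal_leI le_imp_inverse_le)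

locale finite_exponent =
  fixes q :: "real^'n \<Rightarrow> ennreal" and r :: "real^'n \<Rightarrow> real"
  assumes q_eq: "\<And>x. q x = ennreal (r x)" and r_nonneg: "\<And>x. 0 \<le> r x"
begin

lemma modular_eq: "modular q f = (\<integral>\<^sup>+x. ennreal_powr (f x) (r x) \<partial>lebesgue)"
proof -
  have emp: "{x. q x = \<infinity>} = {}" by (simp add: q_eq)
  have "esssup (restrict_space lebesgue {}) f = 0"
  proof -
    have "ae_filter (restrict_space lebesgue ({} :: (real^'n) set)) = bot"
      by (simp add: Measure_Space.ae_filter_eq_bot_iff space_restrict_space)
    moreover have "f \<in> borel_measurable (restrict_space lebesgue {})"
      by (rule measurableI) (auto simp: space_restrict_space)
    ultimately show ?thesis by (simp add: esssup_def bot_ennreal)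
  qed
  then show ?thesis
    using r_nonneg by (simp add: modular_def emp q_eq)
qed

lemma Lp_norm_leI:
  assumes "0 < l" "(\<integral>\<^sup>+x. ennreal_powr (f x / ennreal l) (r x) \<partial>lebesgue) \<le> 1"
  shows "Lp_norm q f \<le> ennreal l"
  unfolding Lp_norm_def using assms by (intro Inf_lower) (auto simp: modular_eq)

lemma Lp_norm_lessD:
  assumes "Lp_norm q f < ennreal c"
  shows "(\<integral>\<^sup>+x. ennreal_powr (f x / ennreal c) (r x) \<partial>lebesgue) \<le> 1"
proof -
  obtain l where l: "0 < l" "ennreal l < ennreal c" "modular q (\<lambda>x. f x / ennreal l) \<le> 1"
    using assms unfolding Lp_norm_def Inf_less_iff by blast
  then have "l \<le> c" by (simp add: ennreal_less_iff)
  then have "(\<integral>\<^sup>+x. ennreal_powr (f x / ennreal c) (r x) \<partial>lebesgue)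
      \<le> (\<integral>\<^sup>+x. ennreal_powr (f x / ennreal l) (r x) \<partial>lebesgue)"
    using l r_nonneg by (intro nn_integral_mono ennreal_powr_mono ennreal_divide_left_mono) auto
  then show ?thesis using l(3) by (simp add: modular_eq)
qed

end

section \<open>The scalar weights of a matrix weight\<close>

lemma matrix_inv_works:
  fixes A :: "real^'d^'d"
  assumes "det A \<noteq> 0"
  shows "A ** matrix_inv A = mat 1" "matrix_inv A ** A = mat 1"
proof -
  have "\<exists>A'. A ** A' = mat 1 \<and> A' ** A = mat 1"
    using assms invertible_det_nz[of A] by (simp add: invertible_def)
  from someI_ex[OF this] show "A ** matrix_inv A = mat 1" "matrix_inv A ** A = mat 1"
    unfolding matrix_inv_def by auto
qed

lemma matrix_inv_symmetric:
  fixes A :: "real^'d^'d"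
  assumes d: "det A \<noteq> 0" and s: "transpose A = A"
  shows "transpose (matrix_inv A) = matrix_inv A"
proof -
  let ?T = "transpose (matrix_inv A)"
  have "?T ** A = transpose (A ** matrix_inv A)"
    by (simp add: matrix_transpose_mul s)
  also have "\<dots> = mat 1" using matrix_inv_works[OF d] by (simp add: transpose_mat)
  finally have "?T ** A = mat 1" .
  then have "?T ** (A ** matrix_inv A) = matrix_inv A" by (simp add: matrix_mul_assoc)
  then show ?thesis using matrix_inv_works[OF d] by simp
qed

lemma op_norm_bound: "norm (A *v v) \<le> op_norm A * norm v" for A :: "real^'d^'d"
  by (rule onorm) simp

text \<open>The inequality \<open>\<bar>A\<^sup>T v\<bar>\<^sup>2 = \<langle>v, A A\<^sup>T v\<rangle> \<le> \<bar>v\<bar> \<bar>A\<bar> \<bar>A\<^sup>T v\<bar>\<close>.\<close>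

lemma norm_transpose_mult_le:
  fixes A :: "real^'d^'d"
  shows "norm (transpose A *v v) \<le> op_norm A * norm v"
proof -
  let ?u = "transpose A *v v"
  have "norm ?u * norm ?u = ?u \<bullet> ?u" by (simp add: power2_norm_eq_inner[symmetric] power2_eq_square)
  also have "\<dots> = v \<bullet> (A *v ?u)" by (simp add: dot_lmul_matrix)
  also have "\<dots> \<le> norm v * (op_norm A * norm ?u)"
    by (intro order_trans[OF norm_cauchy_schwarz] mult_left_mono op_norm_bound) auto
  finally have "norm ?u * norm ?u \<le> (op_norm A * norm v) * norm ?u" by (simp add: mult_ac)
  then show ?thesis
    by (cases "norm ?u = 0") (auto simp: mult_le_cancel_right onorm_pos_le)
qed

lemma op_norm_le_sum_rows:
  fixes A :: "real^'d^'d"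
  shows "op_norm A \<le> (\<Sum>i\<in>UNIV. norm (transpose A *v axis i 1))"
proof (rule onorm_le)
  fix v
  have "\<bar>(A *v v) $ i\<bar> \<le> norm (transpose A *v axis i 1) * norm v" for i
  proof -
    have "(A *v v) $ i = axis i 1 \<bullet> (A *v v)" by (simp add: inner_axis' )
    also have "\<dots> = (transpose A *v axis i 1) \<bullet> v" by (simp add: dot_lmul_matrix)
    finally show ?thesis by (simp add: Cauchy_Schwarz_ineq2)
  qed
  then have "(\<Sum>i\<in>UNIV. \<bar>(A *v v) $ i\<bar>) \<le> (\<Sum>i\<in>UNIV. norm (transpose A *v axis i 1) * norm v)"
    by (intro sum_mono)
  then show "norm (A *v v) \<le> (\<Sum>i\<in>UNIV. norm (transpose A *v axis i 1)) * norm v"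
    using norm_le_l1_cart[of "A *v v"] by (simp add: sum_distrib_right)
qed

lemma pd_det_nonzero:
  assumes "A \<in> pd_matrices"
  shows "det A \<noteq> 0"
proof -
  have "v = 0" if "A *v v = 0" for v
    using assms that by (force simp: pd_matrices_def)
  then show ?thesis
    unfolding invertible_det_nz[symmetric] invertible_left_inverse matrix_left_invertible_ker by blast
qed

text \<open>The scalar weight \<open>\<bar>W\<^sup>-\<^sup>1(y) e\<bar>\<close>. The value 1 on the null set of singular matrices keeps it positive
  everywhere.\<close>

definition dual_weight :: "(real^'n \<Rightarrow> real^'d^'d) \<Rightarrow> real^'d \<Rightarrow> real^'n \<Rightarrow> real" where
  "dual_weight W e y = (if det (W y) = 0 then 1 else norm (matrix_inv (W y) *v e))"

lemma dual_weight_pos: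
  assumes "e \<noteq> 0"
  shows "0 < dual_weight W e y"
proof (cases "det (W y) = 0")
  case False
  have "matrix_inv (W y) *v e \<noteq> 0"
  proof
    assume "matrix_inv (W y) *v e = 0"
    then have "(W y ** matrix_inv (W y)) *v e = 0" by (simp add: matrix_vector_mul_assoc[symmetric])
    then show False using assms matrix_inv_works(1)[OF False] by simp
  qed
  then show ?thesis using False by (simp add: dual_weight_def)
qed (simp add: dual_weight_def)

text \<open>Cramer's rule expresses the weight by determinants, and so by polynomials in the entries of \<open>W\<close>.\<close>

lemma dual_weight_measurable:
  fixes W :: "real^'n \<Rightarrow> real^'d^'d"
  assumes W: "W \<in> borel_measurable M"
  shows "dual_weight W e \<in> borel_measurable M"
proof -
  have entry [measurable]: "(\<lambda>y. W y $ i $ j) \<in> borel_measurable M" for i j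
  proof (rule measurable_compose[OF W])
    have "continuous_on UNIV (\<lambda>A :: real^'d^'d. A $ i $ j)" by (intro continuous_intros)
    then show "(\<lambda>A :: real^'d^'d. A $ i $ j) \<in> borel_measurable borel"
      by (rule borel_measurable_continuous_onI)
  qed
  have detm: "(\<lambda>y. det (F y)) \<in> borel_measurable M"
    if [measurable]: "\<And>i j. (\<lambda>y. F y $ i $ j) \<in> borel_measurable M" for F :: "real^'n \<Rightarrow> real^'d^'d"
    unfolding det_def by measurable
  have det1 [measurable]: "(\<lambda>y. det (W y)) \<in> borel_measurable M" by (rule detm) measurable
  have det2 [measurable]: "(\<lambda>y. det (\<chi> i j. if j = k then e $ i else W y $ i $ j)) \<in> borel_measurable M" for k
  proof (rule detm)
    show "(\<lambda>y. (\<chi> i j. if j = k then e $ i else W y $ i $ j) $ i $ j) \<in> borel_measurable M" for i j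
      by (cases "j = k") simp_all
  qed
  have eq: "dual_weight W e y = (if det (W y) = 0 then 1 else
      sqrt (\<Sum>k\<in>UNIV. (det (\<chi> i j. if j = k then e $ i else W y $ i $ j) / det (W y))\<^sup>2))" for y
  proof (cases "det (W y) = 0")
    case False
    have "W y *v (matrix_inv (W y) *v e) = e"
      using matrix_inv_works(1)[OF False] by (simp add: matrix_vector_mul_assoc)
    then have "matrix_inv (W y) *v e = (\<chi> k. det (\<chi> i j. if j = k then e $ i else W y $ i $ j) / det (W y))"
      by (simp add: cramer[OF False])
    then show ?thesis using False by (simp add: dual_weight_def norm_vec_def L2_set_def power_divide)
  qed (simp add: dual_weight_def)
  show ?thesis unfolding eq[abs_def] by measurable
qed

text \<open>The vector \<open>W\<^sup>-\<^sup>1(y) e\<close> is the image of \<open>W\<^sup>-\<^sup>1(x) e\<close> under \<open>W\<^sup>-\<^sup>1(y) W(x)\<close>, the transpose of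
  \<open>W(x) W\<^sup>-\<^sup>1(y)\<close>. This brings the scalar weights under the control of the matrix condition.\<close>

lemma dual_weight_ratio:
  assumes x: "det (W x) \<noteq> 0" and y: "det (W y) \<noteq> 0"
    and s: "transpose (W x) = W x" "transpose (W y) = W y"
  shows "dual_weight W e y \<le> op_norm (W x ** matrix_inv (W y)) * dual_weight W e x"
proof -
  have "matrix_inv (W y) *v e = transpose (W x ** matrix_inv (W y)) *v (matrix_inv (W x) *v e)"
  proof -
    have "transpose (W x ** matrix_inv (W y)) = matrix_inv (W y) ** W x"
      using matrix_inv_symmetric[OF y s(2)] s(1) by (simp add: matrix_transpose_mul)
    then have "transpose (W x ** matrix_inv (W y)) *v (matrix_inv (W x) *v e)
        = (matrix_inv (W y) ** (W x ** matrix_inv (W x))) *v e"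
      by (simp add: matrix_vector_mul_assoc matrix_mul_assoc)
    then show ?thesis using matrix_inv_works(1)[OF x] by simp
  qed
  then show ?thesis
    using norm_transpose_mult_le[of "W x ** matrix_inv (W y)" "matrix_inv (W x) *v e"] x y
    by (simp add: dual_weight_def)
qed

text \<open>Conversely, the rows of \<open>W(x) W\<^sup>-\<^sup>1(y)\<close> are the vectors \<open>W\<^sup>-\<^sup>1(y) W(x) e\<^sub>i\<close>, so finitely many scalar
  weights, though dependent on \<open>x\<close>, recover the operator norm.\<close>

lemma op_norm_le_sum_dual_weights:
  assumes y: "det (W y) \<noteq> 0" and s: "transpose (W x) = W x" "transpose (W y) = W y"
  shows "op_norm (W x ** matrix_inv (W y)) \<le> (\<Sum>i\<in>UNIV. dual_weight W (W x *v axis i 1) y)"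
proof -
  have "transpose (W x ** matrix_inv (W y)) = matrix_inv (W y) ** W x"
    using matrix_inv_symmetric[OF y s(2)] s(1) by (simp add: matrix_transpose_mul)
  then have "norm (transpose (W x ** matrix_inv (W y)) *v axis i 1) = dual_weight W (W x *v axis i 1) y" for i
    using y by (simp add: dual_weight_def matrix_vector_mul_assoc)
  then show ?thesis using op_norm_le_sum_rows[of "W x ** matrix_inv (W y)"] by simp
qed

lemma dual_weight_self:
  assumes x: "det (W x) \<noteq> 0"
  shows "dual_weight W (W x *v axis i 1) x = 1"
  using x matrix_inv_works(2)[OF x] by (simp add: dual_weight_def matrix_vector_mul_assoc norm_axis_1)

lemma image_axis_nonzero:
  fixes A :: "real^'d^'d"
  assumes "det A \<noteq> 0"
  shows "A *v axis i 1 \<noteq> 0"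
proof
  assume "A *v axis i 1 = 0"
  then have "(matrix_inv A ** A) *v axis i 1 = 0" by (simp add: matrix_vector_mul_assoc[symmetric])
  then show False using matrix_inv_works(2)[OF assms] by (simp add: axis_eq_0_iff)
qed

section \<open>Log-Hoelder exponents and their conjugates\<close>

text \<open>The essential lower bound holds at every point because log-Hoelder functions are continuous.\<close>

lemma exponent_gt_exponent_minus:
  fixes p :: "real^'n \<Rightarrow> ennreal"
  assumes "\<And>x. p x < \<infinity>" "log_Hoelder (\<lambda>x. enn2real (p x))" "ennreal m < exponent_minus p"
  shows "m \<le> enn2real (p x)"
proof (rule ccontr)
  let ?r = "\<lambda>x. enn2real (p x)"
  assume "\<not> m \<le> ?r x"
  then have d: "0 < m - ?r x" by simp
  obtain C0 where C0: "\<And>x y. norm (x - y) < 1/2 \<Longrightarrow> \<bar>?r x - ?r y\<bar> \<le> C0 / (- ln (norm (x - y)))"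
    using assms(2) unfolding log_Hoelder_def by blast
  define \<delta> where "\<delta> = min (1/4) (exp (- (\<bar>C0\<bar> / (m - ?r x))) / 2)"
  have del: "0 < \<delta>" "\<delta> \<le> 1/4" "\<delta> < exp (- (\<bar>C0\<bar> / (m - ?r x)))"
    by (auto simp: \<delta>_def min_def)
  have near: "?r y < m" if "y \<in> ball x \<delta>" for y
  proof (cases "y = x")
    case True then show ?thesis using d by simp
  next
    case False
    define h where "h = norm (x - y)"
    have h: "0 < h" "h < \<delta>" using that False by (auto simp: h_def dist_norm)
    have "ln h < ln (exp (- (\<bar>C0\<bar> / (m - ?r x))))" using h del by (subst ln_less_cancel_iff) auto
    then have l: "\<bar>C0\<bar> / (m - ?r x) < - ln h" by simp
    have l0: "0 < - ln h" using h del by simp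
    have "?r y - ?r x \<le> C0 / (- ln h)" using C0[of x y] h del unfolding h_def by (simp add: abs_le_iff)
    also have "\<dots> \<le> \<bar>C0\<bar> / (- ln h)" using l0 by (intro divide_right_mono) auto
    also have "\<dots> < m - ?r x" using l l0 d by (simp add: field_simps)
    finally show ?thesis by simp
  qed
  have "AE y in lebesgue. ennreal m < p y"
    using assms(3) unfolding exponent_minus_def by (rule less_LiminfD)
  then have "AE y in lebesgue. y \<notin> ball x \<delta>"
  proof eventually_elim
    case (elim y)
    show ?case
    proof
      assume "y \<in> ball x \<delta>"
      then have "?r y < m" by (rule near)
      then have "ennreal (?r y) \<le> ennreal m" by (intro ennreal_leI) simp
      then show False using elim assms(1)[of y] by (simp add: ennreal_enn2real_if split: if_splits)
    qed
  qed
  then have "emeasure lebesgue (ball x \<delta>) = 0"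
    by (subst (asm) AE_iff_measurable[of "ball x \<delta>"]) auto
  moreover have "0 < emeasure lebesgue (ball x \<delta>)"
    using open_not_negligible[of "ball x \<delta>"] del
    by (metis ball_eq_empty negligible_iff_emeasure0 open_ball not_le not_gr_zero fmeasurableD lmeasurable_ball)
  ultimately show False by simp
qed

lemma conj_exponent_finite:
  assumes "p x = ennreal r" "1 < r"
  shows "conj_exponent p x = ennreal (r / (r - 1))"
proof -
  have "1 - inverse (ennreal r) = ennreal (1 - inverse r)"
    using assms by (simp add: inverse_ennreal ennreal_minus flip: ennreal_1)
  moreover have "0 < 1 - inverse r" using assms by (simp add: field_simps)
  moreover have "inverse (1 - inverse r) = r / (r - 1)" using assms by (simp add: field_simps)
  ultimately show ?thesis using assms by (simp add: conj_exponent_def inverse_ennreal)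
qed

text \<open>Raising the limit at infinity to the lower bound \<open>b\<close> only brings it closer to the values of \<open>u\<close>.\<close>

lemma lh_exponent_of_log_Hoelder:
  fixes u :: "real^'n \<Rightarrow> real"
  assumes m: "u \<in> borel_measurable lebesgue" and lh: "log_Hoelder u" and b: "\<And>x. b \<le> u x" "1 \<le> b"
  shows "\<exists>P C0 Ci \<tau>. lh_exponent u P C0 Ci \<tau> \<and> b \<le> \<tau>"
proof -
  obtain C0 Ci v where C0: "\<And>x y. norm (x - y) < 1/2 \<Longrightarrow> \<bar>u x - u y\<bar> \<le> C0 / (- ln (norm (x - y)))"
    and Ci: "\<And>x. \<bar>u x - v\<bar> \<le> Ci / ln (exp 1 + norm x)"
    using lh unfolding log_Hoelder_def by blast
  have l1: "1 \<le> ln (exp 1 + norm x)" for x :: "real^'n"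
  proof -
    have "ln (exp 1) \<le> ln (exp 1 + norm x)" by (subst ln_le_cancel_iff) (auto simp: add_pos_nonneg)
    then show ?thesis by simp
  qed
  define \<tau> where "\<tau> = max v b"
  define P where "P = max (\<bar>v\<bar> + \<bar>Ci\<bar>) \<tau>"
  have tau: "\<bar>u x - \<tau>\<bar> \<le> \<bar>u x - v\<bar>" for x using b(1)[of x] by (auto simp: \<tau>_def)
  have Ci': "Ci / ln (exp 1 + norm x) \<le> \<bar>Ci\<bar> / ln (exp 1 + norm x)" for x :: "real^'n"
    using l1[of x] by (intro divide_right_mono) auto
  have "lh_exponent u P \<bar>C0\<bar> \<bar>Ci\<bar> \<tau>"
  proof
    show "u x \<le> P" for x
    proof -
      have "\<bar>Ci\<bar> / ln (exp 1 + norm x) \<le> \<bar>Ci\<bar> / 1" using l1[of x] by (intro divide_left_mono) auto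
      then have "u x \<le> \<bar>v\<bar> + \<bar>Ci\<bar>" using Ci[of x] Ci'[of x] by linarith
      then show ?thesis by (simp add: P_def)
    qed
    show "\<bar>u x - \<tau>\<bar> \<le> \<bar>Ci\<bar> / ln (exp 1 + norm x)" for x
      using tau[of x] Ci[of x] Ci'[of x] by linarith
    show "\<bar>u x - u y\<bar> \<le> \<bar>C0\<bar> / (- ln (norm (x - y)))" if "norm (x - y) < 1/2" for x y
    proof -
      have "0 \<le> - ln (norm (x - y))" using that by (cases "x = y") auto
      then have "C0 / (- ln (norm (x - y))) \<le> \<bar>C0\<bar> / (- ln (norm (x - y)))" by (intro divide_right_mono) auto
      then show ?thesis using C0[OF that] by linarith
    qed
    show "1 \<le> u x" for x using b(1)[of x] b(2) by linarith
  qed (use m b in \<open>auto simp: \<tau>_def P_def\<close>)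
  moreover have "b \<le> \<tau>" by (simp add: \<tau>_def)
  ultimately show ?thesis by blast
qed

text \<open>The map \<open>s \<mapsto> s / (s - 1)\<close> is Lipschitz on \<open>[b, \<infinity>)\<close> for \<open>b > 1\<close>.\<close>

lemma conj_lh_exponent:
  fixes u :: "real^'n \<Rightarrow> real"
  assumes lh: "lh_exponent u P C0 Ci \<tau>" and b: "1 < b" "\<And>x. b \<le> u x" "b \<le> \<tau>"
  shows "\<exists>P' C0' Ci'. lh_exponent (\<lambda>x. u x / (u x - 1)) P' C0' Ci' (\<tau> / (\<tau> - 1))"
proof -
  interpret lh_exponent u P C0 Ci \<tau> by fact
  define B where "B = 1 / ((b - 1) * (b - 1))"
  have B: "0 \<le> B" by (simp add: B_def)
  have lip: "\<bar>s / (s - 1) - s' / (s' - 1)\<bar> \<le> B * \<bar>s - s'\<bar>" if "b \<le> s" "b \<le> s'" for s s'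
  proof -
    have p: "0 < s - 1" "0 < s' - 1" using that b by auto
    have "s / (s - 1) - s' / (s' - 1) = (s' - s) / ((s - 1) * (s' - 1))"
      using p by (simp add: field_simps)
    then have "\<bar>s / (s - 1) - s' / (s' - 1)\<bar> = \<bar>s - s'\<bar> / ((s - 1) * (s' - 1))"
      using p by (simp add: abs_mult abs_minus_commute)
    also have "\<dots> \<le> \<bar>s - s'\<bar> / ((b - 1) * (b - 1))"
      using that b by (intro divide_left_mono mult_mono mult_pos_pos) auto
    finally show ?thesis by (simp add: B_def)
  qed
  have range: "1 \<le> s / (s - 1)" "s / (s - 1) \<le> b / (b - 1)" if "b \<le> s" for s
    using that b by (auto simp: field_simps)
  have "lh_exponent (\<lambda>x. u x / (u x - 1)) (b / (b - 1)) (B * C0) (B * Ci) (\<tau> / (\<tau> - 1))"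
  proof
    show "(\<lambda>x. u x / (u x - 1)) \<in> borel_measurable lebesgue" by measurable
    show "\<bar>u x / (u x - 1) - u y / (u y - 1)\<bar> \<le> B * C0 / (- ln (norm (x - y)))" if "norm (x - y) < 1/2" for x y
      using lip[OF b(2) b(2), of x y] mult_left_mono[OF lh_local[OF that] B] by simp
    show "\<bar>u x / (u x - 1) - \<tau> / (\<tau> - 1)\<bar> \<le> B * Ci / ln (exp 1 + norm x)" for x
      using lip[OF b(2) b(3), of x] mult_left_mono[OF lh_inf[of x] B] by simp
    show "1 \<le> u x / (u x - 1)" "u x / (u x - 1) \<le> b / (b - 1)" for x by (rule range[OF b(2)])+
    show "1 \<le> \<tau> / (\<tau> - 1)" "\<tau> / (\<tau> - 1) \<le> b / (b - 1)" by (rule range[OF b(3)])+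
    show "0 \<le> B * C0" "0 \<le> B * Ci" using B C0 Ci by simp_all
  qed
  then show ?thesis by blast
qed

text \<open>The constant weight satisfies Muckenhoupt's condition: at each cube the bounds for the norms of \<open>1\<close> with the two
  conjugate exponents multiply to the volume, because the reciprocals of the two reference exponents add up to one.\<close>

lemma admissible_one:
  fixes u :: "real^'n \<Rightarrow> real"
  assumes lh: "lh_exponent u P C0 Ci \<tau>" and lh': "lh_exponent (\<lambda>x. u x / (u x - 1)) P' C0' Ci' (\<tau> / (\<tau> - 1))"
    and u1: "\<And>x. 1 < u x" and t1: "1 < \<tau>"
  shows "\<exists>c. lh_exponent.admissible u P c (\<lambda>_. 1)"
proof -
  interpret A: lh_exponent u P C0 Ci \<tau> by fact
  interpret B: lh_exponent "\<lambda>x. u x / (u x - 1)" P' C0' Ci' "\<tau> / (\<tau> - 1)" by fact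
  obtain A1 where A1: "1 \<le> A1" "\<And>a l. 0 < l \<Longrightarrow> A.nrm (\<lambda>_. 1) (cube a l) \<le> A1 * (l ^ CARD('n)) powr (1 / (if 1 \<le> l then \<tau> else u a))"
    using A.nrm_one_upper by blast
  obtain B1 where B1: "1 \<le> B1" "\<And>a l. 0 < l \<Longrightarrow> B.nrm (\<lambda>_. 1) (cube a l) \<le> B1 * (l ^ CARD('n)) powr (1 / (if 1 \<le> l then \<tau> / (\<tau> - 1) else u a / (u a - 1)))"
    using B.nrm_one_upper by blast
  have "1 * 1 \<le> A1 * B1" using A1(1) B1(1) by (intro mult_mono) auto
  then have K: "1 \<le> A1 * B1" by simp
  have "A.admissible (1 / (2 * (A1 * B1))) (\<lambda>_. 1)"
  proof (rule A.admissible_if_norm_product[OF A.weight_one K u1])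
    show "(\<lambda>x. u x / (u x - 1)) \<in> borel_measurable lebesgue" by (rule B.t_meas)
    fix a :: "real^'n" and l :: real assume l: "0 < l"
    let ?B = "B.nrm (\<lambda>_. 1) (cube a l)"
    have Bp: "0 < ?B" by (rule B.nrm_pos[OF B.weight_one l])
    have "(\<integral>\<^sup>+x\<in>cube a l. ennreal ((1 / (1 * ?B)) powr (u x / (u x - 1))) \<partial>lebesgue)
        = emeasure (B.modular_measure (\<lambda>_. 1) ?B) (cube a l)"
      by (subst B.emeasure_modular_measure) auto
    also have "\<dots> = 1" using B.emeasure_V[OF B.weight_one B.bounded_cube[OF l] Bp] B.V_nrm[OF B.weight_one l] by simp
    finally have int: "(\<integral>\<^sup>+x\<in>cube a l. ennreal ((1 / (1 * ?B)) powr (u x / (u x - 1))) \<partial>lebesgue) \<le> 1" by simp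
    define s where "s = (if 1 \<le> l then \<tau> else u a)"
    have s: "1 < s" using u1 t1 by (simp add: s_def)
    have s': "(if 1 \<le> l then \<tau> / (\<tau> - 1) else u a / (u a - 1)) = s / (s - 1)" by (simp add: s_def)
    have "A.nrm (\<lambda>_. 1) (cube a l) * ?B \<le> (A1 * (l ^ CARD('n)) powr (1 / s)) * (B1 * (l ^ CARD('n)) powr (1 / (s / (s - 1))))"
      using A1(2)[OF l, of a] B1(2)[OF l, of a] A1(1) Bp unfolding s' s_def[symmetric]
      by (intro mult_mono) auto
    also have "\<dots> = A1 * B1 * ((l ^ CARD('n)) powr (1 / s + 1 / (s / (s - 1))))"
      by (simp only: powr_add mult_ac)
    also have "1 / s + 1 / (s / (s - 1)) = 1" using s by (simp add: field_simps)
    finally have "A.nrm (\<lambda>_. 1) (cube a l) * ?B \<le> A1 * B1 * l ^ CARD('n)" using l by simp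
    then show "\<exists>B>0. (\<integral>\<^sup>+x\<in>cube a l. ennreal ((1 / (1 * B)) powr (u x / (u x - 1))) \<partial>lebesgue) \<le> 1 \<and>
              A.nrm (\<lambda>_. 1) (cube a l) * B \<le> A1 * B1 * l ^ CARD('n)"
      using Bp int by blast
  qed simp
  then show ?thesis by blast
qed

section \<open>Raising the inner exponent and lowering the outer one\<close>

text \<open>Here \<open>t\<close> is the conjugate of the given exponent: the inner norm of the \<open>\<A>\<close>-condition is the one with
  exponent \<open>t\<close>, and the exponent \<open>q\<close> with \<open>q' = s p'\<close> has the inner exponent \<open>s t\<close>.\<close>

locale dual_setting = lh_exponent t P C0 Ci \<tau>
  for t :: "real^'n \<Rightarrow> real" and P C0 Ci \<tau> :: real +
  fixes W :: "real^'n \<Rightarrow> real^'d^'d"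
  assumes t_gt1: "\<And>x. 1 < t x"
    and W_meas: "W \<in> borel_measurable lebesgue"
    and W_sym: "\<And>x. transpose (W x) = W x"
    and W_det: "AE x in lebesgue. det (W x) \<noteq> 0"
begin

definition inner_norm :: "real \<Rightarrow> (real^'n) set \<Rightarrow> real^'n \<Rightarrow> ennreal" where
  "inner_norm s Q x = Lp_norm (\<lambda>y. ennreal (s * t y)) (\<lambda>y. ennreal (op_norm (W x ** matrix_inv (W y))) * indicator Q y)"

lemma finite_exponent_scaled: "1 \<le> s \<Longrightarrow> finite_exponent (\<lambda>y. ennreal (s * t y)) (\<lambda>y. s * t y)"
  by unfold_locales (use t_ge1 in \<open>auto intro!: mult_nonneg_nonneg intro: order_trans[OF zero_le_one]\<close>)

lemma op_norm_nonneg: "0 \<le> op_norm (A :: real^'d^'d)"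
  by (rule onorm_pos_le) simp

text \<open>Dividing by \<open>dual_weight W e x\<close>, the weight is pointwise dominated by the operator norm inside the inner norm.\<close>

lemma dual_modular_le_1:
  assumes x: "det (W x) \<noteq> 0" and e: "e \<noteq> 0" and b: "inner_norm 1 (cube a l) x < ennreal b"
  shows "emeasure (modular_measure (dual_weight W e) (dual_weight W e x * b)) (cube a l) \<le> 1"
proof -
  let ?w = "dual_weight W e" and ?Q = "cube a l"
  interpret F: finite_exponent "\<lambda>y. ennreal (1 * t y)" "\<lambda>y. 1 * t y" by (rule finite_exponent_scaled) simp
  have wx: "0 < ?w x" by (rule dual_weight_pos[OF e])
  have b0: "0 < b" using b by (metis ennreal_neg not_le not_less_zero)
  have "emeasure (modular_measure ?w (?w x * b)) ?Q = (\<integral>\<^sup>+y\<in>?Q. ennreal ((?w y / (?w x * b)) powr t y) \<partial>lebesgue)"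
    by (rule emeasure_modular_measure) (use dual_weight_measurable[OF W_meas] in auto)
  also have "\<dots> \<le> (\<integral>\<^sup>+y. ennreal_powr (ennreal (op_norm (W x ** matrix_inv (W y))) * indicator ?Q y / ennreal b) (1 * t y) \<partial>lebesgue)"
  proof (rule nn_integral_mono_AE, use W_det in eventually_elim)
    fix y assume y: "det (W y) \<noteq> 0"
    let ?o = "op_norm (W x ** matrix_inv (W y))"
    have "?w y \<le> ?o * ?w x" by (rule dual_weight_ratio[OF x y W_sym W_sym])
    then have "?w y / (?w x * b) \<le> ?o / b" using wx b0 by (simp add: field_simps)
    then have "(?w y / (?w x * b)) powr t y \<le> (?o / b) powr t y"
      using wx b0 t_ge1[of y] dual_weight_pos[OF e, of W y] by (intro powr_mono2) (auto intro: less_imp_le)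
    then show "ennreal ((?w y / (?w x * b)) powr t y) * indicator ?Q y
        \<le> ennreal_powr (ennreal ?o * indicator ?Q y / ennreal b) (1 * t y)"
      using b0 op_norm_nonneg by (auto simp: indicator_def divide_ennreal ennreal_powr_ennreal intro!: ennreal_leI)
  qed
  also have "\<dots> \<le> 1" using F.Lp_norm_lessD b unfolding inner_norm_def by blast
  finally show ?thesis .
qed

lemma nrm_dual_weight_le:
  assumes w: "weight (dual_weight W e)" and l: "0 < l" and x: "det (W x) \<noteq> 0" and e: "e \<noteq> 0"
  shows "ennreal (nrm (dual_weight W e) (cube a l)) \<le> ennreal (dual_weight W e x) * inner_norm 1 (cube a l) x"
proof -
  let ?w = "dual_weight W e" and ?F = "inner_norm 1 (cube a l) x"
  have wx: "0 < ?w x" by (rule dual_weight_pos[OF e])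
  show ?thesis
  proof (cases "?F = top")
    case True
    then show ?thesis using wx by (simp add: ennreal_mult_top)
  next
    case False
    then obtain f where f: "0 \<le> f" "?F = ennreal f" by (cases ?F) auto
    have "nrm ?w (cube a l) \<le> ?w x * f + d" if d: "0 < d" for d
    proof -
      define b where "b = f + d / ?w x"
      have b: "f < b" using d wx by (simp add: b_def)
      then have "?F < ennreal b" using f by (simp add: ennreal_less_iff)
      from dual_modular_le_1[OF x e this]
      have "ennreal (V ?w (?w x * b) (cube a l)) \<le> ennreal 1"
        using emeasure_V[OF w bounded_cube[OF l], of "?w x * b" a] wx b f by simp
      then have "V ?w (?w x * b) (cube a l) \<le> 1" by (subst (asm) ennreal_le_iff) auto
      then have "nrm ?w (cube a l) \<le> ?w x * b" using wx b f by (intro norm_le_if_modular_le_1[OF w l]) auto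
      also have "\<dots> = ?w x * f + d" using wx by (simp add: b_def distrib_left)
      finally show ?thesis .
    qed
    then have "nrm ?w (cube a l) \<le> ?w x * f" by (rule field_le_epsilon)
    then show ?thesis using f wx by (simp add: ennreal_mult'[symmetric] ennreal_leI)
  qed
qed

text \<open>By the previous bound the outer norm of \<open>inner_norm\<close> dominates the product of the norms of the dual weight and
  of its reciprocal, with a constant that is the same for all \<open>e\<close>. Local integrability of the weight comes
  from the existence of a single point of the cube where the inner norm is finite.\<close>

lemma dual_weight_admissible:
  assumes pr: "\<And>x. pr x = t x / (t x - 1)" and K: "1 \<le> K"
    and A: "\<And>a l. 0 < l \<Longrightarrow> (\<integral>\<^sup>+x. ennreal_powr (inner_norm 1 (cube a l) x * indicator (cube a l) x / ennreal (K * l ^ CARD('n))) (pr x) \<partial>lebesgue) \<le> 1"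
    and e: "e \<noteq> 0"
  shows "admissible (1 / (2 * K)) (dual_weight W e)"
proof -
  let ?w = "dual_weight W e"
  have wm [measurable]: "?w \<in> borel_measurable lebesgue" by (rule dual_weight_measurable[OF W_meas])
  have wp: "0 < ?w x" for x by (rule dual_weight_pos[OF e])
  \<comment> \<open>Otherwise the integrand of the outer modular would be infinite almost everywhere on the cube.\<close>
  have ex: "\<exists>x. det (W x) \<noteq> 0 \<and> inner_norm 1 (cube a l) x < \<infinity>" if l: "0 < l" for a l
  proof (rule ccontr)
    assume none: "\<nexists>x. det (W x) \<noteq> 0 \<and> inner_norm 1 (cube a l) x < \<infinity>"
    have kp: "0 < K * l ^ CARD('n)" using K l by simp
    have "(\<integral>\<^sup>+x. top * indicator (cube a l) x \<partial>lebesgue)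
        \<le> (\<integral>\<^sup>+x. ennreal_powr (inner_norm 1 (cube a l) x * indicator (cube a l) x / ennreal (K * l ^ CARD('n))) (pr x) \<partial>lebesgue)"
    proof (rule nn_integral_mono_AE, use W_det in eventually_elim)
      fix x assume "det (W x) \<noteq> 0"
      then have "inner_norm 1 (cube a l) x = top" using none by (metis less_top infinity_ennreal_def)
      then show "top * indicator (cube a l) x \<le> ennreal_powr (inner_norm 1 (cube a l) x * indicator (cube a l) x / ennreal (K * l ^ CARD('n))) (pr x)"
        by (simp add: indicator_def ennreal_top_divide)
    qed
    also have "\<dots> \<le> 1" by (rule A[OF l])
    finally have "(\<integral>\<^sup>+x. top * indicator (cube a l) x \<partial>lebesgue) \<le> 1" .
    moreover have "(\<integral>\<^sup>+x. top * indicator (cube a l) x \<partial>lebesgue) = top * emeasure lebesgue (cube a l)"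
      by (rule nn_integral_cmult_indicator) simp
    moreover have "\<dots> = top" using l by (simp add: emeasure_cube ennreal_top_mult)
    ultimately show False by (simp add: top_unique)
  qed
  have w: "weight ?w"
    unfolding weight_def
  proof (intro conjI allI impI wm wp)
    fix a :: "real^'n" and l :: real assume l: "0 < l"
    obtain x where x: "det (W x) \<noteq> 0" "inner_norm 1 (cube a l) x < \<infinity>" using ex[OF l] by blast
    then obtain f where f: "0 \<le> f" "inner_norm 1 (cube a l) x = ennreal f" by (cases "inner_norm 1 (cube a l) x") auto
    define b where "b = ?w x * (f + 1)"
    have b: "0 < b" using wp[of x] f by (simp add: b_def)
    have "inner_norm 1 (cube a l) x < ennreal (f + 1)" using f by (simp add: ennreal_less_iff)
    then have le1: "emeasure (modular_measure ?w b) (cube a l) \<le> 1"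
      unfolding b_def by (rule dual_modular_le_1[OF x(1) e])
    have "(b / 1) powr t y \<le> max 1 b powr P" for y
    proof -
      have "(b / 1) powr t y \<le> max 1 b powr t y" using b t_ge1[of y] by (intro powr_mono2) auto
      also have "\<dots> \<le> max 1 b powr P" using t_le by (intro powr_mono) auto
      finally show ?thesis .
    qed
    then have "emeasure (modular_measure ?w 1) (cube a l) \<le> ennreal (max 1 b powr P) * emeasure (modular_measure ?w b) (cube a l)"
      by (intro emeasure_compare wm wp b) auto
    also have "\<dots> \<le> ennreal (max 1 b powr P) * 1" by (intro mult_left_mono le1) simp
    finally show "emeasure (modular_measure ?w 1) (cube a l) < \<infinity>" by (simp add: le_less_trans)
  qed
  show ?thesis
  proof (rule admissible_if_norm_product[OF w K t_gt1 _ pr])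
    show "pr \<in> borel_measurable lebesgue" unfolding pr[abs_def] by measurable
    fix a :: "real^'n" and l :: real assume l: "0 < l"
    let ?Q = "cube a l"
    define N where "N = nrm ?w ?Q"
    define \<kappa> where "\<kappa> = K * l ^ CARD('n)"
    have N: "0 < N" using nrm_pos[OF w l] by (simp add: N_def)
    have k: "0 < \<kappa>" using K l by (simp add: \<kappa>_def)
    have "(\<integral>\<^sup>+x\<in>?Q. ennreal ((1 / (?w x * (\<kappa> / N))) powr pr x) \<partial>lebesgue)
        \<le> (\<integral>\<^sup>+x. ennreal_powr (inner_norm 1 ?Q x * indicator ?Q x / ennreal \<kappa>) (pr x) \<partial>lebesgue)"
    proof (rule nn_integral_mono_AE, use W_det in eventually_elim)
      fix x assume x: "det (W x) \<noteq> 0"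
      have prx: "0 \<le> pr x" using t_gt1[of x] by (simp add: pr)
      have "ennreal (N / ?w x) \<le> inner_norm 1 ?Q x"
      proof -
        have "ennreal (1 / ?w x) * ennreal N \<le> ennreal (1 / ?w x) * (ennreal (?w x) * inner_norm 1 ?Q x)"
          unfolding N_def by (intro mult_left_mono nrm_dual_weight_le[OF w l x e]) simp
        also have "\<dots> = (ennreal (1 / ?w x) * ennreal (?w x)) * inner_norm 1 ?Q x" by (simp only: mult.assoc)
        also have "ennreal (1 / ?w x) * ennreal (?w x) = 1" using wp[of x] by (simp flip: ennreal_mult' ennreal_1)
        finally show ?thesis using wp[of x] N by (simp flip: ennreal_mult')
      qed
      then have "ennreal (N / ?w x) / ennreal \<kappa> \<le> inner_norm 1 ?Q x / ennreal \<kappa>" by (rule divide_right_mono_ennreal)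
      moreover have "ennreal (N / ?w x) / ennreal \<kappa> = ennreal (1 / (?w x * (\<kappa> / N)))"
        using N k wp[of x] by (simp add: divide_ennreal)
      ultimately have "ennreal_powr (ennreal (1 / (?w x * (\<kappa> / N)))) (pr x) \<le> ennreal_powr (inner_norm 1 ?Q x / ennreal \<kappa>) (pr x)"
        using prx by (intro ennreal_powr_mono) auto
      moreover have "ennreal_powr (ennreal (1 / (?w x * (\<kappa> / N)))) (pr x) = ennreal ((1 / (?w x * (\<kappa> / N))) powr pr x)"
        using N k wp[of x] by (intro ennreal_powr_ennreal) simp
      ultimately show "ennreal ((1 / (?w x * (\<kappa> / N))) powr pr x) * indicator ?Q x
          \<le> ennreal_powr (inner_norm 1 ?Q x * indicator ?Q x / ennreal \<kappa>) (pr x)"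
        by (simp add: indicator_def)
    qed
    also have "\<dots> \<le> 1" unfolding \<kappa>_def by (rule A[OF l])
    finally have "(\<integral>\<^sup>+x\<in>?Q. ennreal ((1 / (?w x * (\<kappa> / N))) powr pr x) \<partial>lebesgue) \<le> 1" .
    moreover have "N * (\<kappa> / N) \<le> K * l ^ CARD('n)" using N by (simp add: \<kappa>_def)
    moreover have "0 < \<kappa> / N" using N k by simp
    ultimately show "\<exists>B>0. (\<integral>\<^sup>+x\<in>?Q. ennreal ((1 / (?w x * B)) powr pr x) \<partial>lebesgue) \<le> 1 \<and> nrm ?w ?Q * B \<le> K * l ^ CARD('n)"
      unfolding N_def by blast
  qed
qed

text \<open>The reverse Hoelder inequality is applied to the \<open>d\<close> weights \<open>dual_weight W (W x *v axis i 1)\<close>. They depend on \<open>x\<close>, and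
  it is here that uniformity in \<open>e\<close> is needed. Their norms are at most \<open>inner_norm 1\<close> at \<open>x\<close>, since each
  of them takes the value 1 at \<open>x\<close>.\<close>

lemma inner_norm_improvement:
  fixes C M s :: real
  assumes adm: "\<And>e. e \<noteq> 0 \<Longrightarrow> weight (dual_weight W e)" and l: "0 < l" and s: "1 \<le> s" and M: "0 < M" and C: "1 \<le> C"
    and rh: "\<And>e. e \<noteq> 0 \<Longrightarrow> (\<integral>\<^sup>+y\<in>cube a l. ennreal ((dual_weight W e y / nrm (dual_weight W e) (cube a l) * M powr (1 - 1/s)) powr (s * t y)) \<partial>lebesgue) \<le> ennreal C"
    and x: "det (W x) \<noteq> 0"
  shows "inner_norm s (cube a l) x \<le> ennreal (CARD('d) * (CARD('d) * C) * M powr (1/s - 1)) * inner_norm 1 (cube a l) x"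
proof (cases "inner_norm 1 (cube a l) x = top")
  case True
  define X where "X = CARD('d) * (CARD('d) * C) * M powr (1/s - 1)"
  have "0 < X" using C M by (simp add: X_def)
  then show ?thesis unfolding X_def[symmetric] using True by (simp add: ennreal_mult_top)
next
  case False
  let ?Q = "cube a l"
  define d where "d = real CARD('d)"
  have d: "1 \<le> d" unfolding d_def by (rule one_le_dim)
  obtain f where f: "0 \<le> f" "inner_norm 1 ?Q x = ennreal f" using False by (cases "inner_norm 1 ?Q x") auto
  define w where "w i = dual_weight W (W x *v axis i 1)" for i
  have ei: "W x *v axis i 1 \<noteq> 0" for i by (rule image_axis_nonzero[OF x])
  have wt: "weight (w i)" for i unfolding w_def by (rule adm[OF ei])
  have wm [measurable]: "w i \<in> borel_measurable lebesgue" and wp: "0 < w i y" for i y using wt[of i] by (auto simp: weight_def)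
  define N where "N i = nrm (w i) ?Q" for i
  have N: "0 < N i" for i unfolding N_def by (rule nrm_pos[OF wt l])
  have Nf: "N i \<le> f" for i
    using nrm_dual_weight_le[OF adm[OF ei] l x ei, of i a] f dual_weight_self[where W=W and x=x and i=i, OF x]
    by (simp add: N_def w_def)
  have f0: "0 < f" using N[of undefined] Nf[of undefined] by linarith
  define D where "D = d * C"
  have "1 * 1 \<le> d * C" using d C by (intro mult_mono) auto
  then have D: "1 \<le> D" by (simp add: D_def)
  define L where "L = d * D * M powr (1/s - 1) * f"
  have lam: "0 < L" using d D M f0 by (simp add: L_def)
  define z where "z i y = (w i y / N i * M powr (1 - 1/s)) powr (s * t y)" for i y
  have zm [measurable]: "z i \<in> borel_measurable lebesgue" for i unfolding z_def by measurable
  have zint: "(\<integral>\<^sup>+y\<in>?Q. ennreal (z i y) \<partial>lebesgue) \<le> ennreal C" for i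
    using rh[OF ei[of i]] by (simp add: z_def w_def N_def)
  interpret F: finite_exponent "\<lambda>y. ennreal (s * t y)" "\<lambda>y. s * t y" by (rule finite_exponent_scaled[OF s])
  have "inner_norm s ?Q x \<le> ennreal L"
    unfolding inner_norm_def
  proof (rule F.Lp_norm_leI[OF lam])
    have "(\<integral>\<^sup>+y. ennreal_powr (ennreal (op_norm (W x ** matrix_inv (W y))) * indicator ?Q y / ennreal L) (s * t y) \<partial>lebesgue)
        \<le> (\<integral>\<^sup>+y. ennreal (1 / D) * (\<Sum>i\<in>UNIV. ennreal (z i y) * indicator ?Q y) \<partial>lebesgue)"
    proof (rule nn_integral_mono_AE, use W_det in eventually_elim)
      fix y assume y: "det (W y) \<noteq> 0"
      let ?o = "op_norm (W x ** matrix_inv (W y))"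
      show "ennreal_powr (ennreal ?o * indicator ?Q y / ennreal L) (s * t y)
          \<le> ennreal (1 / D) * (\<Sum>i\<in>UNIV. ennreal (z i y) * indicator ?Q y)"
      proof (cases "y \<in> ?Q")
        case True
        have st: "1 \<le> s * t y" using mult_mono[of 1 s 1 "t y"] s t_ge1[of y] by simp
        have "?o \<le> (\<Sum>i\<in>UNIV. w i y)" unfolding w_def by (rule op_norm_le_sum_dual_weights[where W=W and x=x and y=y, OF y W_sym W_sym])
        moreover obtain i where i: "w i y = Max (range (\<lambda>i. w i y))"
          using Max_in[of "range (\<lambda>i. w i y)"] by fastforce
        have "(\<Sum>j\<in>UNIV. w j y) \<le> of_nat CARD('d) * w i y"
          unfolding i by (rule sum_bounded_above) simp
        ultimately have o: "?o \<le> d * w i y" by (simp add: d_def)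
        have "?o / L \<le> d * w i y / L" using o lam by (intro divide_right_mono) auto
        also have "\<dots> = (1 / D) * (w i y / f * M powr (1 - 1/s))"
        proof -
          have "M powr (1/s - 1) * M powr (1 - 1/s) = 1" using M by (simp add: powr_add[symmetric])
          then have "M powr (1 - 1/s) = 1 / M powr (1/s - 1)" using M by (simp add: field_simps)
          then show ?thesis using d by (simp add: L_def)
        qed
        also have "\<dots> \<le> (1 / D) * (w i y / N i * M powr (1 - 1/s))"
          using D Nf[of i] N[of i] wp[of i y] f0 by (intro mult_left_mono mult_right_mono divide_left_mono) auto
        finally have "(?o / L) powr (s * t y) \<le> ((1 / D) * (w i y / N i * M powr (1 - 1/s))) powr (s * t y)"
          using lam op_norm_nonneg st by (intro powr_mono2) auto
        also have "\<dots> = (1 / D) powr (s * t y) * z i y" by (simp only: powr_mult z_def)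
        also have "\<dots> \<le> (1 / D) powr 1 * z i y"
          using D st by (intro mult_right_mono powr_mono') (auto simp: z_def)
        also have "\<dots> \<le> 1 / D * (\<Sum>i\<in>UNIV. z i y)"
          using D by (auto intro!: mult_left_mono member_le_sum divide_right_mono simp: z_def)
        finally have "ennreal ((?o / L) powr (s * t y)) \<le> ennreal (1 / D * (\<Sum>i\<in>UNIV. z i y))" by (rule ennreal_leI)
        also have "\<dots> = ennreal (1 / D) * (\<Sum>i\<in>UNIV. ennreal (z i y))"
          using D by (subst ennreal_mult') (auto simp: z_def sum_ennreal)
        finally show ?thesis using True lam op_norm_nonneg by (simp add: divide_ennreal ennreal_powr_ennreal)
      qed simp
    qed
    also have "\<dots> = ennreal (1 / D) * (\<integral>\<^sup>+y. (\<Sum>i\<in>UNIV. ennreal (z i y) * indicator ?Q y) \<partial>lebesgue)"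
      by (rule nn_integral_cmult) measurable
    also have "(\<integral>\<^sup>+y. (\<Sum>i\<in>UNIV. ennreal (z i y) * indicator ?Q y) \<partial>lebesgue)
        = (\<Sum>i\<in>UNIV. \<integral>\<^sup>+y\<in>?Q. ennreal (z i y) \<partial>lebesgue)"
      by (rule nn_integral_sum) measurable
    also have "ennreal (1 / D) * (\<Sum>i\<in>UNIV. \<integral>\<^sup>+y\<in>?Q. ennreal (z i y) \<partial>lebesgue)
        \<le> ennreal (1 / D) * (\<Sum>i\<in>(UNIV :: 'd set). ennreal C)"
      by (intro mult_left_mono sum_mono zint) simp
    also have "\<dots> = ennreal (1 / D * (d * C))"
      using D C by (simp add: d_def ennreal_of_nat_eq_real_of_nat flip: ennreal_mult')
    also have "1 / D * (d * C) = 1" using d C by (simp add: D_def)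
    finally show "(\<integral>\<^sup>+y. ennreal_powr (ennreal (op_norm (W x ** matrix_inv (W y))) * indicator ?Q y / ennreal L) (s * t y) \<partial>lebesgue) \<le> 1"
      by simp
  qed
  also have "ennreal L = ennreal (CARD('d) * (CARD('d) * C) * M powr (1/s - 1)) * ennreal f"
    unfolding L_def D_def d_def using f C by (subst ennreal_mult'[symmetric]) auto
  finally show ?thesis by (simp add: f)
qed

text \<open>Young's inequality with the exponents \<open>p/q\<close> and \<open>u/q\<close>, where \<open>1/q = 1/p + 1/u\<close> and \<open>u = t / (1 - 1/s)\<close>.\<close>

lemma young_outer:
  assumes s: "1 < s" and a: "0 \<le> a" and M: "0 < M"
  shows "(a * M powr (1/s - 1)) powr (s * t x / (s * t x - 1)) \<le> a powr (t x / (t x - 1)) + M powr - t x"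
proof -
  have tx: "1 < t x" by (rule t_gt1)
  define q where "q = s * t x / (s * t x - 1)"
  have st: "1 < s * t x" using s tx by (smt (verit) mult_le_cancel_right1)
  define \<alpha> where "\<alpha> = (s * t x - 1) / (s * (t x - 1))"
  define \<beta> where "\<beta> = (s * t x - 1) / (s - 1)"
  have al: "1 < \<alpha>" using s tx by (simp add: \<alpha>_def right_diff_distrib)
  have be: "1 < \<beta>" using s st tx by (simp add: \<beta>_def)
  have conj: "1 / \<alpha> + 1 / \<beta> = 1"
  proof -
    have "1 / \<alpha> + 1 / \<beta> = (s * (t x - 1) + (s - 1)) / (s * t x - 1)" by (simp add: \<alpha>_def \<beta>_def add_divide_distrib)
    also have "s * (t x - 1) + (s - 1) = s * t x - 1" by (simp add: algebra_simps)
    finally show ?thesis using st by simp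
  qed
  have qa: "q * \<alpha> = t x / (t x - 1)" using s st tx by (simp add: q_def \<alpha>_def)
  have qb: "(1/s - 1) * (q * \<beta>) = - t x"
  proof -
    have "q * \<beta> = s * t x / (s - 1)" using st by (simp add: q_def \<beta>_def)
    moreover have "1/s - 1 = - (s - 1) / s" using s by (simp add: diff_divide_distrib)
    ultimately show ?thesis using s by (simp add: field_simps)
  qed
  have "(a * M powr (1/s - 1)) powr q = a powr q * (M powr (1/s - 1)) powr q" by (rule powr_mult)
  also have "\<dots> \<le> (a powr q) powr \<alpha> / \<alpha> + ((M powr (1/s - 1)) powr q) powr \<beta> / \<beta>"
    by (rule Youngs_inequality[OF al be conj]) auto
  also have "\<dots> \<le> (a powr q) powr \<alpha> + ((M powr (1/s - 1)) powr q) powr \<beta>"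
    using al be by (intro add_mono) (simp_all add: divide_le_eq mult_le_cancel_left1)
  also have "\<dots> = a powr (t x / (t x - 1)) + M powr - t x"
    by (simp only: powr_powr mult.assoc qa qb)
  finally show ?thesis unfolding q_def .
qed

text \<open>Passing from the outer exponent \<open>p\<close> to the smaller \<open>q\<close> costs by Hoelder's inequality exactly the power of \<open>M\<close>
  gained in the inner norm, because \<open>M\<close> normalises the modular of \<open>1\<close> on the cube.\<close>

lemma outer_norm_improvement:
  assumes s: "1 < s" and l: "0 < l" and k: "0 < \<kappa>" and C: "0 < C"
    and M_def: "M = nrm (\<lambda>_. 1) (cube a l)"
    and q: "\<And>x. q x = ennreal (s * t x / (s * t x - 1))"
    and int: "(\<integral>\<^sup>+x. ennreal_powr (F x * indicator (cube a l) x / ennreal \<kappa>) (t x / (t x - 1)) \<partial>lebesgue) \<le> 1"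
    and le: "AE x in lebesgue. G x \<le> ennreal (C * M powr (1/s - 1)) * F x"
  shows "Lp_norm q (\<lambda>x. G x * indicator (cube a l) x) \<le> ennreal (2 * C * \<kappa>)"
proof -
  let ?Q = "cube a l"
  have M: "0 < M" unfolding M_def by (rule nrm_pos[OF weight_one l])
  define r where "r x = s * t x / (s * t x - 1)" for x
  have st: "1 < s * t x" for x using s t_gt1[of x] by (smt (verit) mult_le_cancel_right1)
  have r1: "1 \<le> r x" for x using st[of x] by (simp add: r_def)
  interpret E: finite_exponent q r
    by unfold_locales (use q r1 in \<open>auto simp: r_def intro: order_trans[OF zero_le_one]\<close>)
  show ?thesis
  proof (rule E.Lp_norm_leI)
    show k2: "0 < 2 * C * \<kappa>" using C k by simp
    define g where "g x = ennreal (M powr - t x) * indicator ?Q x" for x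
    have gm: "g \<in> borel_measurable lebesgue" unfolding g_def by measurable
    have gi: "(\<integral>\<^sup>+x. g x \<partial>lebesgue) = 1"
      unfolding g_def modular_measure_one[OF sets_cube M, symmetric]
      using emeasure_V[OF weight_one bounded_cube[OF l] M] V_nrm[OF weight_one l] by (simp add: M_def)
    define h where "h x = ennreal_powr (F x * indicator ?Q x / ennreal \<kappa>) (t x / (t x - 1))" for x
    have "(\<integral>\<^sup>+x. ennreal_powr (G x * indicator ?Q x / ennreal (2 * C * \<kappa>)) (r x) \<partial>lebesgue)
        \<le> (\<integral>\<^sup>+x. ennreal (1/2) * (h x + g x) \<partial>lebesgue)"
    proof (rule nn_integral_mono_AE, use le in eventually_elim)
      fix x assume GF: "G x \<le> ennreal (C * M powr (1/s - 1)) * F x"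
      show "ennreal_powr (G x * indicator ?Q x / ennreal (2 * C * \<kappa>)) (r x) \<le> ennreal (1/2) * (h x + g x)"
      proof (cases "x \<in> ?Q")
        case False
        then show ?thesis by simp
      next
        case True
        show ?thesis
        proof (cases "F x = top")
          case True2: True
          have "h x = top" using True True2 k by (simp add: h_def ennreal_top_divide)
          then show ?thesis by (simp add: ennreal_mult_top)
        next
          case False
          then obtain f where f: "0 \<le> f" "F x = ennreal f" by (cases "F x") auto
          let ?a = "f / \<kappa>"
          have "G x / ennreal (2 * C * \<kappa>) \<le> ennreal (C * M powr (1/s - 1) * f) / ennreal (2 * C * \<kappa>)"
            using GF C f by (intro divide_right_mono_ennreal) (simp add: ennreal_mult'[symmetric])
          also have "\<dots> = ennreal (1/2 * (?a * M powr (1/s - 1)))"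
            using C k f by (subst divide_ennreal) (auto simp: field_simps)
          finally have "ennreal_powr (G x / ennreal (2 * C * \<kappa>)) (r x) \<le> ennreal_powr (ennreal (1/2 * (?a * M powr (1/s - 1)))) (r x)"
            using r1[of x] by (intro ennreal_powr_mono) auto
          also have "\<dots> = ennreal ((1/2 * (?a * M powr (1/s - 1))) powr r x)"
            using f k by (intro ennreal_powr_ennreal) auto
          also have "(1/2 * (?a * M powr (1/s - 1))) powr r x = (1/2) powr r x * (?a * M powr (1/s - 1)) powr r x"
            by (rule powr_mult)
          also have "ennreal \<dots> \<le> ennreal ((1/2) powr 1 * (?a powr (t x / (t x - 1)) + M powr - t x))"
            using young_outer[OF s _ M, of ?a x] f k r1[of x] unfolding r_def[symmetric]
            by (intro ennreal_leI mult_mono powr_mono') auto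
          also have "\<dots> = ennreal (1/2) * ennreal (?a powr (t x / (t x - 1)) + M powr - t x)"
            by (subst ennreal_mult'[symmetric]) simp_all
          also have "ennreal (?a powr (t x / (t x - 1)) + M powr - t x) = ennreal (?a powr (t x / (t x - 1))) + ennreal (M powr - t x)"
            by (intro ennreal_plus) auto
          also have "ennreal (1/2) * (ennreal (?a powr (t x / (t x - 1))) + ennreal (M powr - t x)) = ennreal (1/2) * (h x + g x)"
            using True f k by (simp add: h_def g_def divide_ennreal ennreal_powr_ennreal del: ennreal_half)
          finally show ?thesis using True by simp
        qed
      qed
    qed
    also have "\<dots> \<le> ennreal (1/2) * (\<integral>\<^sup>+x. h x + g x \<partial>lebesgue)"
      by (rule nn_integral_cmult_le) simp
    also have "\<dots> \<le> ennreal (1/2) * ((\<integral>\<^sup>+x. h x \<partial>lebesgue) + (\<integral>\<^sup>+x. g x \<partial>lebesgue))"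
      by (intro mult_left_mono nn_integral_add_le gm) (auto simp: g_def indicator_def)
    also have "\<dots> \<le> ennreal (1/2) * (1 + 1)"
      using int unfolding gi h_def by (intro mult_left_mono add_mono) auto
    also have "\<dots> = ennreal (1/2) * ennreal 2" by simp
    also have "\<dots> = ennreal (1/2 * 2)" by (rule ennreal_mult'[symmetric]) simp
    also have "\<dots> = 1" by simp
    finally show "(\<integral>\<^sup>+x. ennreal_powr (G x * indicator ?Q x / ennreal (2 * C * \<kappa>)) (r x) \<partial>lebesgue) \<le> 1" .
  qed
qed

end

theorem theorem1p6:
  fixes p :: "real^'n \<Rightarrow> ennreal"
    and W :: "real^'n \<Rightarrow> real^'d^'d"
  assumes "exponent_function p"
    and "\<And>x. p x < \<infinity>"
    and "log_Hoelder (\<lambda>x. enn2real (p x))"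
    and "exponent_minus p > 1"
    and "matrix_weight W"
    and "W \<in> A_class p"
  shows "\<exists>r::real. r > 1 \<and> (\<forall>s\<in>{1..r}. \<forall>q.
           exponent_function q \<and> (\<forall>x. conj_exponent q x = ennreal s * conj_exponent p x)
             \<longrightarrow> W \<in> A_class q)"
proof -
  note p_exp = assms(1) and p_fin = assms(2) and p_lh = assms(3) and p_minus = assms(4)
  define u where "u x = enn2real (p x)" for x
  have p_eq: "p x = ennreal (u x)" for x using p_fin[of x] by (simp add: u_def)
  obtain m where m: "1 < m" "m < exponent_minus p" using dense[OF p_minus] by blast
  then obtain b where mb: "0 \<le> b" "m = ennreal b" by (cases m) auto
  have b1: "1 < b" using m(1) mb by (simp flip: ennreal_1 add: ennreal_less_iff)
  have ub: "b \<le> u x" for x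
    unfolding u_def using exponent_gt_exponent_minus[OF p_fin p_lh] m(2) mb(2) by blast
  have um: "u \<in> borel_measurable lebesgue"
  proof -
    have [measurable]: "p \<in> borel_measurable lebesgue" using p_exp by (simp add: exponent_function_def)
    show ?thesis unfolding u_def[abs_def] by measurable
  qed
  obtain P0 A0 Ai \<tau>0 where lhu: "lh_exponent u P0 A0 Ai \<tau>0" and tau0: "b \<le> \<tau>0"
    using lh_exponent_of_log_Hoelder[OF um _ ub] p_lh b1 unfolding u_def by (metis less_imp_le)
  define t where "t x = u x / (u x - 1)" for x
  define \<tau> where "\<tau> = \<tau>0 / (\<tau>0 - 1)"
  have u1: "1 < u x" for x using ub[of x] b1 by linarith
  have t1: "1 < t x" for x using u1[of x] by (simp add: t_def field_simps)
  have ut: "u x = t x / (t x - 1)" for x using u1[of x] by (simp add: t_def field_simps)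
  have tau1: "1 < \<tau>" "\<tau>0 = \<tau> / (\<tau> - 1)" using tau0 b1 by (simp_all add: \<tau>_def field_simps)
  obtain P C0 Ci where lht: "lh_exponent t P C0 Ci \<tau>"
    using conj_lh_exponent[OF lhu b1 ub tau0] unfolding t_def[abs_def] \<tau>_def by blast
  have conj_p: "conj_exponent p x = ennreal (t x)" for x
    unfolding t_def by (rule conj_exponent_finite[OF p_eq u1])
  have W: "matrix_weight W" "AE x in lebesgue. W x \<in> pd_matrices" "A_const p W < \<infinity>"
    using assms(6) by (auto simp: A_class_def invertible_matrix_weight_def)
  interpret dual_setting t P C0 Ci \<tau> W
  proof (intro dual_setting.intro dual_setting_axioms.intro lht t1)
    show "W \<in> borel_measurable lebesgue" "\<And>x. transpose (W x) = W x"
      using W(1) by (auto simp: matrix_weight_def psd_matrices_def)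
    show "AE x in lebesgue. det (W x) \<noteq> 0" using W(2) by eventually_elim (rule pd_det_nonzero)
  qed
  have inner_p: "Lp_norm (conj_exponent p) (\<lambda>y. ennreal (op_norm (W x ** matrix_inv (W y))) * indicator Q y) = inner_norm 1 Q x" for Q x
    by (simp add: inner_norm_def conj_p[abs_def])
  interpret U: finite_exponent p u
    by unfold_locales (use p_eq u1 in \<open>auto intro: less_imp_le order_trans[OF zero_le_one]\<close>)
  obtain K0 where K0: "0 \<le> K0" "A_const p W = ennreal K0" using W(3) by (cases "A_const p W") auto
  \<comment> \<open>Strictly above the infimum that defines the norm, the modular is at most one.\<close>
  define K where "K = K0 + 1"
  have K: "1 \<le> K" using K0 by (simp add: K_def)
  have outer_p: "(\<integral>\<^sup>+x. ennreal_powr (inner_norm 1 (cube a l) x * indicator (cube a l) x / ennreal (K * l ^ CARD('n))) (u x) \<partial>lebesgue) \<le> 1"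
    if l: "0 < l" for a l
  proof (rule U.Lp_norm_lessD)
    let ?Q = "cube a l" and ?X = "Lp_norm p (\<lambda>x. inner_norm 1 (cube a l) x * indicator (cube a l) x)"
    have pl: "0 < l ^ CARD('n)" using l by simp
    have "?Q \<in> cubes" using l by (auto simp: cubes_def)
    then have "inverse (emeasure lebesgue ?Q) * ?X \<le> ennreal K0"
      unfolding K0(2)[symmetric] A_const_def inner_p by (rule SUP_upper)
    then have "ennreal (l ^ CARD('n)) * (inverse (ennreal (l ^ CARD('n))) * ?X) \<le> ennreal (l ^ CARD('n)) * ennreal K0"
      using l by (intro mult_left_mono) (simp_all add: emeasure_cube)
    moreover have "ennreal (l ^ CARD('n)) * inverse (ennreal (l ^ CARD('n))) = 1"
      using l by (simp add: inverse_ennreal flip: ennreal_mult' ennreal_1)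
    ultimately have "?X \<le> ennreal (l ^ CARD('n)) * ennreal K0" by (simp add: mult.assoc[symmetric])
    also have "\<dots> = ennreal (K0 * l ^ CARD('n))" using pl K0 by (simp add: mult.commute flip: ennreal_mult')
    also have "\<dots> < ennreal (K * l ^ CARD('n))" using pl K0 by (intro ennreal_lessI) (auto simp: K_def)
    finally show "?X < ennreal (K * l ^ CARD('n))" .
  qed
  have adm_w: "admissible (1 / (2 * K)) (dual_weight W e)" if "e \<noteq> 0" for e
    by (rule dual_weight_admissible[OF ut K outer_p that])
  have lhu': "lh_exponent (\<lambda>x. t x / (t x - 1)) P0 A0 Ai (\<tau> / (\<tau> - 1))"
    using lhu by (simp only: ut[abs_def, symmetric] tau1(2)[symmetric])
  obtain c1 where c1: "admissible c1 (\<lambda>_. 1)"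
    using admissible_one[OF lht lhu' t1 tau1(1)] by blast
  define c where "c = min c1 (1 / (2 * K))"
  have c: "0 < c" "c \<le> 1" "c \<le> c1" "c \<le> 1 / (2 * K)"
    using admissibleD(2,3)[OF c1] K by (auto simp: c_def)
  have adm1: "admissible c (\<lambda>_. 1)" by (rule admissible_antimono[OF c1 c(1,3)])
  have adm: "admissible c (dual_weight W e)" if "e \<noteq> 0" for e
    by (rule admissible_antimono[OF adm_w[OF that] c(1,4)])
  obtain C r where C: "1 \<le> C" and r: "1 < r" and rh: "\<And>w a l s. admissible c w \<Longrightarrow> 0 < l \<Longrightarrow> s \<in> {1..r} \<Longrightarrow>
     (\<integral>\<^sup>+x\<in>cube a l. ennreal ((w x / nrm w (cube a l) * nrm (\<lambda>_. 1) (cube a l) powr (1 - 1/s)) powr (s * t x)) \<partial>lebesgue) \<le> ennreal C"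
    using reverse_hoelder[OF c(1,2) adm1] by blast
  have "W \<in> A_class q" if s: "s \<in> {1..r}" and q: "exponent_function q" "\<And>x. conj_exponent q x = ennreal s * conj_exponent p x" for s q
  proof -
    have inv: "conj_exponent (conj_exponent v) = v" if "exponent_function v" for v :: "real^'n \<Rightarrow> ennreal"
      using conj_exponent_unique[OF that, of "conj_exponent v"]
        conj_exponent_unique[OF exponent_function_conj[OF that], of v]
      by (simp add: add.commute)
    show ?thesis
    proof (cases "s = 1")
      case True
      then have "conj_exponent q = conj_exponent p" using q(2) by auto
      then have "q = p" using inv[OF q(1)] inv[OF p_exp] by metis
      then show ?thesis using assms(6) by simp
    next
      case False
      then have s1: "1 < s" using s by simp
      have cq: "conj_exponent q x = ennreal (s * t x)" for x
        using s t1[of x] by (simp add: q(2) conj_p ennreal_mult')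
      have st: "1 < s * t x" for x using s1 t1[of x] by (smt (verit) mult_le_cancel_right1)
      have q_eq: "q x = ennreal (s * t x / (s * t x - 1))" for x
        using conj_exponent_finite[where p="conj_exponent q" and x=x, OF cq st] inv[OF q(1)] by metis
      have inner_q: "Lp_norm (conj_exponent q) (\<lambda>y. ennreal (op_norm (W x ** matrix_inv (W y))) * indicator Q y) = inner_norm s Q x" for Q x
        by (simp add: inner_norm_def cq[abs_def])
      define D where "D = CARD('d) * (CARD('d) * C)"
      have D: "0 < D" using C by (simp add: D_def)
      have "A_const q W \<le> ennreal (2 * D * K)"
        unfolding A_const_def
      proof (rule SUP_least)
        fix Q :: "(real^'n) set" assume "Q \<in> cubes"
        then obtain a l where l: "0 < l" and Q: "Q = cube a l" by (auto simp: cubes_def)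
        have pl: "0 < l ^ CARD('n)" using l by simp
        define M where "M = nrm (\<lambda>_. 1) Q"
        have M: "0 < M" unfolding M_def Q by (rule nrm_pos[OF weight_one l])
        have "Lp_norm q (\<lambda>x. inner_norm s Q x * indicator Q x) \<le> ennreal (2 * D * (K * l ^ CARD('n)))"
          unfolding Q
        proof (rule outer_norm_improvement[OF s1 l _ D M_def[unfolded Q] q_eq])
          show "0 < K * l ^ CARD('n)" using K pl by simp
          show "(\<integral>\<^sup>+x. ennreal_powr (inner_norm 1 (cube a l) x * indicator (cube a l) x / ennreal (K * l ^ CARD('n))) (t x / (t x - 1)) \<partial>lebesgue) \<le> 1"
            using outer_p[OF l, of a] by (simp only: ut)
          show "AE x in lebesgue. inner_norm s (cube a l) x \<le> ennreal (D * M powr (1/s - 1)) * inner_norm 1 (cube a l) x"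
            using W_det
          proof eventually_elim
            case (elim x)
            show ?case unfolding D_def
              by (rule inner_norm_improvement[OF admissibleD(1)[OF adm] l _ M C _ elim])
                 (use s rh[OF adm l s] in \<open>auto simp: M_def Q\<close>)
          qed
        qed
        then have "inverse (emeasure lebesgue Q) * Lp_norm q (\<lambda>x. inner_norm s Q x * indicator Q x)
            \<le> inverse (ennreal (l ^ CARD('n))) * ennreal (2 * D * (K * l ^ CARD('n)))"
          using l by (intro mult_mono) (auto simp: Q emeasure_cube)
        also have "\<dots> = ennreal (2 * D * K)"
          using l D K by (simp add: inverse_ennreal field_simps flip: ennreal_mult')
        finally show "inverse (emeasure lebesgue Q) * Lp_norm q (\<lambda>x. Lp_norm (conj_exponent q)
            (\<lambda>y. ennreal (op_norm (W x ** matrix_inv (W y))) * indicator Q y) * indicator Q x) \<le> ennreal (2 * D * K)"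
          unfolding inner_q .
      qed
      then have "A_const q W < \<infinity>" by (simp add: le_less_trans)
      then show ?thesis using W by (simp add: A_class_def invertible_matrix_weight_def)
    qed
  qed
  then show ?thesis using r by blast
qed

end
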